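(* Consider the randomized urn model $(C_0,(\chi_n,R_n)_{n\ge 1})$ with $K$ colors, configuration vectors $C_n$, total contents $S_n$, count vectors $N_n$ and filtration $(\mathcal F_n)_{n\ge 0}$ as described in the context (including the basic assumptions (i)--(iv) there). Let $\widetilde H_{n-1}:=\mathbb E\left(R_n\mathbf 1_{\{\rho(R_n)\le n\}}\mid\mathcal F_{n-1}\right)$, $n\ge1$. Assume: (1) There exists a (possibly random) $K\times K$ matrix $H$ with nonnegative entries, almost surely irreducible, such that $\frac1n\sum_{k=0}^{n-1}\rho(\widetilde H_k-H)\to0$ almost surely. (2) At least one of the following holds: (a) there exist $c\in(0,\infty)$ and a positive random variable $R$ with $\mathbb E(R)<\infty$ such that $\mathbb P(\rho(R_n)>x)\le c\,\mathbb P(R>x)$ for all $x>0$ and all $n\ge1$; (b) there is a nonnegative function $\phi$ on $[0,\infty)$ which is eventually positive and nondecreasing, with $\sum_n \frac{1}{n\phi(n)}<\infty$ (sum over all sufficiently large $n$) and $x/\phi(x)$ eventually nondecreasing, such that $\sup_{n\ge1}\mathbb E\left(\rho(R_n)\phi(\rho(R_n))\right)<\infty$. Let $\lambda_H$ be the dominant eigenvalue of $H$ and $\pi_H$ the unique left eigenvector of $H$ for $\lambda_H$ which has all coordinates strictly positive and is normalized to be a probability vector. Then, as $n\to\infty$, almost surely as well as in $L^1$, $$\frac{C_n}{S_n}\to\pi_H,\qquad \frac{S_n}{n}\to\lambda_H,\qquad \frac{C_n}{n}\to\lambda_H\pi_H,\qquad \frac{N_n}{n}\to\pi_H .$$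
   Context: Vectors are row vectors; $[K]=\{1,\dots,K\}$; $e_i$ is the $i$-th coordinate vector of $\mathbb R^K$. For a matrix $A$, $\rho(A):=\max_i\sum_j|A_{ij}|$. A square matrix $A$ with nonnegative entries is irreducible if for all $i,j\in[K]$ there is a positive integer $N$ (depending on $i,j$) such that the $(i,j)$ entry of $A^N$ is positive. The dominant eigenvalue of an irreducible matrix is its eigenvalue with largest real part; by Perron--Frobenius it is simple and positive with strictly positive left and right eigenvectors. Urn model: on a probability space, $C_0$ is a random vector in $\mathbb R^K$, $(R_n)_{n\ge1}$ are random $K\times K$ matrices with nonnegative entries (replacement matrices), and $(\chi_n)_{n\ge1}$ are random vectors with values in $\{e_1,\dots,e_K\}$ (the color drawn at trial $n$). The configuration vectors $C_n=(C_{n1},\dots,C_{nK})$ satisfy $C_n=C_{n-1}+\chi_nR_n$ for $n\ge1$; $S_n=\sum_{i=1}^KC_{ni}$; $N_n=\sum_{k=1}^n\chi_k$. $\mathcal F_n$ is the $\sigma$-field generated by $C_0$ and $(R_m,\chi_m)_{m=1}^n$ (so $\mathcal F_0=\sigma(C_0)$). Basic assumptions: (i) $C_0$ is almost surely nonzero with nonnegative entries, and has finite mean; (ii) for $n\ge1$, $i\in[K]$, $\mathbb P(\chi_n=e_i\mid\mathcal F_{n-1})=C_{n-1,i}/S_{n-1}$; (iii) each $R_n$ has finite mean; (iv) for each $n\ge 1$, $\chi_n$ and $R_n$ are conditionally independent given $\mathcal F_{n-1}$. *)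

theory Defs
  imports "HOL-Probability.Probability"
begin

section \<open>Matrices\<close>

definition max_row_sum :: "real^'k^'k \<Rightarrow> real" where
  "max_row_sum A = (MAX i. \<Sum>j\<in>UNIV. \<bar>A $ i $ j\<bar>)"

primrec matrix_power :: "real^'k^'k \<Rightarrow> nat \<Rightarrow> real^'k^'k" where
  "matrix_power A 0 = mat 1"
| "matrix_power A (Suc n) = A ** matrix_power A n"

definition nonneg_matrix :: "real^'k^'k \<Rightarrow> bool" where
  "nonneg_matrix A \<longleftrightarrow> (\<forall>i j. 0 \<le> A $ i $ j)"

definition irreducible_matrix :: "real^'k^'k \<Rightarrow> bool" where
  "irreducible_matrix A \<longleftrightarrow>
     nonneg_matrix A \<and> (\<forall>i j. \<exists>N>0. 0 < matrix_power A N $ i $ j)"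

definition complex_eigenvalue :: "real^'k^'k \<Rightarrow> complex \<Rightarrow> bool" where
  "complex_eigenvalue A z \<longleftrightarrow>
     (\<exists>v. v \<noteq> 0 \<and> (\<chi> i j. complex_of_real (A $ i $ j)) *v v = z *s v)"

text \<open>By Perron--Frobenius, the eigenvalue of largest real part among all complex eigenvalues
  of an irreducible matrix is real, so it can be returned as a real number. Both notions below are
  meant for irreducible matrices only; the value 0 elsewhere is a convention which makes them
  total, and it matters only on a null event when the matrix is almost surely irreducible.\<close>

definition dominant_eigenvalue :: "real^'k^'k \<Rightarrow> real" where
  "dominant_eigenvalue A =
     (if irreducible_matrix A
      then THE l. complex_eigenvalue A (complex_of_real l) \<and>
                  (\<forall>z. complex_eigenvalue A z \<longrightarrow> Re z \<le> l)
      else 0)"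

definition left_prob_eigenvector :: "real^'k^'k \<Rightarrow> real^'k" where
  "left_prob_eigenvector A =
     (if irreducible_matrix A
      then THE p. p v* A = dominant_eigenvalue A *s p \<and>
                  (\<forall>i. 0 < p $ i) \<and> (\<Sum>i\<in>UNIV. p $ i) = 1
      else 0)"


section \<open>Probability\<close>

definition cond_prob_sigma :: "'w measure \<Rightarrow> 'w measure \<Rightarrow> 'w set \<Rightarrow> 'w \<Rightarrow> real" where
  "cond_prob_sigma M F A = real_cond_exp M F (indicat_real A)"

definition cond_indep_var ::
    "'w measure \<Rightarrow> 'w measure \<Rightarrow> ('w \<Rightarrow> 'a::topological_space) \<Rightarrow> ('w \<Rightarrow> 'b::topological_space) \<Rightarrow> bool"
  where
  "cond_indep_var M F X Y \<longleftrightarrow>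
     (\<forall>A\<in>sets borel. \<forall>B\<in>sets borel. AE w in M.
        cond_prob_sigma M F {u \<in> space M. X u \<in> A \<and> Y u \<in> B} w =
        cond_prob_sigma M F {u \<in> space M. X u \<in> A} w *
        cond_prob_sigma M F {u \<in> space M. Y u \<in> B} w)"

definition tendsto_L1 ::
    "'w measure \<Rightarrow> (nat \<Rightarrow> 'w \<Rightarrow> 'a::{banach, second_countable_topology}) \<Rightarrow> ('w \<Rightarrow> 'a) \<Rightarrow> bool"
  where
  "tendsto_L1 M X L \<longleftrightarrow>
     (\<forall>n. integrable M (X n)) \<and> integrable M L \<and>
     (\<lambda>n. \<integral>w. norm (X n w - L w) \<partial>M) \<longlonglongrightarrow> 0"

definition tendsto_as_and_L1 ::
    "'w measure \<Rightarrow> (nat \<Rightarrow> 'w \<Rightarrow> 'a::{banach, second_countable_topology}) \<Rightarrow> ('w \<Rightarrow> 'a) \<Rightarrow> bool"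
  where
  "tendsto_as_and_L1 M X L \<longleftrightarrow>
     (AE w in M. (\<lambda>n. X n w) \<longlonglongrightarrow> L w) \<and> tendsto_L1 M X L"


section \<open>The urn model\<close>

text \<open>Colors are the elements of the finite type \<open>'k\<close>, so the number of colors is
  \<open>CARD('k)\<close>. Vectors are row vectors. The draws \<open>chi n\<close> and the replacement matrices \<open>R n\<close>
  are used for \<open>n \<ge> 1\<close> only; the values at index 0 are ignored.\<close>

primrec urn_config ::
    "('w \<Rightarrow> real^'k) \<Rightarrow> (nat \<Rightarrow> 'w \<Rightarrow> real^'k) \<Rightarrow> (nat \<Rightarrow> 'w \<Rightarrow> real^'k^'k) \<Rightarrow> nat \<Rightarrow> 'w \<Rightarrow> real^'k"
  where
  "urn_config C0 chi R 0 w = C0 w"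
| "urn_config C0 chi R (Suc n) w =
     urn_config C0 chi R n w + chi (Suc n) w v* R (Suc n) w"

definition urn_total ::
    "('w \<Rightarrow> real^'k) \<Rightarrow> (nat \<Rightarrow> 'w \<Rightarrow> real^'k) \<Rightarrow> (nat \<Rightarrow> 'w \<Rightarrow> real^'k^'k) \<Rightarrow> nat \<Rightarrow> 'w \<Rightarrow> real"
  where
  "urn_total C0 chi R n w = (\<Sum>i\<in>UNIV. urn_config C0 chi R n w $ i)"

definition urn_counts :: "(nat \<Rightarrow> 'w \<Rightarrow> real^'k) \<Rightarrow> nat \<Rightarrow> 'w \<Rightarrow> real^'k" where
  "urn_counts chi n w = (\<Sum>k=1..n. chi k w)"

definition urn_filtration ::
    "'w measure \<Rightarrow> ('w \<Rightarrow> real^'k) \<Rightarrow> (nat \<Rightarrow> 'w \<Rightarrow> real^'k) \<Rightarrow> (nat \<Rightarrow> 'w \<Rightarrow> real^'k^'k)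
      \<Rightarrow> nat \<Rightarrow> 'w measure"
  where
  "urn_filtration M C0 chi R n = sigma (space M)
     ({C0 -` A \<inter> space M | A. A \<in> sets borel}
      \<union> (\<Union>m\<in>{1..n}. {R m -` A \<inter> space M | A. A \<in> sets borel})
      \<union> (\<Union>m\<in>{1..n}. {chi m -` A \<inter> space M | A. A \<in> sets borel}))"

text \<open>Integrability of \<open>C0\<close> and \<open>R n\<close> expresses the finite means and includes measurability.\<close>

locale randomized_urn = prob_space M
  for M :: "'w measure"
    and C0 :: "'w \<Rightarrow> real^'k"
    and chi :: "nat \<Rightarrow> 'w \<Rightarrow> real^'k"
    and R :: "nat \<Rightarrow> 'w \<Rightarrow> real^'k^'k" +
  assumes C0_nonneg_nonzero: "AE w in M. C0 w \<noteq> 0 \<and> (\<forall>i. 0 \<le> C0 w $ i)"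
    and C0_integrable: "integrable M C0"
    and chi_measurable: "\<And>n. n \<ge> 1 \<Longrightarrow> chi n \<in> borel_measurable M"
    and chi_unit_vector: "\<And>n. n \<ge> 1 \<Longrightarrow> AE w in M. chi n w \<in> range (\<lambda>i. axis i 1)"
    and R_integrable: "\<And>n. n \<ge> 1 \<Longrightarrow> integrable M (R n)"
    and R_nonneg: "\<And>n. n \<ge> 1 \<Longrightarrow> AE w in M. nonneg_matrix (R n w)"
    and draw_prob: "\<And>n i. n \<ge> 1 \<Longrightarrow> AE w in M.
          cond_prob_sigma M (urn_filtration M C0 chi R (n - 1))
            {u \<in> space M. chi n u = axis i 1} w =
          urn_config C0 chi R (n - 1) w $ i / urn_total C0 chi R (n - 1) w"
    and draw_replacement_cond_indep: "\<And>n. n \<ge> 1 \<Longrightarrow>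
          cond_indep_var M (urn_filtration M C0 chi R (n - 1)) (chi n) (R n)"

text \<open>\<open>truncated_cond_mean M C0 chi R k\<close> is the entrywise conditional expectation of
  \<open>R\<^sub>k\<^sub>+\<^sub>1 1{\<rho>(R\<^sub>k\<^sub>+\<^sub>1) \<le> k + 1}\<close> given the \<open>\<sigma>\<close>-field at time \<open>k\<close>, where \<open>\<rho>\<close> is \<open>max_row_sum\<close>.\<close>

definition truncated_cond_mean ::
    "'w measure \<Rightarrow> ('w \<Rightarrow> real^'k) \<Rightarrow> (nat \<Rightarrow> 'w \<Rightarrow> real^'k) \<Rightarrow> (nat \<Rightarrow> 'w \<Rightarrow> real^'k^'k)
      \<Rightarrow> nat \<Rightarrow> 'w \<Rightarrow> real^'k^'k"
  where
  "truncated_cond_mean M C0 chi R k w =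
     (\<chi> i j. real_cond_exp M (urn_filtration M C0 chi R k)
        (\<lambda>u. R (Suc k) u $ i $ j *
              indicat_real {v. max_row_sum (R (Suc k) v) \<le> real (Suc k)} u) w)"

text \<open>The dominating random variable \<open>Y\<close> may live on any probability space. Since only its law
  matters, it is no restriction to take that space to be a probability space on the reals.\<close>

definition tail_dominated :: "'w measure \<Rightarrow> (nat \<Rightarrow> 'w \<Rightarrow> real^'k^'k) \<Rightarrow> bool" where
  "tail_dominated M R \<longleftrightarrow>
     (\<exists>c>0. \<exists>(N :: real measure) (Y :: real \<Rightarrow> real).
        prob_space N \<and> integrable N Y \<and> (AE y in N. 0 < Y y) \<and>
        (\<forall>x>0. \<forall>n\<ge>1. measure M {w \<in> space M. max_row_sum (R n w) > x}
                        \<le> c * measure N {y \<in> space N. Y y > x}))"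

text \<open>Division by zero yields 0, so the finitely many \<open>n\<close> with \<open>n * \<phi> n = 0\<close> do not influence
  the summability condition.\<close>

definition phi_moment_bounded :: "'w measure \<Rightarrow> (nat \<Rightarrow> 'w \<Rightarrow> real^'k^'k) \<Rightarrow> bool" where
  "phi_moment_bounded M R \<longleftrightarrow>
     (\<exists>\<phi> :: real \<Rightarrow> real.
        (\<forall>x\<ge>0. 0 \<le> \<phi> x) \<and>
        (\<exists>a. (\<forall>x\<ge>a. 0 < \<phi> x) \<and> mono_on {a..} \<phi> \<and> mono_on {a..} (\<lambda>x. x / \<phi> x)) \<and>
        summable (\<lambda>n. 1 / (real n * \<phi> (real n))) \<and>
        (SUP n\<in>{1..}. \<integral>\<^sup>+w. ennreal (max_row_sum (R n w) * \<phi> (max_row_sum (R n w))) \<partial>M) < \<infinity>)"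

end

theory Submission
  imports Defs
begin

text \<open>
  The proof reduces the theorem to a deterministic statement about single paths. Write
  \<open>x\<^sub>k = C\<^sub>k / S\<^sub>k\<close> for the color proportions and \<open>A\<^sub>n = (x\<^sub>0 + \<dots> + x\<^sub>n\<^sub>-\<^sub>1) / n\<close> for their averages.

  Probability enters only to show that almost surely \<open>C\<^sub>n / n - A\<^sub>n H \<rightarrow> 0\<close> and
  \<open>N\<^sub>n / n - A\<^sub>n \<rightarrow> 0\<close>. Either moment condition yields a summable sequence \<open>q\<close> with
  \<open>P(\<rho>(R\<^sub>n) > k) \<le> q\<^sub>k\<close> for all \<open>n\<close> (\<open>uniformly_summable_tail\<close>). Hence
  almost surely only finitely many \<open>R\<^sub>k\<close> are changed by truncating them where \<open>\<rho>(R\<^sub>k) > k\<close>,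
  and the truncated second moments, divided by \<open>k\<^sup>2\<close>, are summable. By conditional independence
  the truncated addition \<open>\<chi>\<^sub>k R\<^sub>k\<close> has conditional mean \<open>x\<^sub>k\<^sub>-\<^sub>1\<close> times the truncated
  conditional mean matrix (\<open>cond_exp_draw_times_replacement\<close>), and a strong law for
  martingale differences, derived from Kolmogorov's maximal inequality on dyadic blocks
  (\<open>strong_law_conditional_means\<close>), removes the fluctuations. The Cesaro hypothesis
  then replaces the conditional means by \<open>H\<close>.

  For a fixed path put \<open>D\<^sub>n = n A\<^sub>n\<close>. Then \<open>D\<^sub>n\<^sub>+\<^sub>1 = D\<^sub>n + x\<^sub>n\<close>, where \<open>x\<^sub>n\<close> is asymptotically the
  normalization of \<open>D\<^sub>n H\<close>. This is a discretization of a flow on the simplex, but the flow need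
  not be solved: up to the scalar step size \<open>1 / |D\<^sub>n H|\<close> the recursion is linear. Let \<open>u\<close> and
  \<open>\<pi>\<close> be the Perron vectors and \<open>\<lambda>\<close> their eigenvalue. The component \<open>D\<^sub>n u\<close> grows at rate \<open>\<lambda>\<close>, whereas in
  the norm with weights \<open>u\<^sub>i / \<pi>\<^sub>i\<close> the transversal component \<open>D\<^sub>n - (D\<^sub>n u) \<pi>\<close> grows at a
  rate at most \<open>\<lambda> - c\<close>. The gap \<open>c > 0\<close> comes from the Dirichlet form of the Markov chain
  with transition matrix \<open>H\<^sub>i\<^sub>j u\<^sub>j / (\<lambda> u\<^sub>i)\<close>, which vanishes only on constants because \<open>H\<close> is
  irreducible (\<open>perron_spectral_gap\<close>). As the step sizes are of order \<open>1/n\<close> and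
  sum to infinity, the transversal component becomes negligible and \<open>A\<^sub>n \<rightarrow> \<pi>\<close>
  (\<open>normalized_linear_dynamics\<close>). The other limits follow from it.

  Applied to the unperturbed recursion, the same convergence result represents \<open>\<pi>\<^sub>H\<close> and \<open>\<lambda>\<^sub>H\<close> as
  pointwise limits of measurable functions, so they are random variables. Convergence in mean
  is dominated convergence for the bounded sequences, and for \<open>S\<^sub>n / n\<close> and \<open>C\<^sub>n / n\<close> it follows from
  uniform integrability: the mean of \<open>(\<rho>(R\<^sub>n) - m)\<^sup>+\<close> is at most \<open>\<Sum> q\<^sub>l\<close> over \<open>l \<ge> m\<close>.
\<close>

section \<open>Perron--Frobenius theory of irreducible matrices\<close>

lemma vector_matrix_mult_nth:
  fixes v :: "real^'k"
  shows "(v v* A) $ j = (\<Sum>i\<in>UNIV. v $ i * A $ i $ j)"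
  by (simp add: vector_matrix_mult_def mult.commute)

lemma matrix_vector_mult_nth:
  fixes v :: "real^'k"
  shows "(A *v v) $ i = (\<Sum>j\<in>UNIV. A $ i $ j * v $ j)"
  by (simp add: matrix_vector_mult_def)

lemma irreducible_matrix_nonneg: "irreducible_matrix A \<Longrightarrow> 0 \<le> A $ i $ j"
  by (auto simp: irreducible_matrix_def nonneg_matrix_def)

lemma matrix_power_nonneg:
  assumes "nonneg_matrix A" shows "0 \<le> matrix_power A n $ i $ j"
  using assms
  by (induction n arbitrary: i)
     (auto simp: nonneg_matrix_def mat_def matrix_matrix_mult_def intro!: sum_nonneg mult_nonneg_nonneg)

lemma matrix_power_Suc_nonzeroE:
  fixes A :: "real^'k^'k"
  assumes "matrix_power A (Suc n) $ i $ j \<noteq> 0"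
  obtains k where "A $ i $ k \<noteq> 0" "matrix_power A n $ k $ j \<noteq> 0"
proof -
  have "(\<Sum>k\<in>UNIV. A $ i $ k * matrix_power A n $ k $ j) \<noteq> 0"
    using assms by (simp add: matrix_matrix_mult_def)
  then obtain k where "A $ i $ k * matrix_power A n $ k $ j \<noteq> 0"
    by (meson sum.not_neutral_contains_not_neutral)
  thus ?thesis using that by auto
qed

lemma irreducible_matrix_row_pos:
  assumes "irreducible_matrix A" obtains j where "0 < A $ i $ j"
proof -
  obtain N where "N > 0" "0 < matrix_power A N $ i $ i"
    using assms unfolding irreducible_matrix_def by blast
  then obtain n where "N = Suc n" by (cases N) auto
  hence "matrix_power A (Suc n) $ i $ i \<noteq> 0"
    using \<open>0 < matrix_power A N $ i $ i\<close> by simp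
  then obtain k where "A $ i $ k \<noteq> 0" by (rule matrix_power_Suc_nonzeroE)
  thus ?thesis using that[of k] irreducible_matrix_nonneg[OF assms, of i k] by simp
qed

lemma irreducible_matrix_row_sum_pos:
  assumes A: "irreducible_matrix A" shows "0 < (\<Sum>j\<in>UNIV. A $ i $ j)"
proof -
  obtain j where "0 < A $ i $ j" using A by (rule irreducible_matrix_row_pos)
  thus ?thesis
    by (intro sum_pos2[where i = j]) (auto simp: irreducible_matrix_nonneg[OF A])
qed

lemma irreducible_matrix_column_pos:
  assumes "irreducible_matrix A" obtains i where "0 < A $ i $ j"
proof -
  have *: "\<exists>i. A $ i $ j \<noteq> 0" if "matrix_power A (Suc n) $ k $ j \<noteq> 0" for n k
    using that
  proof (induction n arbitrary: k)
    case 0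
    then obtain l where "A $ k $ l \<noteq> 0" "matrix_power A 0 $ l $ j \<noteq> 0"
      by (rule matrix_power_Suc_nonzeroE)
    thus ?case by (auto simp: mat_def split: if_splits)
  next
    case (Suc n)
    obtain l where "matrix_power A (Suc n) $ l $ j \<noteq> 0"
      using matrix_power_Suc_nonzeroE[OF Suc.prems] by blast
    thus ?case by (rule Suc.IH)
  qed
  obtain N where "N > 0" "0 < matrix_power A N $ j $ j"
    using assms unfolding irreducible_matrix_def by blast
  then obtain n where "N = Suc n" by (cases N) auto
  hence "matrix_power A (Suc n) $ j $ j \<noteq> 0"
    using \<open>0 < matrix_power A N $ j $ j\<close> by simp
  then obtain i where "A $ i $ j \<noteq> 0" using * by blast
  thus ?thesis using that[of i] irreducible_matrix_nonneg[OF assms, of i j] by simp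
qed

text \<open>A positive entry of a power of the matrix is a path in its graph, and by irreducibility paths
  join any two vertices.\<close>

lemma irreducible_matrix_constant_along_edges:
  fixes A :: "real^'k^'k"
  assumes A: "irreducible_matrix A" and edge: "\<And>i j. A $ i $ j \<noteq> 0 \<Longrightarrow> g i = g j"
  shows "g i = g j"
proof -
  have *: "matrix_power A n $ i $ j \<noteq> 0 \<Longrightarrow> g i = g j" for n i
  proof (induction n arbitrary: i)
    case 0 thus ?case by (auto simp: mat_def split: if_splits)
  next
    case (Suc n)
    from Suc.prems obtain k where "A $ i $ k \<noteq> 0" "matrix_power A n $ k $ j \<noteq> 0"
      by (rule matrix_power_Suc_nonzeroE)
    thus ?case using edge Suc.IH by metis
  qed
  show ?thesis using A * unfolding irreducible_matrix_def by (metis less_irrefl)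
qed

lemma left_eigenvector_power:
  fixes p :: "real^'k"
  assumes "p v* A = l *s p" shows "p v* matrix_power A n = l ^ n *s p"
proof (induction n)
  case (Suc n)
  have "p v* matrix_power A (Suc n) = (l *s p) v* matrix_power A n"
    by (simp add: vector_matrix_mul_assoc[symmetric] assms)
  also have "\<dots> = l *s (p v* matrix_power A n)"
    by (simp add: vec_eq_iff vector_matrix_mult_nth sum_distrib_left mult.assoc)
  finally show ?case by (simp add: Suc.IH vec_eq_iff)
qed (simp add: vec_eq_iff)

lemma right_eigenvector_power:
  fixes p :: "real^'k"
  assumes "A *v p = l *s p" shows "matrix_power A n *v p = l ^ n *s p"
proof (induction n)
  case (Suc n)
  have "matrix_power A (Suc n) *v p = A *v (l ^ n *s p)"
    by (simp add: matrix_vector_mul_assoc[symmetric] Suc.IH)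
  also have "\<dots> = l ^ n *s (A *v p)"
    by (simp add: vec_eq_iff matrix_vector_mult_nth sum_distrib_left mult.left_commute)
  finally show ?case by (simp add: assms vec_eq_iff mult.commute mult.left_commute)
qed simp

text \<open>Some power of the matrix carries the mass of a positive coordinate to any other coordinate.\<close>

lemma left_eigenvector_pos:
  fixes p :: "real^'k"
  assumes A: "irreducible_matrix A" and l: "0 \<le> l" and eig: "p v* A = l *s p"
    and nonneg: "\<And>i. 0 \<le> p $ i" and "p \<noteq> 0"
  shows "0 < p $ j"
proof -
  obtain i where "p $ i \<noteq> 0" using \<open>p \<noteq> 0\<close> by (auto simp: vec_eq_iff)
  hence pi: "0 < p $ i" using nonneg[of i] by simp
  obtain N where N: "0 < matrix_power A N $ i $ j"
    using A unfolding irreducible_matrix_def by blast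
  have "0 < p $ i * matrix_power A N $ i $ j" using pi N by simp
  also have "\<dots> \<le> (\<Sum>i\<in>UNIV. p $ i * matrix_power A N $ i $ j)"
    using A by (intro member_le_sum) (auto intro!: mult_nonneg_nonneg nonneg matrix_power_nonneg
        simp: irreducible_matrix_def)
  also have "\<dots> = l ^ N * p $ j"
    using left_eigenvector_power[OF eig, of N] by (simp add: vector_matrix_mult_nth[symmetric])
  finally show ?thesis using nonneg[of j] l by (simp add: zero_less_mult_iff)
qed

lemma right_eigenvector_pos:
  fixes p :: "real^'k"
  assumes A: "irreducible_matrix A" and l: "0 \<le> l" and eig: "A *v p = l *s p"
    and nonneg: "\<And>i. 0 \<le> p $ i" and "p \<noteq> 0"
  shows "0 < p $ i"
proof -
  obtain j where "p $ j \<noteq> 0" using \<open>p \<noteq> 0\<close> by (auto simp: vec_eq_iff)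
  hence pj: "0 < p $ j" using nonneg[of j] by simp
  obtain N where N: "0 < matrix_power A N $ i $ j"
    using A unfolding irreducible_matrix_def by blast
  have "0 < matrix_power A N $ i $ j * p $ j" using pj N by simp
  also have "\<dots> \<le> (\<Sum>j\<in>UNIV. matrix_power A N $ i $ j * p $ j)"
    using A by (intro member_le_sum) (auto intro!: mult_nonneg_nonneg nonneg matrix_power_nonneg
        simp: irreducible_matrix_def)
  also have "\<dots> = l ^ N * p $ i"
    using right_eigenvector_power[OF eig, of N] by (simp add: matrix_vector_mult_nth[symmetric])
  finally show ?thesis using nonneg[of i] l by (simp add: zero_less_mult_iff)
qed

text \<open>Brouwer's theorem, applied on the probability simplex to the linear map followed by
  normalization.\<close>

lemma positive_linear_map_eigenvector:
  fixes f :: "real^'k \<Rightarrow> real^'k"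
  assumes lin: "linear f" and nonneg: "\<And>x i. (\<And>j. 0 \<le> x $ j) \<Longrightarrow> 0 \<le> f x $ i"
    and nonzero: "\<And>x. (\<And>j. 0 \<le> x $ j) \<Longrightarrow> x \<noteq> 0 \<Longrightarrow> f x \<noteq> 0"
  obtains p l where "0 < l" "f p = l *s p" "\<And>i. 0 \<le> p $ i" "(\<Sum>i\<in>UNIV. p $ i) = 1"
proof -
  define S :: "(real^'k) set" where "S = {x. (\<forall>i. 0 \<le> x $ i) \<and> (\<Sum>i\<in>UNIV. x $ i) = 1}"
  define t where "t x = (\<Sum>i\<in>UNIV. f x $ i)" for x
  have nz: "x \<noteq> 0" if "x \<in> S" for x using that by (auto simp: S_def)
  have t_pos: "0 < t x" if "x \<in> S" for x
  proof -
    have "f x \<noteq> 0" using nonzero nz that by (auto simp: S_def)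
    then obtain i where "f x $ i \<noteq> 0" by (auto simp: vec_eq_iff)
    hence "0 < f x $ i" using nonneg[of x i] that by (auto simp: S_def less_le)
    thus ?thesis unfolding t_def using nonneg[of x] that
      by (intro sum_pos2[where i = i]) (auto simp: S_def)
  qed
  have clS: "closed S"
    unfolding S_def by (intro closed_Collect_conj closed_Collect_all closed_Collect_le
        closed_Collect_eq continuous_intros)
  have "bounded S"
  proof (rule boundedI)
    fix x assume "x \<in> S"
    have "norm x \<le> (\<Sum>i\<in>UNIV. \<bar>x $ i\<bar>)" by (rule norm_le_l1_cart)
    also have "\<dots> = 1" using \<open>x \<in> S\<close> by (auto simp: S_def)
    finally show "norm x \<le> 1" .
  qed
  with clS have cS: "compact S" by (simp add: compact_eq_bounded_closed)
  have cvx: "convex S"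
  proof (rule convexI)
    fix x y u v assume *: "x \<in> S" "y \<in> S" "0 \<le> u" "0 \<le> v" "u + v = (1::real)"
    have "(\<Sum>i\<in>UNIV. (u *\<^sub>R x + v *\<^sub>R y) $ i) = u * (\<Sum>i\<in>UNIV. x $ i) + v * (\<Sum>i\<in>UNIV. y $ i)"
      by (simp add: sum.distrib sum_distrib_left)
    thus "u *\<^sub>R x + v *\<^sub>R y \<in> S" using * by (auto simp: S_def)
  qed
  have "axis undefined 1 \<in> S" by (auto simp: S_def axis_def)
  hence ne: "S \<noteq> {}" by auto
  have cf: "continuous_on S f" using lin by (rule linear_continuous_on_compose[OF continuous_on_id])
  hence ct: "continuous_on S t" unfolding t_def by (intro continuous_intros)
  have cg: "continuous_on S (\<lambda>x. (1 / t x) *\<^sub>R f x)"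
    using t_pos by (intro continuous_intros cf ct) (auto simp: less_imp_neq[symmetric] dest: t_pos)
  have gS: "(\<lambda>x. (1 / t x) *\<^sub>R f x) \<in> S \<rightarrow> S"
  proof
    fix x assume "x \<in> S"
    hence "0 \<le> f x $ i" for i using nonneg by (auto simp: S_def)
    moreover have "(\<Sum>i\<in>UNIV. (1 / t x) * f x $ i) = 1"
      using t_pos[OF \<open>x \<in> S\<close>] by (simp add: sum_divide_distrib[symmetric] t_def[symmetric])
    ultimately show "(1 / t x) *\<^sub>R f x \<in> S" using t_pos[OF \<open>x \<in> S\<close>] by (auto simp: S_def)
  qed
  obtain p where p: "p \<in> S" "(1 / t p) *\<^sub>R f p = p"
    using brouwer[OF cS cvx ne cg gS] by blast
  have "f p = t p *\<^sub>R ((1 / t p) *\<^sub>R f p)" using t_pos[OF p(1)] by simp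
  hence "f p = t p *s p" using p(2) by (simp add: scalar_mult_eq_scaleR)
  thus ?thesis using that[of "t p" p] t_pos[OF p(1)] p(1) by (auto simp: S_def)
qed

text \<open>The normalization of \<open>u\<close> makes \<open>p\<^sub>i u\<^sub>i\<close> a probability vector, the stationary law of
  the stochastic matrix \<open>A\<^sub>i\<^sub>j u\<^sub>j / (l u\<^sub>i)\<close>.\<close>

definition perron_vectors :: "real^'k^'k \<Rightarrow> real \<Rightarrow> real^'k \<Rightarrow> real^'k \<Rightarrow> bool" where
  "perron_vectors A l p u \<longleftrightarrow> 0 < l \<and> p v* A = l *s p \<and> A *v u = l *s u \<and>
     (\<forall>i. 0 < p $ i) \<and> (\<forall>i. 0 < u $ i) \<and> (\<Sum>i\<in>UNIV. p $ i) = 1 \<and> (\<Sum>i\<in>UNIV. p $ i * u $ i) = 1"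

text \<open>The two eigenvalues agree because both equal \<open>p H u / p u\<close>.\<close>

lemma irreducible_matrix_perron_vectors:
  fixes A :: "real^'k^'k"
  assumes A: "irreducible_matrix A"
  obtains l p u where "perron_vectors A l p u"
proof -
  have row: "x v* A \<noteq> 0" if x: "\<And>j. 0 \<le> x $ j" "x \<noteq> 0" for x
  proof -
    obtain i where "x $ i \<noteq> 0" using x(2) by (auto simp: vec_eq_iff)
    hence xi: "0 < x $ i" using x(1)[of i] by simp
    obtain j where "0 < A $ i $ j" using A by (rule irreducible_matrix_row_pos)
    hence "0 < (x v* A) $ j" unfolding vector_matrix_mult_nth using xi x(1)
      by (intro sum_pos2[where i = i]) (auto simp: irreducible_matrix_nonneg[OF A])
    thus ?thesis by auto
  qed
  have col: "A *v x \<noteq> 0" if x: "\<And>j. 0 \<le> x $ j" "x \<noteq> 0" for x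
  proof -
    obtain j where "x $ j \<noteq> 0" using x(2) by (auto simp: vec_eq_iff)
    hence xj: "0 < x $ j" using x(1)[of j] by simp
    obtain i where "0 < A $ i $ j" using A by (rule irreducible_matrix_column_pos)
    hence "0 < (A *v x) $ i" unfolding matrix_vector_mult_nth using xj x(1)
      by (intro sum_pos2[where i = j]) (auto simp: irreducible_matrix_nonneg[OF A])
    thus ?thesis by auto
  qed
  obtain p l where p: "0 < l" "p v* A = l *s p" "\<And>i. 0 \<le> p $ i" "(\<Sum>i\<in>UNIV. p $ i) = 1"
  proof (rule positive_linear_map_eigenvector[of "\<lambda>x. x v* A"])
    show "linear (\<lambda>x. x v* A)"
      by (intro linearI) (simp_all add: vec_eq_iff vector_matrix_mult_nth sum.distrib
          sum_distrib_left algebra_simps)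
  qed (use row in \<open>auto simp: vector_matrix_mult_nth irreducible_matrix_nonneg[OF A]
         intro!: sum_nonneg mult_nonneg_nonneg\<close>)
  obtain u m where u: "0 < m" "A *v u = m *s u" "\<And>i. 0 \<le> u $ i" "(\<Sum>i\<in>UNIV. u $ i) = 1"
  proof (rule positive_linear_map_eigenvector[of "\<lambda>x. A *v x"])
    show "linear (\<lambda>x. A *v x)" by (rule matrix_vector_mul_linear)
  qed (use col in \<open>auto simp: matrix_vector_mult_nth irreducible_matrix_nonneg[OF A]
         intro!: sum_nonneg mult_nonneg_nonneg\<close>)
  have "p \<noteq> 0" "u \<noteq> 0" using p(4) u(4) by auto
  hence pos: "0 < p $ i" "0 < u $ i" for i
    using left_eigenvector_pos[OF A _ p(2,3)] right_eigenvector_pos[OF A _ u(2,3)] p(1) u(1)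
    by (auto simp: less_imp_le)
  define s where "s = (\<Sum>i\<in>UNIV. p $ i * u $ i)"
  have s: "0 < s" unfolding s_def by (intro sum_pos) (auto simp: pos)
  have "l * s = (\<Sum>j\<in>UNIV. (p v* A) $ j * u $ j)" by (simp add: p(2) s_def sum_distrib_left mult.assoc)
  also have "\<dots> = (\<Sum>j\<in>UNIV. \<Sum>i\<in>UNIV. p $ i * A $ i $ j * u $ j)"
    by (simp add: vector_matrix_mult_nth sum_distrib_right)
  also have "\<dots> = (\<Sum>i\<in>UNIV. \<Sum>j\<in>UNIV. p $ i * A $ i $ j * u $ j)" by (rule sum.swap)
  also have "\<dots> = (\<Sum>i\<in>UNIV. p $ i * (A *v u) $ i)"
    by (simp add: matrix_vector_mult_nth sum_distrib_left mult.assoc)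
  also have "\<dots> = m * s" by (simp add: u(2) s_def sum_distrib_left mult.left_commute)
  finally have lm: "l = m" using s by simp
  have "A *v ((1 / s) *s u) = l *s ((1 / s) *s u)"
  proof -
    have "A *v ((1 / s) *s u) = (1 / s) *s (A *v u)"
      by (simp add: vec_eq_iff matrix_vector_mult_nth sum_distrib_left sum_divide_distrib)
    thus ?thesis by (simp add: u(2) lm vec_eq_iff)
  qed
  moreover have "(\<Sum>i\<in>UNIV. p $ i * ((1 / s) *s u) $ i) = 1"
    using s by (simp add: s_def sum_divide_distrib[symmetric])
  ultimately have "perron_vectors A l p ((1 / s) *s u)"
    using p pos s by (auto simp: perron_vectors_def)
  thus ?thesis by (rule that)
qed

text \<open>Pair the entrywise inequality \<open>|z| |v| \<le> A |v|\<close> with the positive left eigenvector.\<close>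

lemma complex_eigenvalue_norm_le:
  fixes A :: "real^'k^'k"
  assumes A: "irreducible_matrix A" and pf: "perron_vectors A l p u" and z: "complex_eigenvalue A z"
  shows "norm z \<le> l"
proof -
  obtain v where v: "v \<noteq> 0" "(\<chi> i j. complex_of_real (A $ i $ j)) *v v = z *s v"
    using z unfolding complex_eigenvalue_def by blast
  have p: "0 < p $ i" for i using pf by (simp add: perron_vectors_def)
  have le: "norm z * norm (v $ i) \<le> (\<Sum>j\<in>UNIV. A $ i $ j * norm (v $ j))" for i
  proof -
    have "norm z * norm (v $ i) = norm ((z *s v) $ i)" by (simp add: norm_mult)
    also have "(z *s v) $ i = (\<Sum>j\<in>UNIV. complex_of_real (A $ i $ j) * v $ j)"
      unfolding v(2)[symmetric] by (simp add: matrix_vector_mult_def)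
    also have "norm \<dots> \<le> (\<Sum>j\<in>UNIV. norm (complex_of_real (A $ i $ j) * v $ j))" by (rule norm_sum)
    also have "\<dots> = (\<Sum>j\<in>UNIV. A $ i $ j * norm (v $ j))"
      by (simp add: norm_mult irreducible_matrix_nonneg[OF A])
    finally show ?thesis .
  qed
  define q where "q = (\<Sum>i\<in>UNIV. p $ i * norm (v $ i))"
  obtain i where "v $ i \<noteq> 0" using v(1) by (auto simp: vec_eq_iff)
  hence q: "0 < q" unfolding q_def by (intro sum_pos2[where i = i]) (auto simp: p less_imp_le)
  have "norm z * q = (\<Sum>i\<in>UNIV. p $ i * (norm z * norm (v $ i)))"
    by (simp add: q_def sum_distrib_left mult.left_commute)
  also have "\<dots> \<le> (\<Sum>i\<in>UNIV. p $ i * (\<Sum>j\<in>UNIV. A $ i $ j * norm (v $ j)))"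
    by (intro sum_mono mult_left_mono le) (simp add: p less_imp_le)
  also have "\<dots> = (\<Sum>i\<in>UNIV. \<Sum>j\<in>UNIV. p $ i * A $ i $ j * norm (v $ j))"
    by (simp add: sum_distrib_left mult.assoc)
  also have "\<dots> = (\<Sum>j\<in>UNIV. \<Sum>i\<in>UNIV. p $ i * A $ i $ j * norm (v $ j))" by (rule sum.swap)
  also have "\<dots> = (\<Sum>j\<in>UNIV. (p v* A) $ j * norm (v $ j))"
    by (simp add: vector_matrix_mult_nth sum_distrib_right)
  also have "\<dots> = l * q" using pf by (simp add: perron_vectors_def q_def sum_distrib_left mult.assoc)
  finally show ?thesis using q by simp
qed

lemma dominant_eigenvalue_eq:
  fixes A :: "real^'k^'k"
  assumes A: "irreducible_matrix A" and pf: "perron_vectors A l p u"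
  shows "dominant_eigenvalue A = l"
proof -
  define v :: "complex^'k" where "v = (\<chi> i. complex_of_real (u $ i))"
  have u: "A *v u = l *s u" "0 < u $ i" for i using pf by (auto simp: perron_vectors_def)
  have "(\<Sum>j\<in>UNIV. A $ i $ j * u $ j) = l * u $ i" for i
    using arg_cong[OF u(1), of "\<lambda>w. w $ i"] by (simp add: matrix_vector_mult_nth)
  hence "(\<chi> i j. complex_of_real (A $ i $ j)) *v v = complex_of_real l *s v"
    by (simp add: vec_eq_iff v_def matrix_vector_mult_def flip: of_real_mult of_real_sum)
  moreover have "v \<noteq> 0" using u(2) by (auto simp: v_def vec_eq_iff less_imp_neq[symmetric])
  ultimately have ev: "complex_eigenvalue A (complex_of_real l)" by (auto simp: complex_eigenvalue_def)
  have le: "Re z \<le> l" if "complex_eigenvalue A z" for z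
    using complex_eigenvalue_norm_le[OF A pf that] complex_Re_le_cmod[of z] by simp
  have "(THE l. complex_eigenvalue A (complex_of_real l) \<and>
           (\<forall>z. complex_eigenvalue A z \<longrightarrow> Re z \<le> l)) = l"
  proof (rule the_equality)
    fix m assume m: "complex_eigenvalue A (complex_of_real m) \<and> (\<forall>z. complex_eigenvalue A z \<longrightarrow> Re z \<le> m)"
    show "m = l" using le[of "complex_of_real m"] m ev by (metis Re_complex_of_real antisym)
  qed (use ev le in auto)
  thus ?thesis using A by (simp add: dominant_eigenvalue_def)
qed

text \<open>Uniqueness: subtract from a second positive eigenvector the largest multiple of \<open>p\<close> that keeps it
  nonnegative. The difference has a zero coordinate, hence vanishes.\<close>

lemma left_prob_eigenvector_eq:
  fixes A :: "real^'k^'k"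
  assumes A: "irreducible_matrix A" and pf: "perron_vectors A l p u"
  shows "left_prob_eigenvector A = p"
proof -
  have p: "0 < l" "p v* A = l *s p" "\<And>i. 0 < p $ i" "(\<Sum>i\<in>UNIV. p $ i) = 1"
    using pf by (auto simp: perron_vectors_def)
  have "(THE q. q v* A = l *s q \<and> (\<forall>i. 0 < q $ i) \<and> (\<Sum>i\<in>UNIV. q $ i) = 1) = p"
  proof (rule the_equality)
    fix q :: "real^'k" assume q: "q v* A = l *s q \<and> (\<forall>i. 0 < q $ i) \<and> (\<Sum>i\<in>UNIV. q $ i) = 1"
    define t where "t = (MIN i. q $ i / p $ i)"
    have t_le: "t \<le> q $ i / p $ i" for i unfolding t_def by (rule Min_le) auto
    have "t \<in> range (\<lambda>i. q $ i / p $ i)" unfolding t_def by (rule Min_in) auto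
    then obtain i where i: "t = q $ i / p $ i" by auto
    define d where "d = q - t *s p"
    have di: "d $ i = 0" using i p(3)[of i] by (simp add: d_def)
    have "d = 0"
    proof (rule ccontr)
      assume "d \<noteq> 0"
      have "d v* A = l *s d"
      proof -
        have "d v* A = q v* A - t *s (p v* A)"
          by (simp add: d_def vec_eq_iff vector_matrix_mult_nth left_diff_distrib sum_subtractf
              sum_distrib_left mult.assoc)
        thus ?thesis using q p(2) by (simp add: d_def vec_eq_iff algebra_simps)
      qed
      moreover have "0 \<le> d $ j" for j
        using t_le[of j] p(3)[of j] by (simp add: d_def field_simps)
      ultimately have "0 < d $ i"
        using left_eigenvector_pos[OF A less_imp_le[OF p(1)] _ _ \<open>d \<noteq> 0\<close>] by blast
      thus False using di by simp
    qed
    hence qt: "q = t *s p" by (simp add: d_def)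
    hence "t * (\<Sum>i\<in>UNIV. p $ i) = 1" using q by (simp add: sum_distrib_left)
    thus "q = p" using p(4) qt by simp
  qed (use p in auto)
  thus ?thesis using A dominant_eigenvalue_eq[OF A pf] by (simp add: left_prob_eigenvector_def)
qed

section \<open>A perturbed linear recursion with step sizes of order 1/n\<close>

text \<open>The factors \<open>1 - c/n\<close> multiply to zero, and the error \<open>r\<^sub>n / n\<close> outweighs the contraction only
  while \<open>V\<close> is below \<open>r\<^sub>n / c\<close>, which tends to zero.\<close>

lemma contraction_with_harmonic_steps:
  fixes V r :: "nat \<Rightarrow> real"
  assumes c: "0 < c" and V: "\<And>n. 0 \<le> V n" and r: "r \<longlonglongrightarrow> 0"
    and step: "\<And>n. 1 \<le> n \<Longrightarrow> V (Suc n) \<le> (1 - c / real n) * V n + r n / real n"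
  shows "V \<longlonglongrightarrow> 0"
proof (rule LIMSEQ_I)
  fix e :: real assume e: "0 < e"
  have "eventually (\<lambda>n. r n < c * (e/2)) sequentially"
    using r e c by (intro order_tendstoD(2)[OF r]) auto
  then obtain N0 where N0: "\<And>n. n \<ge> N0 \<Longrightarrow> r n < c * (e/2)" by (auto simp: eventually_sequentially)
  obtain N1 where N1: "c \<le> real N1" using real_arch_simple by blast
  define N where "N = max (max N0 N1) 1"
  have N: "n \<ge> 1" "r n \<le> c * (e/2)" "c \<le> real n" if "n \<ge> N" for n
  proof -
    show "n \<ge> 1" "r n \<le> c * (e/2)" using that N0[of n] by (auto simp: N_def)
    have "real N1 \<le> real n" using that by (simp add: N_def)
    thus "c \<le> real n" using N1 by linarith
  qed
  \<comment> \<open>Above the level \<open>e/2\<close> the error is absorbed, so the excess over that level contracts.\<close>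
  define Z where "Z n = max 0 (V n - e/2)" for n
  have Z0: "0 \<le> Z n" for n by (simp add: Z_def)
  have Z_step: "Z (Suc n) \<le> exp (- c / real n) * Z n" if n: "n \<ge> N" for n
  proof -
    have pos: "0 < real n" using N[OF n] by simp
    have "V (Suc n) - e/2 \<le> (1 - c / real n) * V n + (c * (e/2)) / real n - e/2"
      using step[OF N(1)[OF n]] divide_right_mono[OF N(2)[OF n], of "real n"] by simp
    also have "\<dots> = (1 - c / real n) * (V n - e/2)" using pos by (simp add: field_simps)
    also have "\<dots> \<le> (1 - c / real n) * Z n"
      using N(3)[OF n] pos by (intro mult_left_mono) (auto simp: Z_def)
    also have "\<dots> \<le> exp (- c / real n) * Z n"
      using exp_ge_add_one_self[of "- c / real n"] by (intro mult_right_mono Z0) simp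
    finally show ?thesis using Z0[of n] by (simp add: Z_def)
  qed
  \<comment> \<open>Since \<open>exp (-c/n) \<le> (n/(n+1))\<^sup>c\<close>, the quantity \<open>n\<^sup>c Z\<^sub>n\<close> does not increase.\<close>
  have bound: "Z n * real n powr c \<le> Z N * real N powr c" if "n \<ge> N" for n
    using that
  proof (induction n rule: dec_induct)
    case (step n)
    have pos: "0 < real n" using N[OF step(1)] by simp
    have "ln (real (Suc n)) - ln (real n) = ln (1 + 1 / real n)"
      using pos ln_div[of "real (Suc n)" "real n"] by (simp add: add_divide_distrib add.commute)
    also have "\<dots> \<le> 1 / real n" using pos by (intro ln_add_one_self_le_self) simp
    finally have "c * (ln (real (Suc n)) - ln (real n)) \<le> c * (1 / real n)"
      using c by (intro mult_left_mono) auto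
    hence "- c / real n + c * ln (real (Suc n)) \<le> c * ln (real n)" by (simp add: algebra_simps)
    hence "exp (- c / real n) * real (Suc n) powr c \<le> real n powr c"
      using pos by (simp add: powr_def flip: exp_add)
    hence "Z n * (exp (- c / real n) * real (Suc n) powr c) \<le> Z n * real n powr c"
      by (intro mult_left_mono Z0)
    moreover have "Z (Suc n) * real (Suc n) powr c \<le> exp (- c / real n) * Z n * real (Suc n) powr c"
      using Z_step[OF step(1)] by (intro mult_right_mono) auto
    moreover have "exp (- c / real n) * Z n * real (Suc n) powr c
        = Z n * (exp (- c / real n) * real (Suc n) powr c)" by simp
    ultimately show ?case using step.IH by linarith
  qed simp
  have "(\<lambda>n. Z N * real N powr c * real n powr (- c)) \<longlonglongrightarrow> Z N * real N powr c * 0"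
    using c by (intro tendsto_mult tendsto_const tendsto_neg_powr filterlim_real_sequentially) auto
  hence "eventually (\<lambda>n. Z N * real N powr c * real n powr (- c) < e/2) sequentially"
    using e by (intro order_tendstoD(2)) auto
  then obtain N2 where N2: "\<And>n. n \<ge> N2 \<Longrightarrow> Z N * real N powr c * real n powr (- c) < e/2"
    by (auto simp: eventually_sequentially)
  show "\<exists>no. \<forall>n\<ge>no. norm (V n - 0) < e"
  proof (intro exI allI impI)
    fix n assume n: "n \<ge> max N N2"
    have "0 < real n" using N[of n] n by auto
    hence "Z n \<le> Z N * real N powr c * real n powr (- c)"
      using bound[of n] n by (simp add: powr_minus field_simps)
    hence "Z n < e/2" using N2[of n] n by linarith
    moreover have "V n - e/2 \<le> Z n" by (simp add: Z_def)
    ultimately have "V n < e" by linarith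
    thus "norm (V n - 0) < e" using V[of n] by simp
  qed
qed

text \<open>The squared ratio \<open>|y|\<^sup>2/w\<^sup>2\<close> contracts, because \<open>|y|\<^sup>2\<close> grows by a factor
  \<open>1 + 2\<beta>(l - c)\<close> in each step and \<open>w\<^sup>2\<close> by \<open>1 + 2\<beta>l\<close>, up to errors of smaller order.\<close>

lemma perturbed_linear_recursion_ratio:
  fixes y e :: "nat \<Rightarrow> 'a::real_inner" and w \<eta> \<beta> :: "nat \<Rightarrow> real"
  assumes B: "bounded_linear B"
    and y: "\<And>n. y (Suc n) = y n + \<beta> n *\<^sub>R B (y n) + e n"
    and w: "\<And>n. w (Suc n) = (1 + l * \<beta> n) * w n + \<eta> n"
    and l: "0 < l" and c: "0 < c"
    and gap: "\<And>n. y n \<bullet> B (y n) \<le> (l - c) * (norm (y n))\<^sup>2"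
    and e: "e \<longlonglongrightarrow> 0" and \<eta>: "\<eta> \<longlonglongrightarrow> 0" and a: "0 < a"
    and w_ge: "\<And>n. 1 \<le> n \<Longrightarrow> a * real n \<le> w n"
    and y_le: "\<And>n. 1 \<le> n \<Longrightarrow> norm (y n) \<le> K * real n"
    and \<beta>_ge: "\<And>n. 1 \<le> n \<Longrightarrow> a / real n \<le> \<beta> n"
    and \<beta>_le: "\<And>n. 1 \<le> n \<Longrightarrow> \<beta> n \<le> K / real n"
  shows "(\<lambda>n. norm (y n) / w n) \<longlonglongrightarrow> 0"
proof -
  obtain KB where KB: "0 \<le> KB" "\<And>x. norm (B x) \<le> norm x * KB"
    using bounded_linear.nonneg_bounded[OF B] by blast
  have K: "0 < K"
  proof -
    have "a \<le> K" using \<beta>_ge[of 1] \<beta>_le[of 1] by simp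
    thus ?thesis using a by simp
  qed
  define V where "V n = (norm (y n))\<^sup>2 / (w n)\<^sup>2" for n
  \<comment> \<open>\<open>n \<epsilon>\<^sub>n\<close> bounds the error in \<open>|y|\<^sup>2\<close>, and \<open>\<delta>\<^sub>n / n\<close> the resulting error in \<open>V\<close>.\<close>
  define \<epsilon> where "\<epsilon> n = 2 * K * norm (e n) + (K * K * KB + norm (e n))\<^sup>2 / real n" for n
  define \<delta> where "\<delta> n = \<epsilon> n / a\<^sup>2 + 2 * (1 + l * K) * (K\<^sup>2 / a\<^sup>2) * \<bar>\<eta> n\<bar> / a" for n
  have inv_n: "(\<lambda>n. 1 / real n) \<longlonglongrightarrow> 0" by (rule lim_const_over_n)
  have en: "(\<lambda>n. norm (e n)) \<longlonglongrightarrow> 0" using e by (rule tendsto_norm_zero)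
  have "(\<lambda>n. 2 * K * norm (e n) + (K * K * KB + norm (e n))\<^sup>2 * (1 / real n))
      \<longlonglongrightarrow> 2 * K * 0 + (K * K * KB + 0)\<^sup>2 * 0"
    by (intro tendsto_intros en inv_n)
  hence \<epsilon>: "\<epsilon> \<longlonglongrightarrow> 0" by (simp add: \<epsilon>_def[abs_def])
  have "(\<lambda>n. \<epsilon> n / a\<^sup>2 + 2 * (1 + l * K) * (K\<^sup>2 / a\<^sup>2) * \<bar>\<eta> n\<bar> / a)
      \<longlonglongrightarrow> 0 / a\<^sup>2 + 2 * (1 + l * K) * (K\<^sup>2 / a\<^sup>2) * \<bar>0\<bar> / a"
    using a by (intro tendsto_intros \<epsilon> \<eta>) auto
  hence \<delta>: "\<delta> \<longlonglongrightarrow> 0" unfolding \<delta>_def[abs_def] by simp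
  have \<epsilon>0: "0 \<le> \<epsilon> n" for n using K by (simp add: \<epsilon>_def)
  have \<delta>0: "0 \<le> \<delta> n" for n using a \<epsilon>0[of n] K l by (simp add: \<delta>_def)
  have w_pos: "0 < w n" if "1 \<le> n" for n
  proof -
    have "0 < a * real n" using a that by simp
    thus ?thesis using w_ge[OF that] by linarith
  qed
  have \<beta>0: "0 < \<beta> n" if "1 \<le> n" for n
  proof -
    have "0 < a / real n" using a that by simp
    thus ?thesis using \<beta>_ge[OF that] by linarith
  qed
  have \<beta>K: "\<beta> n \<le> K" if "1 \<le> n" for n
  proof -
    have "K / real n \<le> K" using K that by (simp add: field_simps)
    thus ?thesis using \<beta>_le[OF that] by linarith
  qed
  have V0: "0 \<le> V n" for n by (simp add: V_def)
  have V_le: "V n \<le> K\<^sup>2 / a\<^sup>2" if n: "1 \<le> n" for n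
  proof -
    have "norm (y n) / w n \<le> (K * real n) / (a * real n)"
      using y_le[OF n] w_ge[OF n] a n K by (intro frac_le) auto
    also have "\<dots> = K / a" using n by simp
    finally have "(norm (y n) / w n)\<^sup>2 \<le> (K / a)\<^sup>2"
      using w_pos[OF n] by (intro power_mono) auto
    thus ?thesis by (simp add: V_def power_divide)
  qed
  define c' where "c' = 2 * c * a / (1 + 2 * l * K)"
  have c': "0 < c'" unfolding c'_def using c a l K
    by (intro divide_pos_pos mult_pos_pos add_pos_pos) auto
  have "V (Suc n) \<le> (1 - c' / real n) * V n + \<delta> n / real n" if n: "1 \<le> n" for n
  proof -
    have n0: "0 < real n" using n by simp
    define u where "u = \<beta> n *\<^sub>R B (y n) + e n"
    have "norm (\<beta> n *\<^sub>R B (y n)) \<le> (K / real n) * ((K * real n) * KB)"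
    proof -
      have "norm (B (y n)) \<le> (K * real n) * KB"
        using KB(2)[of "y n"] mult_right_mono[OF y_le[OF n] KB(1)] by linarith
      moreover have "norm (\<beta> n *\<^sub>R B (y n)) = \<beta> n * norm (B (y n))" using \<beta>0[OF n] by simp
      moreover have "0 \<le> K / real n" using K by simp
      ultimately show ?thesis using \<beta>_le[OF n] by (simp only: mult_mono norm_ge_zero)
    qed
    also have "\<dots> = K * K * KB" using n0 by simp
    finally have u: "norm u \<le> K * K * KB + norm (e n)"
      unfolding u_def by (meson add_right_mono norm_triangle_le)
    have ye: "y n \<bullet> e n \<le> K * norm (e n) * real n"
    proof -
      have "y n \<bullet> e n \<le> norm (y n) * norm (e n)" by (rule norm_cauchy_schwarz)
      also have "\<dots> \<le> (K * real n) * norm (e n)" by (intro mult_right_mono y_le n) simp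
      finally show ?thesis by (simp add: algebra_simps)
    qed
    have "(norm (y (Suc n)))\<^sup>2 = (norm (y n))\<^sup>2 + 2 * (y n \<bullet> u) + (norm u)\<^sup>2"
      unfolding y u_def add.assoc
      by (simp add: power2_norm_eq_inner inner_add_left inner_add_right inner_commute algebra_simps)
    also have "y n \<bullet> u = \<beta> n * (y n \<bullet> B (y n)) + y n \<bullet> e n" by (simp add: u_def inner_add_right)
    finally have y2: "(norm (y (Suc n)))\<^sup>2 = (norm (y n))\<^sup>2 +
        2 * (\<beta> n * (y n \<bullet> B (y n)) + y n \<bullet> e n) + (norm u)\<^sup>2" .
    have "(norm (y (Suc n)))\<^sup>2 \<le> (norm (y n))\<^sup>2 + 2 * (\<beta> n * ((l - c) * (norm (y n))\<^sup>2)
        + K * norm (e n) * real n) + (K * K * KB + norm (e n))\<^sup>2"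
      unfolding y2 using less_imp_le[OF \<beta>0[OF n]]
      by (intro add_mono order_refl mult_left_mono[OF add_mono] mult_left_mono[OF gap] ye
          power_mono[OF u norm_ge_zero]) auto
    hence num: "(norm (y (Suc n)))\<^sup>2 \<le> (1 + 2 * \<beta> n * (l - c)) * (norm (y n))\<^sup>2 + \<epsilon> n * real n"
      using n0 by (simp add: \<epsilon>_def algebra_simps)
    have "(w (Suc n))\<^sup>2 = (1 + 2 * l * \<beta> n) * (w n)\<^sup>2 + 2 * (1 + l * \<beta> n) * w n * \<eta> n
        + ((l * \<beta> n * w n)\<^sup>2 + (\<eta> n)\<^sup>2)"
      unfolding w by (simp add: power2_eq_square algebra_simps)
    hence den: "(1 + 2 * l * \<beta> n) * (w n)\<^sup>2 - 2 * (1 + l * \<beta> n) * w n * \<bar>\<eta> n\<bar> \<le> (w (Suc n))\<^sup>2"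
    proof -
      have "0 \<le> 2 * (1 + l * \<beta> n) * w n" using w_pos[OF n] \<beta>0[OF n] l by simp
      hence "- (2 * (1 + l * \<beta> n) * w n * \<bar>\<eta> n\<bar>) \<le> 2 * (1 + l * \<beta> n) * w n * \<eta> n"
        using mult_left_mono[of "- \<bar>\<eta> n\<bar>" "\<eta> n" "2 * (1 + l * \<beta> n) * w n"] by simp
      moreover have "0 \<le> (l * \<beta> n * w n)\<^sup>2 + (\<eta> n)\<^sup>2" by simp
      ultimately show ?thesis using \<open>(w (Suc n))\<^sup>2 = _\<close> by linarith
    qed
    have "V (Suc n) * (w (Suc n))\<^sup>2 = (norm (y (Suc n)))\<^sup>2"
      using w_pos[of "Suc n"] by (simp add: V_def)
    moreover have "(norm (y n))\<^sup>2 = V n * (w n)\<^sup>2" using w_pos[OF n] by (simp add: V_def)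
    ultimately have "V (Suc n) * ((1 + 2 * l * \<beta> n) * (w n)\<^sup>2 - 2 * (1 + l * \<beta> n) * w n * \<bar>\<eta> n\<bar>)
        \<le> (1 + 2 * \<beta> n * (l - c)) * (V n * (w n)\<^sup>2) + \<epsilon> n * real n"
      using num mult_left_mono[OF den V0[of "Suc n"]] by simp
    hence "(V (Suc n) * (1 + 2 * l * \<beta> n)) * (w n)\<^sup>2
        \<le> ((1 + 2 * \<beta> n * (l - c)) * V n) * (w n)\<^sup>2
            + (\<epsilon> n * real n + V (Suc n) * (2 * (1 + l * \<beta> n) * w n * \<bar>\<eta> n\<bar>))"
      by (simp add: algebra_simps)
    hence "((V (Suc n) * (1 + 2 * l * \<beta> n)) * (w n)\<^sup>2) / (w n)\<^sup>2
        \<le> (((1 + 2 * \<beta> n * (l - c)) * V n) * (w n)\<^sup>2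
            + (\<epsilon> n * real n + V (Suc n) * (2 * (1 + l * \<beta> n) * w n * \<bar>\<eta> n\<bar>))) / (w n)\<^sup>2"
      by (rule divide_right_mono) simp
    hence "V (Suc n) * (1 + 2 * l * \<beta> n) \<le> (1 + 2 * \<beta> n * (l - c)) * V n
            + (\<epsilon> n * real n / (w n)\<^sup>2 + V (Suc n) * (2 * (1 + l * \<beta> n) * \<bar>\<eta> n\<bar>) / w n)"
      using w_pos[OF n] by (simp add: add_divide_distrib power2_eq_square)
    also have "\<epsilon> n * real n / (w n)\<^sup>2 \<le> \<epsilon> n * real n / (a * real n)\<^sup>2"
      using w_ge[OF n] a n0 \<epsilon>0[of n] by (intro frac_le power_mono) auto
    also have "\<dots> = \<epsilon> n / a\<^sup>2 / real n" using n0 by (simp add: power2_eq_square)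
    also have "V (Suc n) * (2 * (1 + l * \<beta> n) * \<bar>\<eta> n\<bar>) / w n
        \<le> (K\<^sup>2 / a\<^sup>2) * (2 * (1 + l * K) * \<bar>\<eta> n\<bar>) / (a * real n)"
      using V_le[of "Suc n"] \<beta>K[OF n] \<beta>0[OF n] l K w_ge[OF n] a n0
      by (intro frac_le mult_mono mult_nonneg_nonneg add_mono) auto
    finally have main: "V (Suc n) * (1 + 2 * l * \<beta> n) \<le> (1 + 2 * \<beta> n * (l - c)) * V n + \<delta> n / real n"
      by (simp add: \<delta>_def add_divide_distrib algebra_simps)
    define D where "D = 1 + 2 * l * \<beta> n"
    have lb: "0 < l * \<beta> n" using l \<beta>0[OF n] by simp
    have lK: "l * \<beta> n \<le> l * K" using l \<beta>K[OF n] by simp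
    have D: "1 \<le> D" "D \<le> 1 + 2 * l * K" using lb lK by (auto simp: D_def)
    have "V (Suc n) \<le> ((D - 2 * c * \<beta> n) * V n + \<delta> n / real n) / D"
      using main D by (simp add: D_def field_simps)
    also have "\<dots> = (1 - 2 * c * \<beta> n / D) * V n + (\<delta> n / real n) / D"
      using D by (simp add: field_simps)
    also have "\<dots> \<le> (1 - c' / real n) * V n + \<delta> n / real n"
    proof (rule add_mono)
      have "c' / real n = 2 * c * (a / real n) / (1 + 2 * l * K)" by (simp add: c'_def)
      also have "\<dots> \<le> 2 * c * \<beta> n / D"
        using \<beta>_ge[OF n] c a n0 D \<beta>0[OF n] by (intro frac_le mult_left_mono) auto
      finally show "(1 - 2 * c * \<beta> n / D) * V n \<le> (1 - c' / real n) * V n"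
        by (intro mult_right_mono V0) simp
      show "(\<delta> n / real n) / D \<le> \<delta> n / real n"
        using D divide_left_mono[of 1 D "\<delta> n / real n"] \<delta>0[of n] by simp
    qed
    finally show ?thesis .
  qed
  hence "V \<longlonglongrightarrow> 0" by (rule contraction_with_harmonic_steps[OF c' V0 \<delta>])
  hence "(\<lambda>n. sqrt (V n)) \<longlonglongrightarrow> sqrt 0" by (rule tendsto_real_sqrt)
  moreover have "eventually (\<lambda>n. sqrt (V n) = norm (y n) / w n) sequentially"
    using eventually_ge_at_top[of 1]
  proof eventually_elim
    case (elim n)
    thus ?case using w_pos[of n] by (simp add: V_def real_sqrt_divide)
  qed
  ultimately show ?thesis by (simp add: tendsto_cong)
qed

section \<open>Linear dynamics normalized in the probability simplex\<close>

text \<open>Put \<open>g = v / p\<close> and expand \<open>2 g\<^sub>i g\<^sub>j = g\<^sub>i\<^sup>2 + g\<^sub>j\<^sup>2 - (g\<^sub>i - g\<^sub>j)\<^sup>2\<close>. The equations for \<open>u\<close>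
  and \<open>p\<close> evaluate the two square terms, and what remains is the Dirichlet form of the
  Markov chain attached to the Perron vectors.\<close>

lemma perron_dirichlet_identity:
  fixes A :: "real^'k^'k" and v :: "real^'k"
  assumes pf: "perron_vectors A l p u"
  shows "(\<Sum>i\<in>UNIV. \<Sum>j\<in>UNIV. v $ i * A $ i $ j * (u $ j / p $ j * v $ j)) =
     l * (\<Sum>i\<in>UNIV. u $ i / p $ i * (v $ i)\<^sup>2)
      - (\<Sum>i\<in>UNIV. \<Sum>j\<in>UNIV. p $ i * A $ i $ j * u $ j * (v $ i / p $ i - v $ j / p $ j)\<^sup>2) / 2"
proof -
  have p: "0 < p $ i" for i using pf by (simp add: perron_vectors_def)
  have p0: "p $ i \<noteq> 0" for i using p[of i] by simp
  have pA: "(\<Sum>i\<in>UNIV. p $ i * A $ i $ j) = l * p $ j" for j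
    using pf unfolding perron_vectors_def vec_eq_iff by (simp add: vector_matrix_mult_nth)
  have Au: "(\<Sum>j\<in>UNIV. A $ i $ j * u $ j) = l * u $ i" for i
    using pf unfolding perron_vectors_def vec_eq_iff by (simp add: matrix_vector_mult_nth)
  define g where "g i = v $ i / p $ i" for i
  define k where "k i j = p $ i * A $ i $ j * u $ j" for i j
  have v: "v $ i = p $ i * g i" for i using p0[of i] by (simp add: g_def)
  define Q where "Q = (\<Sum>i\<in>UNIV. p $ i * u $ i * (g i)\<^sup>2)"
  have "(\<Sum>i\<in>UNIV. \<Sum>j\<in>UNIV. k i j * (g i)\<^sup>2) = (\<Sum>i\<in>UNIV. p $ i * (g i)\<^sup>2 * (\<Sum>j\<in>UNIV. A $ i $ j * u $ j))"
    by (simp add: k_def sum_distrib_left mult_ac)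
  also have "\<dots> = l * Q" unfolding Au by (simp add: Q_def sum_distrib_left mult_ac)
  finally have 1: "(\<Sum>i\<in>UNIV. \<Sum>j\<in>UNIV. k i j * (g i)\<^sup>2) = l * Q" .
  have "(\<Sum>i\<in>UNIV. \<Sum>j\<in>UNIV. k i j * (g j)\<^sup>2) = (\<Sum>j\<in>UNIV. \<Sum>i\<in>UNIV. k i j * (g j)\<^sup>2)"
    by (rule sum.swap)
  also have "\<dots> = (\<Sum>j\<in>UNIV. u $ j * (g j)\<^sup>2 * (\<Sum>i\<in>UNIV. p $ i * A $ i $ j))"
    by (simp add: k_def sum_distrib_left mult_ac)
  also have "\<dots> = l * Q" unfolding pA by (simp add: Q_def sum_distrib_left mult_ac)
  finally have 2: "(\<Sum>i\<in>UNIV. \<Sum>j\<in>UNIV. k i j * (g j)\<^sup>2) = l * Q" .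
  have "(\<Sum>i\<in>UNIV. \<Sum>j\<in>UNIV. k i j * (g i - g j)\<^sup>2) =
      (\<Sum>i\<in>UNIV. \<Sum>j\<in>UNIV. k i j * (g i)\<^sup>2) + (\<Sum>i\<in>UNIV. \<Sum>j\<in>UNIV. k i j * (g j)\<^sup>2)
        - 2 * (\<Sum>i\<in>UNIV. \<Sum>j\<in>UNIV. k i j * (g i * g j))"
    by (simp add: power2_eq_square algebra_simps sum.distrib sum_subtractf sum_distrib_left)
  moreover have "(\<Sum>i\<in>UNIV. \<Sum>j\<in>UNIV. v $ i * A $ i $ j * (u $ j / p $ j * v $ j)) =
      (\<Sum>i\<in>UNIV. \<Sum>j\<in>UNIV. k i j * (g i * g j))"
    using p0 by (simp add: v k_def mult_ac)
  moreover have "(\<Sum>i\<in>UNIV. u $ i / p $ i * (v $ i)\<^sup>2) = Q"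
    using p0 by (simp add: v Q_def power2_eq_square mult_ac)
  hence "l * (\<Sum>i\<in>UNIV. u $ i / p $ i * (v $ i)\<^sup>2) = l * Q" by simp
  ultimately show ?thesis using 1 2 unfolding k_def g_def by linarith
qed

text \<open>The Dirichlet form is positive on the unit sphere of the hyperplane orthogonal to \<open>u\<close>:
  where it vanishes, \<open>v\<close> is a multiple of \<open>p\<close> by irreducibility. Compactness makes it
  bounded below.\<close>

lemma perron_spectral_gap:
  fixes A :: "real^'k^'k"
  assumes A: "irreducible_matrix A" and pf: "perron_vectors A l p u"
  obtains c where "0 < c"
    "\<And>v. (\<Sum>i\<in>UNIV. u $ i * v $ i) = 0 \<Longrightarrow>
       (\<Sum>i\<in>UNIV. \<Sum>j\<in>UNIV. v $ i * A $ i $ j * (u $ j / p $ j * v $ j))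
         \<le> (l - c) * (\<Sum>i\<in>UNIV. u $ i / p $ i * (v $ i)\<^sup>2)"
proof -
  have p: "0 < p $ i" and u: "0 < u $ i" and pu: "(\<Sum>i\<in>UNIV. p $ i * u $ i) = 1" for i
    using pf by (auto simp: perron_vectors_def)
  have p0: "p $ i \<noteq> 0" for i using p[of i] by simp
  define E where "E v = (\<Sum>i\<in>UNIV. \<Sum>j\<in>UNIV. p $ i * A $ i $ j * u $ j * (v $ i / p $ i - v $ j / p $ j)\<^sup>2) / 2"
    for v :: "real^'k"
  define G where "G v = (\<Sum>i\<in>UNIV. u $ i / p $ i * (v $ i)\<^sup>2)" for v :: "real^'k"
  define S :: "(real^'k) set" where "S = {v. (\<Sum>i\<in>UNIV. u $ i * v $ i) = 0} \<inter> sphere 0 1"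
  have "closed {v. (\<Sum>i\<in>UNIV. u $ i * v $ i) = 0}"
    by (intro closed_Collect_eq continuous_intros)
  hence cS: "compact S" unfolding S_def by (intro closed_Int_compact) auto
  have k0: "0 \<le> p $ i * A $ i $ j * u $ j" for i j
    using p[of i] u[of j] irreducible_matrix_nonneg[OF A, of i j] by simp
  have E0: "0 \<le> E v" for v unfolding E_def by (intro divide_nonneg_nonneg sum_nonneg mult_nonneg_nonneg k0) auto
  have E_pos: "0 < E v" if "v \<in> S" for v
  proof (rule ccontr)
    assume "\<not> 0 < E v"
    hence "E v = 0" using E0[of v] by simp
    hence zero: "\<forall>i j. p $ i * A $ i $ j * u $ j * (v $ i / p $ i - v $ j / p $ j)\<^sup>2 = 0"
      unfolding E_def using k0 by (simp add: sum_nonneg_eq_0_iff sum_nonneg)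
    hence edge: "v $ i / p $ i = v $ j / p $ j" if "A $ i $ j \<noteq> 0" for i j
    proof -
      have "p $ i * A $ i $ j * u $ j \<noteq> 0" using that p0[of i] u[of j] by simp
      moreover have "p $ i * A $ i $ j * u $ j * (v $ i / p $ i - v $ j / p $ j)\<^sup>2 = 0"
        using zero by blast
      ultimately have "(v $ i / p $ i - v $ j / p $ j)\<^sup>2 = 0" by (metis mult_eq_0_iff)
      thus ?thesis by simp
    qed
    have const: "v $ i / p $ i = v $ undefined / p $ undefined" for i
      by (rule irreducible_matrix_constant_along_edges[OF A, where g = "\<lambda>i. v $ i / p $ i"]) (rule edge)
    define t where "t = v $ undefined / p $ undefined"
    have vt: "v $ i = t * p $ i" for i using const[of i] p0[of i] by (simp add: t_def field_simps)
    have "(\<Sum>i\<in>UNIV. u $ i * v $ i) = t * (\<Sum>i\<in>UNIV. p $ i * u $ i)"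
      by (simp add: vt sum_distrib_left mult_ac)
    hence "t = 0" using that pu by (simp add: S_def)
    hence "v = 0" using vt by (simp add: vec_eq_iff)
    thus False using that by (simp add: S_def)
  qed
  obtain m where m: "0 < m" "\<And>v. v \<in> S \<Longrightarrow> m \<le> E v"
  proof (cases "S = {}")
    case False
    have "continuous_on S E" unfolding E_def using p0 by (intro continuous_intros) auto
    then obtain w where "w \<in> S" "\<And>v. v \<in> S \<Longrightarrow> E w \<le> E v"
      using continuous_attains_inf[OF cS False] by blast
    thus ?thesis using that[of "E w"] E_pos by blast
  qed (use that[of 1] in auto)
  define b where "b = (\<Sum>i\<in>UNIV. u $ i / p $ i)"
  have b: "0 < b" unfolding b_def using u p by (intro sum_pos) auto
  have G_le: "G v \<le> b * (norm v)\<^sup>2" for v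
  proof -
    have "u $ i / p $ i * (v $ i)\<^sup>2 \<le> u $ i / p $ i * (norm v)\<^sup>2" for i
    proof (intro mult_left_mono)
      show "(v $ i)\<^sup>2 \<le> (norm v)\<^sup>2" using component_le_norm_cart[of v i] by (simp add: abs_le_square_iff[symmetric])
    qed (use u[of i] p[of i] in auto)
    thus ?thesis unfolding G_def b_def sum_distrib_right by (rule sum_mono)
  qed
  have E_ge: "m * (norm v)\<^sup>2 \<le> E v" if v: "(\<Sum>i\<in>UNIV. u $ i * v $ i) = 0" for v
  proof (cases "v = 0")
    case False
    hence nv: "norm v \<noteq> 0" by simp
    define z where "z = (1 / norm v) *\<^sub>R v"
    have "(\<Sum>i\<in>UNIV. u $ i * z $ i) = (\<Sum>i\<in>UNIV. u $ i * v $ i) / norm v"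
      by (simp add: z_def sum_divide_distrib)
    hence "z \<in> S" using v False by (simp add: S_def z_def)
    hence "m \<le> E z" by (rule m)
    have "v = norm v *\<^sub>R z" using False by (simp add: z_def)
    hence vz: "v $ i = norm v * z $ i" for i by (simp add: vec_eq_iff)
    have "v $ i / p $ i - v $ j / p $ j = norm v * (z $ i / p $ i - z $ j / p $ j)" for i j
      by (simp add: vz[of i] vz[of j] right_diff_distrib)
    hence "E v = (norm v)\<^sup>2 * E z"
      by (simp add: E_def power_mult_distrib sum_distrib_left mult_ac)
    thus ?thesis using \<open>m \<le> E z\<close> nv by (simp add: mult.commute)
  qed (use E0 in simp)
  show ?thesis
  proof (rule that[of "m / b"])
    show "0 < m / b" using m b by simp
    fix v :: "real^'k" assume v: "(\<Sum>i\<in>UNIV. u $ i * v $ i) = 0"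
    have "m / b * G v \<le> m / b * (b * (norm v)\<^sup>2)"
      using m b by (intro mult_left_mono G_le) auto
    also have "\<dots> = m * (norm v)\<^sup>2" using b by simp
    also have "\<dots> \<le> E v" by (rule E_ge[OF v])
    finally show "(\<Sum>i\<in>UNIV. \<Sum>j\<in>UNIV. v $ i * A $ i $ j * (u $ j / p $ j * v $ j))
         \<le> (l - m / b) * (\<Sum>i\<in>UNIV. u $ i / p $ i * (v $ i)\<^sup>2)"
      unfolding perron_dirichlet_identity[OF pf] G_def[symmetric] E_def[symmetric]
      by (simp add: left_diff_distrib)
  qed
qed

text \<open>Write \<open>w = D u\<close> and \<open>v = D - w p\<close>. Since \<open>x\<close> is close to the normalization of \<open>D A\<close>, both
  follow linear recursions with step size \<open>1/s\<close> of order \<open>1/n\<close>. The coordinates \<open>y\<close> of \<open>v\<close> are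
  scaled so that the weighted square norm of the spectral gap becomes the Euclidean one.\<close>

lemma normalized_linear_dynamics:
  fixes A :: "real^'k^'k" and D x :: "nat \<Rightarrow> real^'k"
  assumes A: "irreducible_matrix A" and pf: "perron_vectors A l p u"
    and D0: "\<And>i. 0 \<le> D 0 $ i" and D: "\<And>n. D (Suc n) = D n + x n"
    and x0: "\<And>n i. 0 \<le> x n $ i" and x1: "\<And>n. (\<Sum>i\<in>UNIV. x n $ i) = 1"
    and x: "(\<lambda>n. x n - (1 / (\<Sum>j\<in>UNIV. (D n v* A) $ j)) *\<^sub>R (D n v* A)) \<longlonglongrightarrow> 0"
  shows "(\<lambda>n. (1 / real n) *\<^sub>R D n) \<longlonglongrightarrow> p"
proof -
  have p: "0 < p $ i" and u: "0 < u $ i" and l: "0 < l" and p1: "(\<Sum>i\<in>UNIV. p $ i) = 1"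
    and pu: "(\<Sum>i\<in>UNIV. p $ i * u $ i) = 1" and pA: "p v* A = l *s p" for i
    using pf by (auto simp: perron_vectors_def)
  have p0: "p $ i \<noteq> 0" for i using p[of i] by simp
  have pA': "(\<Sum>i\<in>UNIV. p $ i * A $ i $ j) = l * p $ j" for j
    using pA unfolding vec_eq_iff by (simp add: vector_matrix_mult_nth)
  have Au: "(\<Sum>j\<in>UNIV. A $ i $ j * u $ j) = l * u $ i" for i
    using pf unfolding perron_vectors_def vec_eq_iff by (simp add: matrix_vector_mult_nth)
  obtain c where c: "0 < c" and gap: "\<And>v. (\<Sum>i\<in>UNIV. u $ i * v $ i) = 0 \<Longrightarrow>
       (\<Sum>i\<in>UNIV. \<Sum>j\<in>UNIV. v $ i * A $ i $ j * (u $ j / p $ j * v $ j))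
         \<le> (l - c) * (\<Sum>i\<in>UNIV. u $ i / p $ i * (v $ i)\<^sup>2)"
    using perron_spectral_gap[OF A pf] by blast

  define d where "d = (\<Sum>i\<in>UNIV. D 0 $ i)"
  have d0: "0 \<le> d" unfolding d_def by (intro sum_nonneg D0)
  have Dn: "0 \<le> D n $ i" for n i by (induction n) (auto simp: D D0 x0)
  have Dsum: "(\<Sum>i\<in>UNIV. D n $ i) = real n + d" for n
    by (induction n) (auto simp: D sum.distrib x1 d_def)
  define h where "h i = (\<Sum>j\<in>UNIV. A $ i $ j)" for i
  have h: "0 < h i" for i unfolding h_def using A by (rule irreducible_matrix_row_sum_pos)
  define s where "s n = (\<Sum>j\<in>UNIV. (D n v* A) $ j)" for n
  have s_eq: "s n = (\<Sum>i\<in>UNIV. D n $ i * h i)" for n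
  proof -
    have "s n = (\<Sum>j\<in>UNIV. \<Sum>i\<in>UNIV. D n $ i * A $ i $ j)"
      by (simp add: s_def vector_matrix_mult_nth)
    also have "\<dots> = (\<Sum>i\<in>UNIV. \<Sum>j\<in>UNIV. D n $ i * A $ i $ j)" by (rule sum.swap)
    finally show ?thesis by (simp add: h_def sum_distrib_left)
  qed
  have lower: "Min (range f) * (real n + d) \<le> (\<Sum>i\<in>UNIV. D n $ i * f i)" for f :: "'k \<Rightarrow> real" and n
  proof -
    have "(\<Sum>i\<in>UNIV. D n $ i * Min (range f)) \<le> (\<Sum>i\<in>UNIV. D n $ i * f i)"
      by (intro sum_mono mult_left_mono Dn Min_le) auto
    thus ?thesis by (simp add: sum_distrib_right[symmetric] Dsum mult.commute)
  qed
  have upper: "(\<Sum>i\<in>UNIV. D n $ i * f i) \<le> Max (range f) * (real n + d)" for f :: "'k \<Rightarrow> real" and n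
  proof -
    have "(\<Sum>i\<in>UNIV. D n $ i * f i) \<le> (\<Sum>i\<in>UNIV. D n $ i * Max (range f))"
      by (intro sum_mono mult_left_mono Dn Max_ge) auto
    thus ?thesis by (simp add: sum_distrib_right[symmetric] Dsum mult.commute)
  qed
  have Min_pos: "0 < Min (range f)" if "\<And>i. 0 < f i" for f :: "'k \<Rightarrow> real"
  proof -
    have "Min (range f) \<in> range f" by (rule Min_in) auto
    thus ?thesis using that by auto
  qed

  define w where "w n = (\<Sum>i\<in>UNIV. D n $ i * u $ i)" for n
  define \<beta> where "\<beta> n = 1 / s n" for n
  define r where "r i = sqrt (u $ i / p $ i)" for i
  have r: "0 < r i" and r2: "r i * r i = u $ i / p $ i" for i
    using p[of i] u[of i] by (auto simp: r_def)
  define B :: "real^'k \<Rightarrow> real^'k" where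
    "B z = (\<chi> j. r j * (\<Sum>i\<in>UNIV. z $ i / r i * A $ i $ j))" for z
  define v where "v n = D n - w n *\<^sub>R p" for n
  define y :: "nat \<Rightarrow> real^'k" where "y n = (\<chi> i. r i * v n $ i)" for n
  define z where "z n = x n - \<beta> n *\<^sub>R (D n v* A)" for n
  define \<eta> where "\<eta> n = (\<Sum>i\<in>UNIV. z n $ i * u $ i)" for n
  define e :: "nat \<Rightarrow> real^'k" where "e n = (\<chi> i. r i * (z n $ i - \<eta> n * p $ i))" for n
  have z: "z \<longlonglongrightarrow> 0" using x by (simp add: z_def[abs_def] \<beta>_def s_def)
  hence zi: "(\<lambda>n. z n $ i) \<longlonglongrightarrow> 0" for i using tendsto_vec_nth[OF z, of i] by simp
  have "\<eta> \<longlonglongrightarrow> (\<Sum>i\<in>UNIV. 0 * u $ i)" unfolding \<eta>_def[abs_def] by (intro tendsto_intros zi)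
  hence \<eta>: "\<eta> \<longlonglongrightarrow> 0" by simp
  have "(\<lambda>n. r i * (z n $ i - \<eta> n * p $ i)) \<longlonglongrightarrow> r i * (0 - 0 * p $ i)" for i
    by (intro tendsto_intros zi \<eta>)
  hence e: "e \<longlonglongrightarrow> 0" by (intro vec_tendstoI) (simp add: e_def)
  have xz: "x n $ i = \<beta> n * (D n v* A) $ i + z n $ i" for n i by (simp add: z_def)
  have w_Suc: "w (Suc n) = (1 + l * \<beta> n) * w n + \<eta> n" for n
  proof -
    have "(\<Sum>j\<in>UNIV. (D n v* A) $ j * u $ j) = (\<Sum>j\<in>UNIV. \<Sum>i\<in>UNIV. D n $ i * A $ i $ j * u $ j)"
      by (simp add: vector_matrix_mult_nth sum_distrib_right)
    also have "\<dots> = (\<Sum>i\<in>UNIV. \<Sum>j\<in>UNIV. D n $ i * A $ i $ j * u $ j)" by (rule sum.swap)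
    also have "\<dots> = (\<Sum>i\<in>UNIV. D n $ i * (\<Sum>j\<in>UNIV. A $ i $ j * u $ j))"
      by (simp add: sum_distrib_left mult.assoc)
    also have "\<dots> = l * w n" unfolding Au by (simp add: w_def sum_distrib_left mult_ac)
    finally have DA: "(\<Sum>j\<in>UNIV. (D n v* A) $ j * u $ j) = l * w n" .
    have "w (Suc n) = w n + (\<Sum>i\<in>UNIV. x n $ i * u $ i)"
      by (simp add: w_def D sum.distrib distrib_right)
    also have "(\<Sum>i\<in>UNIV. x n $ i * u $ i) = \<beta> n * (\<Sum>j\<in>UNIV. (D n v* A) $ j * u $ j) + \<eta> n"
      by (simp add: xz \<eta>_def distrib_right sum.distrib sum_distrib_left mult.assoc)
    finally show ?thesis unfolding DA by (simp add: algebra_simps)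
  qed
  have vA: "(\<Sum>i\<in>UNIV. v n $ i * A $ i $ j) = (D n v* A) $ j - w n * (l * p $ j)" for n j
  proof -
    have "(\<Sum>i\<in>UNIV. v n $ i * A $ i $ j)
        = (\<Sum>i\<in>UNIV. D n $ i * A $ i $ j) - w n * (\<Sum>i\<in>UNIV. p $ i * A $ i $ j)"
      by (simp add: v_def left_diff_distrib sum_subtractf sum_distrib_left mult.assoc)
    thus ?thesis by (simp add: vector_matrix_mult_nth pA')
  qed
  have By: "B (y n) $ j = r j * ((D n v* A) $ j - w n * (l * p $ j))" for n j
  proof -
    have "y n $ i / r i = v n $ i" for i using r[of i] by (simp add: y_def)
    thus ?thesis by (simp add: B_def vA)
  qed
  have y_Suc: "y (Suc n) = y n + \<beta> n *\<^sub>R B (y n) + e n" for n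
  proof (rule vec_eq_iff[THEN iffD2], rule allI)
    fix i
    have "y (Suc n) $ i = r i * (D n $ i + x n $ i - w (Suc n) * p $ i)" by (simp add: y_def v_def D)
    also have "\<dots> = (y n + \<beta> n *\<^sub>R B (y n) + e n) $ i"
      by (simp add: By e_def xz w_Suc) (simp add: y_def v_def algebra_simps)
    finally show "y (Suc n) $ i = (y n + \<beta> n *\<^sub>R B (y n) + e n) $ i" .
  qed
  have "linear B"
    by (rule linearI)
       (simp_all add: B_def vec_eq_iff add_divide_distrib distrib_right sum.distrib
         sum_distrib_left algebra_simps)
  hence B: "bounded_linear B" by (rule linear_conv_bounded_linear[THEN iffD1])
  have "(\<Sum>i\<in>UNIV. u $ i * v n $ i)
      = (\<Sum>i\<in>UNIV. D n $ i * u $ i) - w n * (\<Sum>i\<in>UNIV. p $ i * u $ i)" for n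
    by (simp add: v_def right_diff_distrib sum_subtractf sum_distrib_left mult_ac)
  hence uv: "(\<Sum>i\<in>UNIV. u $ i * v n $ i) = 0" for n unfolding pu w_def[symmetric] by simp
  have y_gap: "y n \<bullet> B (y n) \<le> (l - c) * (norm (y n))\<^sup>2" for n
  proof -
    have "(norm (y n))\<^sup>2 = (\<Sum>i\<in>UNIV. u $ i / p $ i * (v n $ i)\<^sup>2)"
      unfolding power2_norm_eq_inner inner_vec_def
      by (simp add: y_def r2[symmetric] power2_eq_square mult_ac)
    moreover have "y n \<bullet> B (y n) = (\<Sum>j\<in>UNIV. \<Sum>i\<in>UNIV. v n $ i * A $ i $ j * (u $ j / p $ j * v n $ j))"
      unfolding inner_vec_def By vA[symmetric]
      by (simp add: y_def r2[symmetric] sum_distrib_left sum_distrib_right mult_ac)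
    moreover have "\<dots> = (\<Sum>i\<in>UNIV. \<Sum>j\<in>UNIV. v n $ i * A $ i $ j * (u $ j / p $ j * v n $ j))"
      by (rule sum.swap)
    ultimately show ?thesis using gap[OF uv[of n]] by simp
  qed

  define umin umax hmin hmax where "umin = Min (range (($) u))" and "umax = Max (range (($) u))"
    and "hmin = Min (range h)" and "hmax = Max (range h)"
  have pos: "0 < umin" "0 < hmin" unfolding umin_def hmin_def using u h by (auto intro!: Min_pos)
  have "umin \<le> u $ undefined" "u $ undefined \<le> umax" "hmin \<le> h undefined" "h undefined \<le> hmax"
    unfolding umin_def umax_def hmin_def hmax_def by (auto intro!: Min_le Max_ge)
  hence pos': "0 < umax" "0 < hmax" using pos by linarith+
  define K where "K = max (1 / hmin) ((\<Sum>i\<in>UNIV. r i * (1 + umax * p $ i)) * (1 + d))"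
  define a where "a = min umin (1 / (hmax * (1 + d)))"
  have a: "0 < a" using pos pos' d0 by (simp add: a_def)
  have t_le: "real n + d \<le> (1 + d) * real n" if "1 \<le> n" for n
    using that d0 mult_left_mono[of 1 "real n" d] by (simp add: algebra_simps)
  have w_low: "umin * (real n + d) \<le> w n" and w_up: "w n \<le> umax * (real n + d)"
    and s_low: "hmin * (real n + d) \<le> s n" and s_up: "s n \<le> hmax * (real n + d)" for n
    unfolding w_def s_eq umin_def umax_def hmin_def hmax_def by (rule lower upper)+
  have w_ge: "a * real n \<le> w n" for n
  proof -
    have "a * real n \<le> umin * (real n + d)" using d0 pos a by (intro mult_mono) (auto simp: a_def)
    thus ?thesis using w_low[of n] by linarith
  qed
  have s_pos: "0 < s n" if "1 \<le> n" for n
  proof -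
    have "0 < hmin * (real n + d)" using pos d0 that by simp
    thus ?thesis using s_low[of n] by linarith
  qed
  have \<beta>_ge: "a / real n \<le> \<beta> n" if n: "1 \<le> n" for n
  proof -
    have "s n \<le> hmax * ((1 + d) * real n)"
      using s_up[of n] mult_left_mono[OF t_le[OF n], of hmax] pos' by linarith
    hence "1 / (hmax * ((1 + d) * real n)) \<le> \<beta> n"
      unfolding \<beta>_def using s_pos[OF n] by (intro frac_le) auto
    moreover have "a / real n \<le> (1 / (hmax * (1 + d))) / real n"
      by (intro divide_right_mono) (auto simp: a_def)
    ultimately show ?thesis by simp
  qed
  have \<beta>_le: "\<beta> n \<le> K / real n" if n: "1 \<le> n" for n
  proof -
    have "0 \<le> hmin * d" using pos d0 by simp
    hence "hmin * real n \<le> s n" using s_low[of n] unfolding distrib_left by linarith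
    hence "\<beta> n \<le> 1 / (hmin * real n)" unfolding \<beta>_def using n pos by (intro frac_le) auto
    also have "\<dots> = (1 / hmin) / real n" by simp
    also have "\<dots> \<le> K / real n" by (intro divide_right_mono) (auto simp: K_def)
    finally show ?thesis .
  qed
  have y_le: "norm (y n) \<le> K * real n" if n: "1 \<le> n" for n
  proof -
    have w0: "0 \<le> w n" using w_ge[of n] a mult_nonneg_nonneg[of a "real n"] by linarith
    have vb: "\<bar>v n $ i\<bar> \<le> (real n + d) + umax * (real n + d) * p $ i" for i
    proof -
      have "D n $ i \<le> (\<Sum>i\<in>UNIV. D n $ i)" by (rule member_le_sum) (auto simp: Dn)
      moreover have "w n * p $ i \<le> umax * (real n + d) * p $ i"
        using w_up[of n] p[of i] by (intro mult_right_mono) auto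
      moreover have "0 \<le> w n * p $ i" using w0 p[of i] by simp
      ultimately show ?thesis using Dn[of n i] unfolding Dsum by (simp add: v_def abs_le_iff)
    qed
    have vi: "\<bar>y n $ i\<bar> \<le> r i * (1 + umax * p $ i) * (real n + d)" for i
      using r[of i] mult_left_mono[OF vb[of i] less_imp_le[OF r[of i]]]
      by (simp add: y_def abs_mult algebra_simps)
    have "norm (y n) \<le> (\<Sum>i\<in>UNIV. \<bar>y n $ i\<bar>)" by (rule norm_le_l1_cart)
    also have "\<dots> \<le> (\<Sum>i\<in>UNIV. r i * (1 + umax * p $ i)) * (real n + d)"
      unfolding sum_distrib_right by (rule sum_mono) (rule vi)
    also have "\<dots> \<le> (\<Sum>i\<in>UNIV. r i * (1 + umax * p $ i)) * ((1 + d) * real n)"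
      using less_imp_le[OF r] less_imp_le[OF p] less_imp_le[OF pos'(1)]
      by (intro mult_left_mono t_le n sum_nonneg mult_nonneg_nonneg add_nonneg_nonneg) auto
    also have "\<dots> \<le> K * real n" unfolding mult.assoc[symmetric] by (intro mult_right_mono) (auto simp: K_def)
    finally show ?thesis .
  qed
  have ratio: "(\<lambda>n. norm (y n) / w n) \<longlonglongrightarrow> 0"
    by (rule perturbed_linear_recursion_ratio[where B = B and \<beta> = \<beta> and e = e and \<eta> = \<eta> and l = l
          and c = c and a = a and K = K])
       (use B y_Suc w_Suc l c y_gap e \<eta> a w_ge y_le \<beta>_ge \<beta>_le in auto)

  have w_pos: "0 < w n" if "1 \<le> n" for n
  proof -
    have "0 < a * real n" using a that by simp
    thus ?thesis using w_ge[of n] by linarith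
  qed
  have Dw: "(\<lambda>n. D n $ i / w n) \<longlonglongrightarrow> p $ i" for i
  proof -
    have "(\<lambda>n. y n $ i / w n) \<longlonglongrightarrow> 0"
    proof (rule Lim_null_comparison[OF _ ratio])
      show "eventually (\<lambda>n. norm (y n $ i / w n) \<le> norm (y n) / w n) sequentially"
        using eventually_ge_at_top[of 1]
      proof eventually_elim
        case (elim n)
        thus ?case using w_pos[of n] component_le_norm_cart[of "y n" i]
          by (simp add: divide_right_mono)
      qed
    qed
    hence "(\<lambda>n. (1 / r i) * (y n $ i / w n) + p $ i) \<longlonglongrightarrow> (1 / r i) * 0 + p $ i"
      by (intro tendsto_intros)
    moreover have "eventually (\<lambda>n. (1 / r i) * (y n $ i / w n) + p $ i = D n $ i / w n) sequentially"
      using eventually_ge_at_top[of 1]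
    proof eventually_elim
      case (elim n)
      thus ?case using w_pos[of n] r[of i] by (simp add: y_def v_def field_simps)
    qed
    ultimately show ?thesis by (simp add: tendsto_cong)
  qed
  have "(\<lambda>n. \<Sum>i\<in>UNIV. D n $ i / w n) \<longlonglongrightarrow> (\<Sum>i\<in>UNIV. p $ i)" by (intro tendsto_sum Dw)
  hence tw: "(\<lambda>n. (real n + d) / w n) \<longlonglongrightarrow> 1" by (simp add: sum_divide_distrib[symmetric] Dsum p1)
  have nt: "(\<lambda>n. (real n + d) / real n) \<longlonglongrightarrow> 1" by real_asymp
  have lim: "(\<lambda>n. (D n $ i / w n) / ((real n + d) / w n) * ((real n + d) / real n)) \<longlonglongrightarrow> p $ i / 1 * 1" for i
    by (intro tendsto_mult tendsto_divide Dw tw nt) auto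
  have ev: "eventually (\<lambda>n. (D n $ i / w n) / ((real n + d) / w n) * ((real n + d) / real n)
      = ((1 / real n) *\<^sub>R D n) $ i) sequentially" for i
    using eventually_ge_at_top[of 1]
  proof eventually_elim
    case (elim n)
    thus ?case using w_pos[of n] d0 by simp
  qed
  have "(\<lambda>n. ((1 / real n) *\<^sub>R D n) $ i) \<longlonglongrightarrow> p $ i / 1 * 1" for i
    by (rule Lim_transform_eventually[OF lim ev])
  thus ?thesis by (intro vec_tendstoI) simp
qed

lemma irreducible_image_sum_bounds:
  fixes A :: "real^'k^'k"
  assumes A: "irreducible_matrix A"
  obtains m where "0 < m"
    "\<And>v. (\<And>i. 0 \<le> v $ i) \<Longrightarrow> m * (\<Sum>i\<in>UNIV. v $ i) \<le> (\<Sum>j\<in>UNIV. (v v* A) $ j)"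
proof -
  define h where "h i = (\<Sum>j\<in>UNIV. A $ i $ j)" for i
  have h: "0 < h i" for i unfolding h_def using A by (rule irreducible_matrix_row_sum_pos)
  have "Min (range h) \<in> range h" by (rule Min_in) auto
  hence "0 < Min (range h)" using h by auto
  moreover have "Min (range h) * (\<Sum>i\<in>UNIV. v $ i) \<le> (\<Sum>j\<in>UNIV. (v v* A) $ j)"
    if v: "\<And>i. 0 \<le> v $ i" for v
  proof -
    have "(\<Sum>i\<in>UNIV. v $ i * Min (range h)) \<le> (\<Sum>i\<in>UNIV. v $ i * h i)"
      by (intro sum_mono mult_left_mono v Min_le) auto
    also have "\<dots> = (\<Sum>i\<in>UNIV. \<Sum>j\<in>UNIV. v $ i * A $ i $ j)" by (simp add: h_def sum_distrib_left)
    also have "\<dots> = (\<Sum>j\<in>UNIV. \<Sum>i\<in>UNIV. v $ i * A $ i $ j)" by (rule sum.swap)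
    also have "\<dots> = (\<Sum>j\<in>UNIV. (v v* A) $ j)" by (simp add: vector_matrix_mult_nth)
    finally show ?thesis by (simp add: sum_distrib_right[symmetric] mult.commute)
  qed
  ultimately show ?thesis by (rule that)
qed

text \<open>The pathwise half of the urn theorem: it suffices to know that the configuration is, up to
  \<open>o(n)\<close>, the sum of the past color proportions multiplied by the limit matrix.\<close>

lemma self_consistent_proportions_converge:
  fixes A :: "real^'k^'k" and C :: "nat \<Rightarrow> real^'k"
  defines "s \<equiv> \<lambda>n. \<Sum>i\<in>UNIV. C n $ i"
  assumes A: "irreducible_matrix A"
    and C0: "\<And>n i. 0 \<le> C n $ i" and s0: "\<And>n. 0 < s n"
    and C: "(\<lambda>n. (1 / real n) *\<^sub>R C n - (1 / real n) *\<^sub>R ((\<Sum>k<n. (1 / s k) *\<^sub>R C k) v* A)) \<longlonglongrightarrow> 0"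
  shows "(\<lambda>n. (1 / real n) *\<^sub>R (\<Sum>k<n. (1 / s k) *\<^sub>R C k)) \<longlonglongrightarrow> left_prob_eigenvector A"
    and "(\<lambda>n. (1 / real n) *\<^sub>R C n) \<longlonglongrightarrow> dominant_eigenvalue A *\<^sub>R left_prob_eigenvector A"
    and "(\<lambda>n. s n / real n) \<longlonglongrightarrow> dominant_eigenvalue A"
    and "(\<lambda>n. (1 / s n) *\<^sub>R C n) \<longlonglongrightarrow> left_prob_eigenvector A"
proof -
  obtain l p u where pf: "perron_vectors A l p u" using A by (rule irreducible_matrix_perron_vectors)
  have p: "0 < l" "p v* A = l *s p" "(\<Sum>i\<in>UNIV. p $ i) = 1" using pf by (auto simp: perron_vectors_def)
  have eq: "dominant_eigenvalue A = l" "left_prob_eigenvector A = p"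
    using dominant_eigenvalue_eq[OF A pf] left_prob_eigenvector_eq[OF A pf] by auto
  define x where "x n = (1 / s n) *\<^sub>R C n" for n
  define D where "D n = (\<Sum>k<n. x k)" for n
  have x0: "0 \<le> x n $ i" for n i using C0 s0[of n] by (simp add: x_def)
  have x1: "(\<Sum>i\<in>UNIV. x n $ i) = 1" for n
    using s0[of n] by (simp add: x_def sum_divide_distrib[symmetric] s_def)
  have D0: "0 \<le> D n $ i" for n i by (simp add: D_def x0 sum_nonneg)
  have Dsum: "(\<Sum>i\<in>UNIV. D n $ i) = real n" for n
  proof -
    have "(\<Sum>i\<in>UNIV. D n $ i) = (\<Sum>k<n. \<Sum>i\<in>UNIV. x k $ i)"
      unfolding D_def sum_component by (rule sum.swap)
    thus ?thesis by (simp add: x1)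
  qed
  obtain m where m: "0 < m"
    "\<And>v. (\<And>i. 0 \<le> v $ i) \<Longrightarrow> m * (\<Sum>i\<in>UNIV. v $ i) \<le> (\<Sum>j\<in>UNIV. (v v* A) $ j)"
    using irreducible_image_sum_bounds[OF A] by blast
  define t where "t n = (\<Sum>j\<in>UNIV. (D n v* A) $ j)" for n
  have t_ge: "m * real n \<le> t n" for n using m(2)[of "D n"] D0 by (simp add: t_def Dsum)
  have t_pos: "0 < t n" if "1 \<le> n" for n
  proof -
    have "0 < m * real n" using m(1) that by simp
    thus ?thesis using t_ge[of n] by linarith
  qed
  define z where "z n = (1 / real n) *\<^sub>R C n - (1 / real n) *\<^sub>R (D n v* A)" for n
  have z: "z \<longlonglongrightarrow> 0" using C by (simp add: z_def[abs_def] D_def x_def)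
  have "(\<lambda>n. \<Sum>i\<in>UNIV. z n $ i) \<longlonglongrightarrow> (\<Sum>i\<in>UNIV. (0::real^'k) $ i)"
    by (intro tendsto_sum tendsto_vec_nth z)
  moreover have "(\<Sum>i\<in>UNIV. z n $ i) = (s n - t n) / real n" for n
    by (simp add: z_def s_def t_def sum_subtractf sum_divide_distrib[symmetric] diff_divide_distrib)
  ultimately have st: "(\<lambda>n. (s n - t n) / real n) \<longlonglongrightarrow> 0" by simp
  have norm_x: "norm (x n) \<le> 1" for n
  proof -
    have "norm (x n) \<le> (\<Sum>i\<in>UNIV. \<bar>x n $ i\<bar>)" by (rule norm_le_l1_cart)
    thus ?thesis using x1[of n] x0 by simp
  qed
  \<comment> \<open>With \<open>s x = C\<close>, the difference is \<open>(n/t) (z - x (s - t)/n)\<close>, and \<open>n/t \<le> 1/m\<close>.\<close>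
  have xD: "(\<lambda>n. x n - (1 / t n) *\<^sub>R (D n v* A)) \<longlonglongrightarrow> 0"
  proof (rule Lim_null_comparison)
    show "eventually (\<lambda>n. norm (x n - (1 / t n) *\<^sub>R (D n v* A))
        \<le> (1 / m) * (norm (z n) + \<bar>(s n - t n) / real n\<bar>)) sequentially"
      using eventually_ge_at_top[of 1]
    proof eventually_elim
      case (elim n)
      have n: "0 < real n" using elim by simp
      have sx: "C n = s n *\<^sub>R x n" using s0[of n] by (simp add: x_def)
      have eq1: "x n - (1 / t n) *\<^sub>R (D n v* A) = (real n / t n) *\<^sub>R (z n - ((s n - t n) / real n) *\<^sub>R x n)"
      proof -
        have "a - (1 / T) * b = (N / T) * ((1 / N) * (S * a) - (1 / N) * b - ((S - T) / N) * a)"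
          if "0 < N" "0 < T" for a b N T S :: real using that by (simp add: field_simps)
        from this[OF n t_pos[OF elim]] show ?thesis unfolding z_def sx vec_eq_iff
          by (simp only: vector_minus_component vector_scaleR_component real_scaleR_def) blast
      qed
      have "\<bar>real n / t n\<bar> = real n / t n" using n t_pos[OF elim] by simp
      hence "norm (x n - (1 / t n) *\<^sub>R (D n v* A))
          = (real n / t n) * norm (z n - ((s n - t n) / real n) *\<^sub>R x n)"
        unfolding eq1 norm_scaleR by (simp only:)
      also have "\<dots> \<le> (1 / m) * (norm (z n) + \<bar>(s n - t n) / real n\<bar>)"
      proof (rule mult_mono)
        show "real n / t n \<le> 1 / m" using t_ge[of n] t_pos[OF elim] m(1) by (simp add: field_simps)
        have "norm (z n - ((s n - t n) / real n) *\<^sub>R x n)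
            \<le> norm (z n) + \<bar>(s n - t n) / real n\<bar> * norm (x n)"
          using norm_triangle_ineq4[of "z n" "((s n - t n) / real n) *\<^sub>R x n"] by simp
        also have "\<dots> \<le> norm (z n) + \<bar>(s n - t n) / real n\<bar>"
          using mult_left_mono[OF norm_x[of n] abs_ge_zero[of "(s n - t n) / real n"]] by simp
        finally show "norm (z n - ((s n - t n) / real n) *\<^sub>R x n) \<le> norm (z n) + \<bar>(s n - t n) / real n\<bar>" .
      qed (use m in auto)
      finally show ?case .
    qed
    have "(\<lambda>n. (1 / m) * (norm (z n) + \<bar>(s n - t n) / real n\<bar>)) \<longlonglongrightarrow> (1 / m) * (norm (0::real^'k) + \<bar>0\<bar>)"
      by (intro tendsto_intros z st)
    thus "(\<lambda>n. (1 / m) * (norm (z n) + \<bar>(s n - t n) / real n\<bar>)) \<longlonglongrightarrow> 0" by simp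
  qed
  have Dp: "(\<lambda>n. (1 / real n) *\<^sub>R D n) \<longlonglongrightarrow> p"
    by (rule normalized_linear_dynamics[OF A pf _ _ x0 x1 xD[unfolded t_def]]) (auto simp: D_def)
  thus "(\<lambda>n. (1 / real n) *\<^sub>R (\<Sum>k<n. (1 / s k) *\<^sub>R C k)) \<longlonglongrightarrow> left_prob_eigenvector A"
    by (simp add: eq D_def x_def)
  have "(\<lambda>n. ((1 / real n) *\<^sub>R D n) v* A) \<longlonglongrightarrow> p v* A"
    by (rule vec_tendstoI, unfold vector_matrix_mult_nth)
       (intro tendsto_sum tendsto_mult tendsto_vec_nth Dp tendsto_const)
  moreover have "((1 / real n) *\<^sub>R D n) v* A = (1 / real n) *\<^sub>R (D n v* A)" for n
    by (simp add: vec_eq_iff vector_matrix_mult_nth sum_divide_distrib)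
  ultimately have "(\<lambda>n. z n + (1 / real n) *\<^sub>R (D n v* A)) \<longlonglongrightarrow> 0 + p v* A"
    using z by (intro tendsto_add) auto
  hence Cn: "(\<lambda>n. (1 / real n) *\<^sub>R C n) \<longlonglongrightarrow> l *\<^sub>R p"
    by (simp add: z_def p(2) scalar_mult_eq_scaleR)
  thus "(\<lambda>n. (1 / real n) *\<^sub>R C n) \<longlonglongrightarrow> dominant_eigenvalue A *\<^sub>R left_prob_eigenvector A"
    by (simp add: eq)
  have "(\<lambda>n. \<Sum>i\<in>UNIV. ((1 / real n) *\<^sub>R C n) $ i) \<longlonglongrightarrow> (\<Sum>i\<in>UNIV. (l *\<^sub>R p) $ i)"
    by (intro tendsto_sum tendsto_vec_nth Cn)
  hence sn: "(\<lambda>n. s n / real n) \<longlonglongrightarrow> l"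
    by (simp add: sum_divide_distrib[symmetric] s_def sum_distrib_left[symmetric] p(3))
  thus "(\<lambda>n. s n / real n) \<longlonglongrightarrow> dominant_eigenvalue A" by (simp add: eq)
  have "(1 / l) *\<^sub>R (l *\<^sub>R p) = p" using p(1) by simp
  moreover have "(\<lambda>n. (1 / (s n / real n)) *\<^sub>R ((1 / real n) *\<^sub>R C n)) \<longlonglongrightarrow> (1 / l) *\<^sub>R (l *\<^sub>R p)"
    using p(1) by (intro tendsto_intros Cn sn) auto
  ultimately have lim: "(\<lambda>n. (1 / (s n / real n)) *\<^sub>R ((1 / real n) *\<^sub>R C n)) \<longlonglongrightarrow> p" by argo
  have ev: "eventually (\<lambda>n. (1 / (s n / real n)) *\<^sub>R ((1 / real n) *\<^sub>R C n) = (1 / s n) *\<^sub>R C n) sequentially"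
    using eventually_ge_at_top[of 1] by eventually_elim simp
  show "(\<lambda>n. (1 / s n) *\<^sub>R C n) \<longlonglongrightarrow> left_prob_eigenvector A"
    unfolding eq by (rule Lim_transform_eventually[OF lim ev])
qed

section \<open>Measurability of the Perron data\<close>

text \<open>The unperturbed recursion exhibits the Perron data as pointwise limits of measurable functions
  of the matrix.\<close>

primrec simplex_dynamics :: "real^'k^'k \<Rightarrow> nat \<Rightarrow> real^'k" where
  "simplex_dynamics A 0 = (\<chi> i. 1)"
| "simplex_dynamics A (Suc n) = simplex_dynamics A n +
     (1 / (\<Sum>j\<in>UNIV. (simplex_dynamics A n v* A) $ j)) *\<^sub>R (simplex_dynamics A n v* A)"

lemma simplex_dynamics_tendsto:
  fixes A :: "real^'k^'k"
  assumes A: "irreducible_matrix A"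
  shows "(\<lambda>n. (1 / real n) *\<^sub>R simplex_dynamics A n) \<longlonglongrightarrow> left_prob_eigenvector A"
proof -
  obtain l p u where pf: "perron_vectors A l p u" using A by (rule irreducible_matrix_perron_vectors)
  obtain m where m: "0 < m"
    "\<And>v. (\<And>i. 0 \<le> v $ i) \<Longrightarrow> m * (\<Sum>i\<in>UNIV. v $ i) \<le> (\<Sum>j\<in>UNIV. (v v* A) $ j)"
    using irreducible_image_sum_bounds[OF A] by blast
  define D where "D = simplex_dynamics A"
  define t where "t n = (\<Sum>j\<in>UNIV. (D n v* A) $ j)" for n
  have DA: "0 \<le> (D n v* A) $ j" if "\<And>i. 0 \<le> D n $ i" for n j
    using that by (auto simp: vector_matrix_mult_nth irreducible_matrix_nonneg[OF A] intro!: sum_nonneg)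
  have D1: "1 \<le> D n $ i" for n i
  proof (induction n arbitrary: i)
    case (Suc n)
    have "0 \<le> D n $ i" for i using Suc[of i] by simp
    hence "0 \<le> (D n v* A) $ i" for i by (rule DA)
    hence "0 \<le> (1 / t n) * (D n v* A) $ i" for i by (simp add: t_def sum_nonneg)
    moreover have "D (Suc n) $ i = D n $ i + (1 / t n) * (D n v* A) $ i" by (simp add: D_def t_def)
    ultimately show ?case using Suc[of i] by (metis add_increasing2)
  qed (simp add: D_def)
  have D0: "0 \<le> D n $ i" for n i using D1[of n i] by simp
  have t: "0 < t n" for n
  proof -
    have "0 < (\<Sum>i\<in>UNIV. D n $ i)" using D1 by (intro sum_pos) (auto intro: less_le_trans[OF zero_less_one])
    hence "0 < m * (\<Sum>i\<in>UNIV. D n $ i)" using m(1) by simp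
    also have "\<dots> \<le> t n" unfolding t_def using D0 by (rule m(2))
    finally show ?thesis .
  qed
  define x where "x n = (1 / t n) *\<^sub>R (D n v* A)" for n
  have "(\<lambda>n. (1 / real n) *\<^sub>R D n) \<longlonglongrightarrow> p"
  proof (rule normalized_linear_dynamics[OF A pf, where x = x])
    show "(\<Sum>i\<in>UNIV. x n $ i) = 1" for n
      using t[of n] by (simp add: x_def sum_divide_distrib[symmetric] t_def[symmetric])
    show "0 \<le> x n $ i" for n i using t[of n] DA[OF D0] by (simp add: x_def less_imp_le)
  qed (use D0 in \<open>auto simp: D_def x_def t_def\<close>)
  thus ?thesis by (simp add: D_def left_prob_eigenvector_eq[OF A pf])
qed

lemma measurable_vec_lambda:
  fixes f :: "'i::finite \<Rightarrow> 'w \<Rightarrow> real"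
  assumes "\<And>i. f i \<in> borel_measurable M"
  shows "(\<lambda>w. \<chi> i. f i w) \<in> borel_measurable M"
proof (subst borel_measurable_euclidean_space, rule ballI)
  fix b :: "real^'i" assume "b \<in> Basis"
  then obtain i where b: "b = axis i 1" by (auto simp: Basis_vec_def)
  have "(\<lambda>w. (\<chi> i. f i w) \<bullet> b) = f i" by (auto simp: b inner_axis)
  thus "(\<lambda>w. (\<chi> i. f i w) \<bullet> b) \<in> borel_measurable M" using assms by simp
qed

lemma measurable_vec_nth:
  fixes f :: "'w \<Rightarrow> 'a::euclidean_space^'i"
  assumes "f \<in> borel_measurable M" shows "(\<lambda>w. f w $ i) \<in> borel_measurable M"
proof -
  have "continuous_on UNIV (\<lambda>v::'a^'i. v $ i)" by (intro continuous_intros)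
  thus ?thesis by (rule borel_measurable_continuous_on[OF _ assms])
qed

lemma measurable_vector_matrix_mult:
  fixes f :: "'w \<Rightarrow> real^'i" and g :: "'w \<Rightarrow> real^'j^'i"
  assumes "f \<in> borel_measurable M" "g \<in> borel_measurable M"
  shows "(\<lambda>w. f w v* g w) \<in> borel_measurable M"
  unfolding vector_matrix_mult_def using assms
  by (intro measurable_vec_lambda borel_measurable_sum borel_measurable_times measurable_vec_nth)

lemma measurable_left_prob_eigenvector:
  fixes H :: "'w \<Rightarrow> real^'k^'k"
  assumes H: "H \<in> borel_measurable M"
  shows "(\<lambda>w. left_prob_eigenvector (H w)) \<in> borel_measurable M" (is ?p)
    and "(\<lambda>w. dominant_eigenvalue (H w)) \<in> borel_measurable M" (is ?l)
proof -
  have [measurable]: "(\<lambda>w. H w $ i $ j) \<in> borel_measurable M" for i j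
    by (intro measurable_vec_nth H)
  have [measurable]: "(\<lambda>w. matrix_power (H w) n $ i $ j) \<in> borel_measurable M" for n i j
    by (induction n arbitrary: i) (simp_all add: matrix_matrix_mult_def)
  have pred: "{w \<in> space M. irreducible_matrix (H w)} \<in> sets M"
    unfolding irreducible_matrix_def nonneg_matrix_def by measurable
  have D: "(\<lambda>w. simplex_dynamics (H w) n) \<in> borel_measurable M" for n
  proof (induction n)
    case (Suc n)
    have "(\<lambda>w. simplex_dynamics (H w) n v* H w) \<in> borel_measurable M"
      by (intro measurable_vector_matrix_mult Suc H)
    thus ?case unfolding simplex_dynamics.simps using Suc
      by (intro borel_measurable_add borel_measurable_scaleR borel_measurable_divide
          borel_measurable_sum measurable_vec_nth borel_measurable_const)
  qed simp
  have lim: "(\<lambda>n. if irreducible_matrix (H w) then (1 / real n) *\<^sub>R simplex_dynamics (H w) n else 0)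
      \<longlonglongrightarrow> left_prob_eigenvector (H w)" for w
  proof (cases "irreducible_matrix (H w)")
    case True
    thus ?thesis using simplex_dynamics_tendsto[OF True] by simp
  next
    case False
    thus ?thesis by (simp add: left_prob_eigenvector_def)
  qed
  have f: "(\<lambda>w. if irreducible_matrix (H w) then (1 / real n) *\<^sub>R simplex_dynamics (H w) n else 0)
      \<in> borel_measurable M" for n
    by (intro measurable_If pred borel_measurable_scaleR D borel_measurable_const)
  show p: ?p
    by (rule borel_measurable_LIMSEQ_metric[where f = "\<lambda>n w. if irreducible_matrix (H w)
          then (1 / real n) *\<^sub>R simplex_dynamics (H w) n else 0"]) (rule f, rule lim)
  have eq: "dominant_eigenvalue (H w) = (if irreducible_matrix (H w)
      then \<Sum>j\<in>UNIV. (left_prob_eigenvector (H w) v* H w) $ j else 0)" for w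
  proof (cases "irreducible_matrix (H w)")
    case True
    then obtain l p u where pf: "perron_vectors (H w) l p u" by (rule irreducible_matrix_perron_vectors)
    have "(\<Sum>j\<in>UNIV. (p v* H w) $ j) = l"
      using pf by (simp add: perron_vectors_def sum_distrib_left[symmetric])
    thus ?thesis using True
      by (simp add: dominant_eigenvalue_eq[OF True pf] left_prob_eigenvector_eq[OF True pf])
  qed (simp add: dominant_eigenvalue_def)
  show ?l unfolding eq
    by (intro measurable_If pred borel_measurable_sum measurable_vec_nth
        measurable_vector_matrix_mult p H borel_measurable_const)
qed

section \<open>A strong law for martingale differences\<close>

lemma (in prob_space) subalgebra_sigma_finite:
  assumes "subalgebra M F" shows "sigma_finite_subalgebra M F"
proof -
  interpret finite_measure_subalgebra M F by unfold_locales (rule assms)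
  show ?thesis by unfold_locales
qed

lemma integrable_mult_of_squares:
  fixes f g :: "'w \<Rightarrow> real"
  assumes [measurable]: "f \<in> borel_measurable M" "g \<in> borel_measurable M"
    and int: "integrable M (\<lambda>w. (f w)\<^sup>2)" "integrable M (\<lambda>w. (g w)\<^sup>2)"
  shows "integrable M (\<lambda>w. f w * g w)"
proof (rule Bochner_Integration.integrable_bound)
  show "integrable M (\<lambda>w. (f w)\<^sup>2 + (g w)\<^sup>2)" using int by (rule Bochner_Integration.integrable_add)
  have "\<bar>a * b\<bar> \<le> a\<^sup>2 + b\<^sup>2" for a b :: real
  proof -
    have "2 * \<bar>a\<bar> * \<bar>b\<bar> \<le> a\<^sup>2 + b\<^sup>2" using sum_squares_bound[of "\<bar>a\<bar>" "\<bar>b\<bar>"] by simp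
    moreover have "0 \<le> \<bar>a\<bar> * \<bar>b\<bar>" by simp
    ultimately show ?thesis unfolding abs_mult by linarith
  qed
  hence "norm (f w * g w) \<le> norm ((f w)\<^sup>2 + (g w)\<^sup>2)" for w by simp
  thus "AE w in M. norm (f w * g w) \<le> norm ((f w)\<^sup>2 + (g w)\<^sup>2)" by blast
qed simp

text \<open>Kolmogorov's inequality, by stopping the partial sums at the first time their modulus reaches \<open>a\<close>:
  the increments of the stopped sums are still orthogonal, and the stopped sum remembers
  whether the level was ever reached.\<close>

primrec stopped_sum :: "real \<Rightarrow> (nat \<Rightarrow> 'w \<Rightarrow> real) \<Rightarrow> nat \<Rightarrow> 'w \<Rightarrow> real" where
  "stopped_sum a \<xi> 0 w = 0"
| "stopped_sum a \<xi> (Suc n) w =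
     stopped_sum a \<xi> n w + (if \<bar>stopped_sum a \<xi> n w\<bar> < a then \<xi> (Suc n) w else 0)"

lemma stopped_sum_reaches:
  assumes "m \<le> n" "a \<le> \<bar>\<Sum>k=1..m. \<xi> k w\<bar>"
  shows "a \<le> \<bar>stopped_sum a \<xi> n w\<bar>"
proof -
  have "a \<le> \<bar>stopped_sum a \<xi> n w\<bar> \<or>
      stopped_sum a \<xi> n w = (\<Sum>k=1..n. \<xi> k w) \<and> (\<forall>m\<le>n. \<bar>\<Sum>k=1..m. \<xi> k w\<bar> < a)"
  proof (induction n)
    case (Suc n)
    thus ?case
    proof
      assume *: "stopped_sum a \<xi> n w = (\<Sum>k=1..n. \<xi> k w) \<and> (\<forall>m\<le>n. \<bar>\<Sum>k=1..m. \<xi> k w\<bar> < a)"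
      hence "stopped_sum a \<xi> (Suc n) w = (\<Sum>k=1..Suc n. \<xi> k w)" by simp
      thus ?thesis using * by (metis le_Suc_eq not_le)
    qed simp
  qed auto
  thus ?thesis using assms by (metis not_le)
qed

locale martingale_differences = prob_space M for M :: "'w measure" +
  fixes F :: "nat \<Rightarrow> 'w measure" and \<xi> :: "nat \<Rightarrow> 'w \<Rightarrow> real"
  assumes subalg: "\<And>n. subalgebra M (F n)"
    and filt: "\<And>n. sets (F n) \<subseteq> sets (F (Suc n))"
    and adapted: "\<And>n. \<xi> (Suc n) \<in> borel_measurable (F (Suc n))"
    and square_integrable: "\<And>n. integrable M (\<lambda>w. (\<xi> (Suc n) w)\<^sup>2)"
    and centered: "\<And>n. AE w in M. real_cond_exp M (F n) (\<xi> (Suc n)) w = 0"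
begin

lemma xi_measurable [measurable]: "\<xi> (Suc n) \<in> borel_measurable M"
  by (rule measurable_from_subalg[OF subalg adapted])

lemma stopped_sum_adapted: "stopped_sum a \<xi> n \<in> borel_measurable (F n)"
proof (induction n)
  case (Suc n)
  have "subalgebra (F (Suc n)) (F n)"
    using subalg[of n] subalg[of "Suc n"] filt[of n] by (auto simp: subalgebra_def)
  hence [measurable]: "stopped_sum a \<xi> n \<in> borel_measurable (F (Suc n))"
    using Suc by (rule measurable_from_subalg)
  have [measurable]: "\<xi> (Suc n) \<in> borel_measurable (F (Suc n))" by (rule adapted)
  have "(\<lambda>w. stopped_sum a \<xi> n w + (if \<bar>stopped_sum a \<xi> n w\<bar> < a then \<xi> (Suc n) w else 0))
      \<in> borel_measurable (F (Suc n))" by measurable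
  thus ?case by (simp add: fun_eq_iff cong: measurable_cong)
qed simp

lemma stopped_sum_measurable [measurable]: "stopped_sum a \<xi> n \<in> borel_measurable M"
  by (rule measurable_from_subalg[OF subalg stopped_sum_adapted])

lemma stopped_sum_second_moment:
  "integrable M (\<lambda>w. (stopped_sum a \<xi> n w)\<^sup>2) \<and>
   (\<integral>w. (stopped_sum a \<xi> n w)\<^sup>2 \<partial>M) \<le> (\<Sum>k<n. \<integral>w. (\<xi> (Suc k) w)\<^sup>2 \<partial>M)"
proof (induction n)
  case (Suc n)
  define Z where "Z = stopped_sum a \<xi> n"
  define I where "I w = (if \<bar>Z w\<bar> < a then 1 else 0 :: real)" for w
  have ZF: "Z \<in> borel_measurable (F n)" unfolding Z_def by (rule stopped_sum_adapted)
  have [measurable]: "Z \<in> borel_measurable M" by (simp add: Z_def)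
  have I[measurable]: "I \<in> borel_measurable M" unfolding I_def by measurable
  have ZI: "(\<lambda>w. Z w * I w) \<in> borel_measurable (F n)"
  proof -
    note ZF[measurable]
    show ?thesis unfolding I_def by measurable
  qed
  have Z2: "integrable M (\<lambda>w. (Z w)\<^sup>2)" using Suc by (simp add: Z_def)
  have I\<xi>: "integrable M (\<lambda>w. (I w * \<xi> (Suc n) w)\<^sup>2)"
    by (rule Bochner_Integration.integrable_bound[OF square_integrable[of n]])
       (auto simp: I_def)
  have ZI\<xi>: "integrable M (\<lambda>w. (Z w * I w) * \<xi> (Suc n) w)"
    using integrable_mult_of_squares[OF _ _ Z2 I\<xi>] by (simp add: mult.assoc)
  interpret sigma_finite_subalgebra M "F n" by (rule subalgebra_sigma_finite[OF subalg])
  have "(\<integral>w. (Z w * I w) * \<xi> (Suc n) w \<partial>M)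
      = (\<integral>w. (Z w * I w) * real_cond_exp M (F n) (\<xi> (Suc n)) w \<partial>M)"
    by (rule real_cond_exp_intg(2)[OF ZI\<xi> ZI, symmetric]) simp
  also have "\<dots> = (\<integral>w. 0 \<partial>M)"
  proof (rule integral_cong_AE)
    show "AE w in M. Z w * I w * real_cond_exp M (F n) (\<xi> (Suc n)) w = 0"
      using centered[of n] by eventually_elim simp
  qed auto
  finally have cross: "(\<integral>w. (Z w * I w) * \<xi> (Suc n) w \<partial>M) = 0" by simp
  have eq: "(stopped_sum a \<xi> (Suc n) w)\<^sup>2
      = (Z w)\<^sup>2 + 2 * ((Z w * I w) * \<xi> (Suc n) w) + (I w * \<xi> (Suc n) w)\<^sup>2" for w
    by (simp add: Z_def[symmetric] I_def power2_eq_square algebra_simps)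
  have int: "integrable M (\<lambda>w. (stopped_sum a \<xi> (Suc n) w)\<^sup>2)"
    unfolding eq using Z2 ZI\<xi> I\<xi> by simp
  have "(\<integral>w. (stopped_sum a \<xi> (Suc n) w)\<^sup>2 \<partial>M)
      = (\<integral>w. (Z w)\<^sup>2 \<partial>M) + (\<integral>w. (I w * \<xi> (Suc n) w)\<^sup>2 \<partial>M)"
    unfolding eq using Z2 ZI\<xi> I\<xi> cross by simp
  also have "\<dots> \<le> (\<Sum>k<n. \<integral>w. (\<xi> (Suc k) w)\<^sup>2 \<partial>M) + (\<integral>w. (\<xi> (Suc n) w)\<^sup>2 \<partial>M)"
    using Suc by (intro add_mono integral_mono I\<xi> square_integrable) (auto simp: Z_def I_def)
  finally show ?case using int by simp
qed simp

lemma kolmogorov_inequality: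
  assumes a: "0 < a"
  shows "prob {w \<in> space M. \<exists>m\<le>n. a \<le> \<bar>\<Sum>k=1..m. \<xi> k w\<bar>} \<le> (\<Sum>k<n. \<integral>w. (\<xi> (Suc k) w)\<^sup>2 \<partial>M) / a\<^sup>2"
proof -
  have "prob {w \<in> space M. \<exists>m\<le>n. a \<le> \<bar>\<Sum>k=1..m. \<xi> k w\<bar>}
      \<le> prob {w \<in> space M. a\<^sup>2 \<le> (stopped_sum a \<xi> n w)\<^sup>2}"
  proof (rule finite_measure_mono)
    have "a\<^sup>2 \<le> (stopped_sum a \<xi> n w)\<^sup>2" if "m \<le> n" "a \<le> \<bar>\<Sum>k=1..m. \<xi> k w\<bar>" for m w
      using stopped_sum_reaches[where \<xi> = \<xi> and w = w, OF that] a by (simp flip: abs_le_square_iff)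
    thus "{w \<in> space M. \<exists>m\<le>n. a \<le> \<bar>\<Sum>k=1..m. \<xi> k w\<bar>} \<subseteq> {w \<in> space M. a\<^sup>2 \<le> (stopped_sum a \<xi> n w)\<^sup>2}"
      by blast
  qed measurable
  also have "\<dots> \<le> (\<integral>w. (stopped_sum a \<xi> n w)\<^sup>2 \<partial>M) / a\<^sup>2"
    using stopped_sum_second_moment a
    by (intro integral_Markov_inequality_measure[where A = "space M"]) auto
  also have "\<dots> \<le> (\<Sum>k<n. \<integral>w. (\<xi> (Suc k) w)\<^sup>2 \<partial>M) / a\<^sup>2"
    using stopped_sum_second_moment by (intro divide_right_mono) auto
  finally show ?thesis .
qed

lemma partial_sums_measurable [measurable]: "(\<lambda>w. \<Sum>k=1..m. \<xi> k w) \<in> borel_measurable M"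
proof (rule borel_measurable_sum)
  fix k assume "k \<in> {1..m}"
  thus "\<xi> k \<in> borel_measurable M" using xi_measurable[of "k - 1"] by simp
qed

end

lemma sum_dyadic_quarter_powers_le:
  "(\<Sum>j<J. if k < 2 ^ j then (1/4::real) ^ j else 0) \<le> (4/3) / (real (Suc k))\<^sup>2"
proof -
  obtain i where i: "k < 2 ^ i" "\<And>j. k < 2 ^ j \<Longrightarrow> i \<le> j"
    using LeastI[of "\<lambda>i. k < 2 ^ i" k] Least_le[of "\<lambda>i. k < 2 ^ i"] less_exp[of k] by blast
  have "(\<Sum>j<J. if k < 2 ^ j then (1/4::real) ^ j else 0) \<le> (4/3) * (1/4) ^ i"
  proof -
    have "(\<Sum>j<J. if k < 2 ^ j then (1/4::real) ^ j else 0) \<le> (\<Sum>j<i+J. if i \<le> j then (1/4::real) ^ j else 0)"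
    proof (rule order_trans)
      show "(\<Sum>j<J. if k < 2 ^ j then (1/4::real) ^ j else 0) \<le> (\<Sum>j<J. if i \<le> j then (1/4::real) ^ j else 0)"
        using i(2) by (intro sum_mono) auto
      show "(\<Sum>j<J. if i \<le> j then (1/4::real) ^ j else 0) \<le> (\<Sum>j<i+J. if i \<le> j then (1/4::real) ^ j else 0)"
        by (intro sum_mono2) auto
    qed
    also have "\<dots> \<le> (4/3) * (1/4) ^ i - (4/3) * (1/4) ^ (i + J)"
    proof (induction J)
      case 0
      have "(\<Sum>j<i. if i \<le> j then (1/4::real) ^ j else 0) = 0" by (intro sum.neutral) auto
      thus ?case by simp
    qed simp
    also have "\<dots> \<le> (4/3) * (1/4) ^ i" by simp
    finally show ?thesis .
  qed
  also have "(1/4::real) ^ i \<le> 1 / (real (Suc k))\<^sup>2"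
  proof -
    have "real (Suc k) \<le> 2 ^ i" using i(1) by (metis Suc_leI of_nat_le_iff of_nat_numeral of_nat_power)
    hence "(real (Suc k))\<^sup>2 \<le> (2 ^ i)\<^sup>2" by (intro power_mono) auto
    also have "(2 ^ i)\<^sup>2 = (4::real) ^ i" by (simp add: power2_eq_square flip: power_mult_distrib)
    finally show ?thesis by (simp add: power_one_over field_simps)
  qed
  finally show ?thesis by simp
qed

text \<open>Kolmogorov's inequality on the dyadic blocks \<open>{..2\<^sup>j}\<close> and the Borel--Cantelli lemma. A second
  moment at index \<open>k\<close> occurs in all blocks with \<open>2\<^sup>j \<ge> k\<close>, with total weight of order \<open>1/k\<^sup>2\<close>.\<close>

lemma (in martingale_differences) strong_law:
  assumes summ: "summable (\<lambda>k. (\<integral>w. (\<xi> (Suc k) w)\<^sup>2 \<partial>M) / (real (Suc k))\<^sup>2)"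
  shows "AE w in M. (\<lambda>n. (1 / real n) * (\<Sum>k=1..n. \<xi> k w)) \<longlonglongrightarrow> 0"
proof -
  define \<sigma> where "\<sigma> k = (\<integral>w. (\<xi> (Suc k) w)\<^sup>2 \<partial>M)" for k
  have \<sigma>0: "0 \<le> \<sigma> k" for k by (simp add: \<sigma>_def)
  define T where "T m w = (\<Sum>k=1..m. \<xi> k w)" for m w
  have block: "AE w in M. eventually (\<lambda>j. \<forall>m\<le>2 ^ j. \<bar>T m w\<bar> < e * 2 ^ j) sequentially" if e: "0 < e" for e
  proof -
    define A where "A j = {w \<in> space M. \<exists>m\<le>2 ^ j. e * 2 ^ j \<le> \<bar>T m w\<bar>}" for j
    have A[measurable]: "A j \<in> sets M" for j unfolding A_def T_def by measurable
    have PA: "prob (A j) \<le> (\<Sum>k<2 ^ j. \<sigma> k) * (1/4) ^ j / e\<^sup>2" for j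
    proof -
      have "prob (A j) \<le> (\<Sum>k<2 ^ j. \<sigma> k) / (e * 2 ^ j)\<^sup>2"
        unfolding A_def T_def \<sigma>_def using e by (intro kolmogorov_inequality) simp
      also have "(e * 2 ^ j)\<^sup>2 = e\<^sup>2 * 4 ^ j"
      proof -
        have "((2::real) ^ j)\<^sup>2 = 4 ^ j" by (simp add: power2_eq_square flip: power_mult_distrib)
        thus ?thesis by (simp add: power_mult_distrib)
      qed
      finally show ?thesis by (simp add: power_one_over field_simps)
    qed
    have "summable (\<lambda>j. (\<Sum>k<2 ^ j. \<sigma> k) * (1/4) ^ j)"
    proof (rule summableI_nonneg_bounded)
      fix J :: nat
      have sub: "(\<Sum>k<2 ^ j. \<sigma> k) = (\<Sum>k<2 ^ J. if k < 2 ^ j then \<sigma> k else 0)" if "j < J" for j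
      proof -
        have "{..<2 ^ J} \<inter> {k. k < 2 ^ j} = {..<(2::nat) ^ j}"
        proof -
          have "(2::nat) ^ j \<le> 2 ^ J" using that by (intro power_increasing) auto
          hence "k < 2 ^ J" if "k < 2 ^ j" for k :: nat using that by (rule less_le_trans[rotated])
          thus ?thesis by blast
        qed
        thus ?thesis by (simp add: sum.If_cases)
      qed
      have "(\<Sum>j<J. (\<Sum>k<2 ^ j. \<sigma> k) * (1/4) ^ j)
          = (\<Sum>j<J. \<Sum>k<2 ^ J. (if k < 2 ^ j then \<sigma> k else 0) * (1/4) ^ j)"
        by (intro sum.cong refl) (simp add: sub sum_distrib_right)
      also have "\<dots> = (\<Sum>k<2 ^ J. \<Sum>j<J. (if k < 2 ^ j then \<sigma> k else 0) * (1/4) ^ j)" by (rule sum.swap)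
      also have "\<dots> = (\<Sum>k<2 ^ J. \<sigma> k * (\<Sum>j<J. if k < 2 ^ j then (1/4) ^ j else 0))"
        by (auto simp: sum_distrib_left intro!: sum.cong)
      also have "\<dots> \<le> (\<Sum>k<2 ^ J. \<sigma> k * ((4/3) / (real (Suc k))\<^sup>2))"
        by (intro sum_mono mult_left_mono sum_dyadic_quarter_powers_le \<sigma>0)
      also have "\<dots> = (4/3) * (\<Sum>k<2 ^ J. \<sigma> k / (real (Suc k))\<^sup>2)"
        by (simp add: sum_distrib_left mult.commute)
      also have "\<dots> \<le> (4/3) * (\<Sum>k. \<sigma> k / (real (Suc k))\<^sup>2)"
        using summ \<sigma>0 by (intro mult_left_mono sum_le_suminf) (auto simp: \<sigma>_def)
      finally show "(\<Sum>j<J. (\<Sum>k<2 ^ j. \<sigma> k) * (1/4) ^ j) \<le> (4/3) * (\<Sum>k. \<sigma> k / (real (Suc k))\<^sup>2)" .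
    qed (simp add: \<sigma>0 sum_nonneg)
    hence "summable (\<lambda>j. (\<Sum>k<2 ^ j. \<sigma> k) * (1/4) ^ j / e\<^sup>2)" by (rule summable_divide)
    hence "summable (\<lambda>j. prob (A j))"
      by (rule summable_comparison_test') (use PA in auto)
    hence "AE w in M. eventually (\<lambda>j. w \<in> space M - A j) sequentially"
      by (intro borel_cantelli_AE1 A) (simp_all add: emeasure_eq_measure)
    thus ?thesis
    proof eventually_elim
      case (elim w)
      thus ?case
      proof eventually_elim
        case (elim j)
        show ?case using elim unfolding A_def by (simp add: not_le) (meson not_le)
      qed
    qed
  qed
  have "AE w in M. \<forall>p. eventually (\<lambda>j. \<forall>m\<le>2 ^ j. \<bar>T m w\<bar> < inverse (real (Suc p)) * 2 ^ j) sequentially"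
    using block by (simp add: AE_all_countable)
  thus ?thesis
  proof eventually_elim
    case (elim w)
    show ?case
    proof (rule LIMSEQ_I)
      fix r :: real assume "0 < r"
      then obtain p where p: "inverse (real (Suc p)) < r / 2" using reals_Archimedean[of "r/2"] by auto
      obtain J where J: "\<And>j m. j \<ge> J \<Longrightarrow> m \<le> 2 ^ j \<Longrightarrow> \<bar>T m w\<bar> < inverse (real (Suc p)) * 2 ^ j"
        using elim unfolding eventually_sequentially by blast
      show "\<exists>no. \<forall>n\<ge>no. norm ((1 / real n) * (\<Sum>k=1..n. \<xi> k w) - 0) < r"
      proof (intro exI allI impI)
        fix n :: nat assume n: "n \<ge> 2 ^ J"
        hence n1: "1 \<le> n" using one_le_power[of "2::nat" J] by linarith
        obtain j where j: "2 ^ j \<le> n" "n < 2 ^ (j + 1)" using ex_power_ivl1[of 2 n] n1 by auto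
        have "(2::nat) ^ J < 2 ^ (j + 1)" using n j by linarith
        hence "J < j + 1" by (rule power_less_imp_less_exp[rotated]) simp
        hence "\<bar>T n w\<bar> < inverse (real (Suc p)) * 2 ^ (j + 1)" using J[of "j + 1" n] j by (simp only: less_imp_le)
        also have "\<dots> = inverse (real (Suc p)) * 2 * 2 ^ j" by simp
        also have "\<dots> \<le> inverse (real (Suc p)) * 2 * real n"
        proof (intro mult_left_mono)
          show "2 ^ j \<le> real n" using j(1) by (metis of_nat_le_iff of_nat_numeral of_nat_power)
        qed simp
        also have "\<dots> \<le> r * real n" using p by (intro mult_right_mono) auto
        finally have "\<bar>T n w\<bar> < r * real n" .
        thus "norm ((1 / real n) * (\<Sum>k=1..n. \<xi> k w) - 0) < r"
          using n1 unfolding T_def by (simp add: field_simps abs_mult)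
      qed
    qed
  qed
qed

text \<open>Subtracting the conditional mean does not increase the second moment, so the strong law applies
  to an adapted sequence centered by its conditional means.\<close>

lemma (in prob_space) strong_law_conditional_means:
  fixes F :: "nat \<Rightarrow> 'a measure" and Y :: "nat \<Rightarrow> 'a \<Rightarrow> real"
  assumes subalg: "\<And>n. subalgebra M (F n)"
    and filt: "\<And>n. sets (F n) \<subseteq> sets (F (Suc n))"
    and adapted: "\<And>n. Y (Suc n) \<in> borel_measurable (F (Suc n))"
    and square: "\<And>n. integrable M (\<lambda>w. (Y (Suc n) w)\<^sup>2)"
    and summ: "summable (\<lambda>k. (\<integral>w. (Y (Suc k) w)\<^sup>2 \<partial>M) / (real (Suc k))\<^sup>2)"
    and m: "\<And>n. m n \<in> borel_measurable (F n)" "\<And>n. integrable M (\<lambda>w. (m n w)\<^sup>2)"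
      "\<And>n. AE w in M. real_cond_exp M (F n) (Y (Suc n)) w = m n w"
  shows "AE w in M. (\<lambda>n. (1 / real n) * (\<Sum>k=1..n. Y k w - m (k - 1) w)) \<longlonglongrightarrow> 0"
proof -
  define \<xi> where "\<xi> k w = Y k w - m (k - 1) w" for k w
  have [measurable]: "Y (Suc n) \<in> borel_measurable M" for n
    by (rule measurable_from_subalg[OF subalg adapted])
  have [measurable]: "m n \<in> borel_measurable M" for n
    by (rule measurable_from_subalg[OF subalg m(1)])
  have Ym: "integrable M (\<lambda>w. m n w * Y (Suc n) w)" for n
    by (rule integrable_mult_of_squares) (auto simp: m square)
  have intY: "integrable M (Y (Suc n))" and intm: "integrable M (m n)" for n
    using integrable_mult_of_squares[of "Y (Suc n)" M "\<lambda>_. 1"] integrable_mult_of_squares[of "m n" M "\<lambda>_. 1"]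
    by (auto simp: square m)
  have sq: "(\<xi> (Suc n) w)\<^sup>2 = (Y (Suc n) w)\<^sup>2 - 2 * (m n w * Y (Suc n) w) + (m n w)\<^sup>2" for n w
    by (simp add: \<xi>_def power2_eq_square algebra_simps)
  have int\<xi>: "integrable M (\<lambda>w. (\<xi> (Suc n) w)\<^sup>2)" for n
    unfolding sq using square Ym m(2) by simp
  have mom: "(\<integral>w. (\<xi> (Suc n) w)\<^sup>2 \<partial>M) \<le> (\<integral>w. (Y (Suc n) w)\<^sup>2 \<partial>M)" for n
  proof -
    interpret sigma_finite_subalgebra M "F n" by (rule subalgebra_sigma_finite[OF subalg])
    have "(\<integral>w. m n w * Y (Suc n) w \<partial>M) = (\<integral>w. m n w * real_cond_exp M (F n) (Y (Suc n)) w \<partial>M)"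
      by (rule real_cond_exp_intg(2)[OF Ym m(1), symmetric]) simp
    also have "\<dots> = (\<integral>w. (m n w)\<^sup>2 \<partial>M)"
    proof (rule integral_cong_AE)
      show "AE w in M. m n w * real_cond_exp M (F n) (Y (Suc n)) w = (m n w)\<^sup>2"
        using m(3)[of n] by eventually_elim (simp add: power2_eq_square)
    qed auto
    finally have "(\<integral>w. (\<xi> (Suc n) w)\<^sup>2 \<partial>M) = (\<integral>w. (Y (Suc n) w)\<^sup>2 \<partial>M) - (\<integral>w. (m n w)\<^sup>2 \<partial>M)"
      unfolding sq using square Ym m(2) by simp
    moreover have "0 \<le> (\<integral>w. (m n w)\<^sup>2 \<partial>M)" by simp
    ultimately show ?thesis by linarith
  qed
  interpret martingale_differences M F \<xi>
  proof unfold_locales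
    fix n
    have "subalgebra (F (Suc n)) (F n)"
      using subalg[of n] subalg[of "Suc n"] filt[of n] by (auto simp: subalgebra_def)
    hence "m n \<in> borel_measurable (F (Suc n))" using m(1) by (rule measurable_from_subalg)
    thus "\<xi> (Suc n) \<in> borel_measurable (F (Suc n))"
      unfolding \<xi>_def using adapted by (simp add: borel_measurable_diff)
    have \<xi>_eq: "\<xi> (Suc n) = (\<lambda>w. Y (Suc n) w - m n w)" by (simp add: \<xi>_def fun_eq_iff)
    interpret sigma_finite_subalgebra M "F n" by (rule subalgebra_sigma_finite[OF subalg])
    have "AE w in M. real_cond_exp M (F n) (\<lambda>w. Y (Suc n) w - m n w) w
        = real_cond_exp M (F n) (Y (Suc n)) w - real_cond_exp M (F n) (m n) w"
      by (rule real_cond_exp_diff[OF intY intm])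
    moreover have "AE w in M. real_cond_exp M (F n) (m n) w = m n w"
      by (rule real_cond_exp_F_meas[OF intm m(1)])
    ultimately show "AE w in M. real_cond_exp M (F n) (\<xi> (Suc n)) w = 0"
      using m(3)[of n] unfolding \<xi>_eq by eventually_elim simp
  qed (use subalg filt int\<xi> in auto)
  have "summable (\<lambda>k. (\<integral>w. (\<xi> (Suc k) w)\<^sup>2 \<partial>M) / (real (Suc k))\<^sup>2)"
    by (rule summable_comparison_test'[OF summ]) (auto intro!: divide_right_mono mom)
  from strong_law[OF this] show ?thesis by (simp add: \<xi>_def)
qed

section \<open>Uniformly summable tails\<close>

lemma max_row_sum_row_le:
  fixes A :: "real^'k^'k" shows "(\<Sum>j\<in>UNIV. \<bar>A $ i $ j\<bar>) \<le> max_row_sum A"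
  unfolding max_row_sum_def by (rule Max_ge) auto

lemma max_row_sum_entry_le:
  fixes A :: "real^'k^'k" shows "\<bar>A $ i $ j\<bar> \<le> max_row_sum A"
proof -
  have "\<bar>A $ i $ j\<bar> \<le> (\<Sum>j\<in>UNIV. \<bar>A $ i $ j\<bar>)" by (rule member_le_sum) auto
  thus ?thesis using max_row_sum_row_le[of A i] by linarith
qed

lemma max_row_sum_nonneg: "0 \<le> max_row_sum (A :: real^'k^'k)"
  using max_row_sum_entry_le[of A] abs_ge_zero order_trans by blast

lemma measurable_max_row_sum:
  fixes f :: "'w \<Rightarrow> real^'k^'k"
  assumes "f \<in> borel_measurable M" shows "(\<lambda>w. max_row_sum (f w)) \<in> borel_measurable M"
  unfolding max_row_sum_def
  by (intro borel_measurable_Max borel_measurable_sum borel_measurable_abs measurable_vec_nth assms finite)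

text \<open>Layer cake formulas over the integers: moments and excesses of a random variable become sums
  of its tail probabilities at integers.\<close>

lemma sum_exceeded_integers_le:
  fixes y :: real
  shows "(\<Sum>k<n. if real (Suc k) < y then 1 else 0) \<le> min (real n) (max 0 y)"
  by (induction n) auto

lemma min_le_sum_exceeded_integers:
  fixes x :: real
  shows "min (max 0 (x - real m)) (real n) \<le> (\<Sum>l<n. if real (l + m) < x then 1 else 0)"
  by (induction n) auto

lemma square_le_sum_exceeded_integers:
  fixes x :: real
  assumes "0 \<le> x" "x \<le> real n"
  shows "x\<^sup>2 \<le> (\<Sum>m<n. real (2 * m + 1) * (if real m < x then 1 else 0))"
  using assms(2)
proof (induction n)
  case 0 thus ?case using assms(1) by simp
next
  case (Suc n)
  show ?case
  proof (cases "x \<le> real n")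
    case True
    thus ?thesis using Suc.IH by simp
  next
    case False
    have odd: "(\<Sum>m<k. real (2 * m + 1)) = (real k)\<^sup>2" for k
      by (induction k) (simp_all add: power2_eq_square algebra_simps)
    have "x\<^sup>2 \<le> (real (Suc n))\<^sup>2" using Suc.prems assms(1) by (intro power_mono) auto
    also have "\<dots> = (\<Sum>m<Suc n. real (2 * m + 1) * (if real m < x then 1 else 0))"
      unfolding odd[symmetric]
    proof (rule sum.cong)
      fix m assume "m \<in> {..<Suc n}"
      hence "real m \<le> real n" by simp
      hence "real m < x" using False by linarith
      thus "real (2 * m + 1) = real (2 * m + 1) * (if real m < x then 1 else 0)" by simp
    qed simp
    finally show ?thesis .
  qed
qed

text \<open>The first moment condition bounds the tail at \<open>k\<close> by that of an integrable variable, and under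
  the second one Markov's inequality bounds it by a multiple of \<open>1 / (k \<phi>(k))\<close>. Both enter the
  theorem only through the uniform tail bound obtained here.\<close>

lemma (in prob_space) uniformly_summable_tail:
  fixes R :: "nat \<Rightarrow> 'a \<Rightarrow> real^'k^'k"
  assumes meas: "\<And>n. 1 \<le> n \<Longrightarrow> R n \<in> borel_measurable M"
    and moments: "tail_dominated M R \<or> phi_moment_bounded M R"
  obtains q where "summable q" "\<And>k. 0 \<le> q k"
    "\<And>n k. 1 \<le> n \<Longrightarrow> prob {w \<in> space M. real k < max_row_sum (R n w)} \<le> q k"
proof (cases "tail_dominated M R")
  case True
  then obtain c and N :: "real measure" and Y :: "real \<Rightarrow> real" where c: "0 < c" and N: "prob_space N"
    and Y: "integrable N Y" and dom: "\<And>x n. 0 < x \<Longrightarrow> 1 \<le> n \<Longrightarrow>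
      measure M {w \<in> space M. max_row_sum (R n w) > x} \<le> c * measure N {y \<in> space N. Y y > x}"
    unfolding tail_dominated_def by blast
  interpret N: prob_space N by (rule N)
  have [measurable]: "Y \<in> borel_measurable N" using Y by simp
  define r where "r k = N.prob {y \<in> space N. real (Suc k) < Y y}" for k
  have "summable r"
  proof (rule summableI_nonneg_bounded)
    fix n :: nat
    have "(\<Sum>k<n. r k) = (\<Sum>k<n. \<integral>y. indicat_real {y \<in> space N. real (Suc k) < Y y} y \<partial>N)"
      by (simp add: r_def)
    also have "\<dots> = (\<integral>y. (\<Sum>k<n. indicat_real {y \<in> space N. real (Suc k) < Y y} y) \<partial>N)"
      by (subst Bochner_Integration.integral_sum) (auto intro!: integrable_real_indicator simp: N.emeasure_eq_measure)
    also have "\<dots> \<le> (\<integral>y. \<bar>Y y\<bar> \<partial>N)"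
    proof (rule integral_mono)
      show "integrable N (\<lambda>y. \<Sum>k<n. indicat_real {y \<in> space N. real (Suc k) < Y y} y)"
        by (intro Bochner_Integration.integrable_sum integrable_real_indicator) (auto simp: N.emeasure_eq_measure)
      fix y assume "y \<in> space N"
      hence "(\<Sum>k<n. indicat_real {y \<in> space N. real (Suc k) < Y y} y)
          = (\<Sum>k<n. if real (Suc k) < Y y then 1 else 0)"
        by (intro sum.cong) (auto simp: indicator_def)
      thus "(\<Sum>k<n. indicat_real {y \<in> space N. real (Suc k) < Y y} y) \<le> \<bar>Y y\<bar>"
        using sum_exceeded_integers_le[of "Y y" n] by linarith
    qed (use Y in simp)
    finally show "(\<Sum>k<n. r k) \<le> (\<integral>y. \<bar>Y y\<bar> \<partial>N)" .
  qed (simp add: r_def)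
  \<comment> \<open>The domination holds only at positive levels, so the level 0 gets the trivial bound.\<close>
  define q where "q k = (case k of 0 \<Rightarrow> 1 | Suc k \<Rightarrow> c * r k)" for k
  show ?thesis
  proof (rule that)
    have "summable (\<lambda>k. q (Suc k))" using \<open>summable r\<close> by (simp add: q_def summable_mult)
    thus "summable q" by (simp add: summable_Suc_iff)
    show "0 \<le> q k" for k using c by (cases k) (auto simp: q_def r_def)
    show "prob {w \<in> space M. real k < max_row_sum (R n w)} \<le> q k" if "1 \<le> n" for n k
      using dom[of "real k" n] that by (cases k) (auto simp: q_def r_def)
  qed
next
  case False
  hence "phi_moment_bounded M R" using moments by simp
  then obtain \<phi> :: "real \<Rightarrow> real" and a where \<phi>0: "\<And>x. 0 \<le> x \<Longrightarrow> 0 \<le> \<phi> x"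
    and \<phi>pos: "\<And>x. a \<le> x \<Longrightarrow> 0 < \<phi> x" and mono: "mono_on {a..} \<phi>"
    and summ: "summable (\<lambda>n. 1 / (real n * \<phi> (real n)))"
    and bdd: "(SUP n\<in>{1..}. \<integral>\<^sup>+w. ennreal (max_row_sum (R n w) * \<phi> (max_row_sum (R n w))) \<partial>M) < \<infinity>"
    unfolding phi_moment_bounded_def by blast
  define B where "B = (SUP n\<in>{1..}. \<integral>\<^sup>+w. ennreal (max_row_sum (R n w) * \<phi> (max_row_sum (R n w))) \<partial>M)"
  define K where "K = enn2real B"
  have BK: "B = ennreal K" using bdd by (simp add: B_def K_def)
  obtain k0 :: nat where k0: "max a 1 \<le> real k0" using real_arch_simple by blast
  define q where "q k = (if k < k0 then 1 else K * (1 / (real k * \<phi> (real k))))" for k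
  have tail: "prob {w \<in> space M. real k < max_row_sum (R n w)} \<le> K * (1 / (real k * \<phi> (real k)))"
    if n: "1 \<le> n" and k: "k0 \<le> k" for n k
  proof -
    have k1: "a \<le> real k" "1 \<le> real k" using k k0 by linarith+
    have pos: "0 < real k * \<phi> (real k)" using k1 \<phi>pos by simp
    define E where "E = {w \<in> space M. real k < max_row_sum (R n w)}"
    have [measurable]: "(\<lambda>w. max_row_sum (R n w)) \<in> borel_measurable M"
      using meas[OF n] by (rule measurable_max_row_sum)
    have E[measurable]: "E \<in> sets M" unfolding E_def by measurable
    have "ennreal (real k * \<phi> (real k)) * emeasure M E
        = (\<integral>\<^sup>+w. ennreal (real k * \<phi> (real k)) * indicator E w \<partial>M)"
      by (rule nn_integral_cmult_indicator[OF E, symmetric])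
    also have "\<dots> \<le> (\<integral>\<^sup>+w. ennreal (max_row_sum (R n w) * \<phi> (max_row_sum (R n w))) \<partial>M)"
    proof (rule nn_integral_mono)
      fix w
      show "ennreal (real k * \<phi> (real k)) * indicator E w
          \<le> ennreal (max_row_sum (R n w) * \<phi> (max_row_sum (R n w)))"
      proof (cases "w \<in> E")
        case True
        hence less: "real k < max_row_sum (R n w)" by (simp add: E_def)
        hence "\<phi> (real k) \<le> \<phi> (max_row_sum (R n w))"
          using k1 by (intro mono_onD[OF mono]) auto
        hence "real k * \<phi> (real k) \<le> max_row_sum (R n w) * \<phi> (max_row_sum (R n w))"
          using less k1 \<phi>pos[OF k1(1)] by (intro mult_mono) auto
        thus ?thesis using True by (simp add: ennreal_leI)
      qed simp
    qed
    also have "\<dots> \<le> B" unfolding B_def using n by (intro SUP_upper) auto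
    finally have "ennreal (real k * \<phi> (real k) * prob E) \<le> ennreal K"
      unfolding BK emeasure_eq_measure using pos by (simp add: ennreal_mult)
    moreover have "0 \<le> K" by (simp add: K_def)
    ultimately have "real k * \<phi> (real k) * prob E \<le> K" by (simp only: ennreal_le_iff)
    thus ?thesis using pos by (simp add: E_def[symmetric] field_simps)
  qed
  show ?thesis
  proof (rule that)
    have "summable (\<lambda>k. K * (1 / (real k * \<phi> (real k))))" by (rule summable_mult[OF summ])
    moreover have "eventually (\<lambda>k. q k = K * (1 / (real k * \<phi> (real k)))) sequentially"
      using eventually_ge_at_top[of k0] by eventually_elim (auto simp: q_def)
    ultimately show "summable q" by (simp only: summable_cong)
    show "0 \<le> q k" for k
      using \<phi>0[of "real k"] by (auto simp: q_def K_def)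
    show "prob {w \<in> space M. real k < max_row_sum (R n w)} \<le> q k" if "1 \<le> n" for n k
      using tail[OF that, of k] by (auto simp: q_def)
  qed
qed

lemma (in prob_space) truncated_second_moment_le:
  fixes X :: "'a \<Rightarrow> real"
  assumes [measurable]: "X \<in> borel_measurable M" and X0: "\<And>w. 0 \<le> X w"
    and tail: "\<And>k. prob {w \<in> space M. real k < X w} \<le> q k"
  shows "(\<integral>w. (X w)\<^sup>2 * indicat_real {w. X w \<le> real n} w \<partial>M) \<le> (\<Sum>m<n. real (2 * m + 1) * q m)"
proof -
  have ind: "integrable M (indicat_real {w \<in> space M. real m < X w})" for m
    by (intro integrable_real_indicator) (auto simp: emeasure_eq_measure)
  have "(\<integral>w. (X w)\<^sup>2 * indicat_real {w. X w \<le> real n} w \<partial>M)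
      \<le> (\<integral>w. (\<Sum>m<n. real (2 * m + 1) * indicat_real {w \<in> space M. real m < X w} w) \<partial>M)"
  proof (rule integral_mono_AE')
    show "integrable M (\<lambda>w. \<Sum>m<n. real (2 * m + 1) * indicat_real {w \<in> space M. real m < X w} w)"
      by (intro Bochner_Integration.integrable_sum integrable_mult_right ind)
    have "(X w)\<^sup>2 * indicat_real {w. X w \<le> real n} w
        \<le> (\<Sum>m<n. real (2 * m + 1) * indicat_real {w \<in> space M. real m < X w} w)" if w: "w \<in> space M" for w
    proof (cases "X w \<le> real n")
      case True
      have "(\<Sum>m<n. real (2 * m + 1) * (if real m < X w then 1 else 0))
          = (\<Sum>m<n. real (2 * m + 1) * indicat_real {w \<in> space M. real m < X w} w)"
        using w by (intro sum.cong) (auto simp: indicator_def)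
      thus ?thesis using square_le_sum_exceeded_integers[OF X0 True] True by simp
    qed (simp add: sum_nonneg)
    thus "AE w in M. (X w)\<^sup>2 * indicat_real {w. X w \<le> real n} w
        \<le> (\<Sum>m<n. real (2 * m + 1) * indicat_real {w \<in> space M. real m < X w} w)" by (rule AE_I2)
  qed (auto simp: sum_nonneg)
  also have "\<dots> = (\<Sum>m<n. real (2 * m + 1) * prob {w \<in> space M. real m < X w})"
    by (subst Bochner_Integration.integral_sum) (auto intro!: integrable_mult_right ind)
  also have "\<dots> \<le> (\<Sum>m<n. real (2 * m + 1) * q m)"
    by (intro sum_mono mult_left_mono tail) auto
  finally show ?thesis .
qed

lemma sum_inverse_squares_le:
  assumes "m < n" shows "(\<Sum>k=m..<n. 1 / (real (Suc k))\<^sup>2) \<le> 2 / real (Suc m) - 1 / real n"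
  using assms
proof (induction n)
  case (Suc n)
  show ?case
  proof (cases "n = m")
    case True
    have "1 / (real (Suc m))\<^sup>2 \<le> 1 / real (Suc m)" 
      by (intro divide_left_mono) (auto simp: power2_eq_square)
    thus ?thesis using True by simp
  next
    case False
    hence n: "m < n" "0 < real n" using Suc.prems by auto
    have "1 / (real (Suc n))\<^sup>2 \<le> 1 / (real n * real (Suc n))"
      using n by (intro divide_left_mono) (auto simp: power2_eq_square)
    also have "\<dots> = 1 / real n - 1 / real (Suc n)" using n by (simp add: field_simps)
    finally show ?thesis using Suc.IH n by simp
  qed
qed simp

text \<open>Exchanging the sums, \<open>q m\<close> gets the weight \<open>(2m + 1) \<Sum>\<^sub>k\<^sub>\<ge>\<^sub>m 1/(k + 1)\<^sup>2\<close>, which is bounded.\<close>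

lemma summable_truncated_second_moments:
  assumes q: "summable q" "\<And>k. 0 \<le> q k"
  shows "summable (\<lambda>k. (\<Sum>m<Suc k. real (2 * m + 1) * q m) / (real (Suc k))\<^sup>2)"
proof (rule summableI_nonneg_bounded)
  fix n :: nat
  have "(\<Sum>k<n. (\<Sum>m<Suc k. real (2 * m + 1) * q m) / (real (Suc k))\<^sup>2)
      = (\<Sum>k<n. \<Sum>m<n. if m \<le> k then real (2 * m + 1) * q m * (1 / (real (Suc k))\<^sup>2) else 0)"
  proof (rule sum.cong)
    fix k assume k: "k \<in> {..<n}"
    have "{..<n} \<inter> {m. m \<le> k} = {..<Suc k}" using k by auto
    thus "(\<Sum>m<Suc k. real (2 * m + 1) * q m) / (real (Suc k))\<^sup>2
        = (\<Sum>m<n. if m \<le> k then real (2 * m + 1) * q m * (1 / (real (Suc k))\<^sup>2) else 0)"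
      by (simp only: sum.If_cases[OF finite_lessThan] sum_divide_distrib) simp
  qed simp
  also have "\<dots> = (\<Sum>m<n. \<Sum>k<n. if m \<le> k then real (2 * m + 1) * q m * (1 / (real (Suc k))\<^sup>2) else 0)"
    by (rule sum.swap)
  also have "\<dots> = (\<Sum>m<n. real (2 * m + 1) * q m * (\<Sum>k=m..<n. 1 / (real (Suc k))\<^sup>2))"
  proof (rule sum.cong)
    fix m assume "m \<in> {..<n}"
    have "{..<n} \<inter> {k. m \<le> k} = {m..<n}" by auto
    thus "(\<Sum>k<n. if m \<le> k then real (2 * m + 1) * q m * (1 / (real (Suc k))\<^sup>2) else 0)
        = real (2 * m + 1) * q m * (\<Sum>k=m..<n. 1 / (real (Suc k))\<^sup>2)"
      by (simp only: sum.If_cases[OF finite_lessThan] sum_distrib_left) simp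
  qed simp
  also have "\<dots> \<le> (\<Sum>m<n. 4 * q m)"
  proof (rule sum_mono)
    fix m assume "m \<in> {..<n}"
    hence "(\<Sum>k=m..<n. 1 / (real (Suc k))\<^sup>2) \<le> 2 / real (Suc m)"
      using sum_inverse_squares_le[of m n] by (simp add: order_trans)
    hence "real (2 * m + 1) * q m * (\<Sum>k=m..<n. 1 / (real (Suc k))\<^sup>2)
        \<le> real (2 * m + 1) * q m * (2 / real (Suc m))"
      using q by (intro mult_left_mono) auto
    also have "\<dots> \<le> 4 * q m"
    proof -
      have "real (2 * m + 1) * (2 / real (Suc m)) \<le> 4" by (simp add: field_simps)
      from mult_right_mono[OF this q(2)[of m]] show ?thesis by (simp add: mult_ac)
    qed
    finally show "real (2 * m + 1) * q m * (\<Sum>k=m..<n. 1 / (real (Suc k))\<^sup>2) \<le> 4 * q m" .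
  qed
  also have "\<dots> = 4 * (\<Sum>m<n. q m)" by (simp add: sum_distrib_left)
  also have "\<dots> \<le> 4 * suminf q" using q by (intro mult_left_mono sum_le_suminf) auto
  finally show "(\<Sum>k<n. (\<Sum>m<Suc k. real (2 * m + 1) * q m) / (real (Suc k))\<^sup>2) \<le> 4 * suminf q" .
next
  show "0 \<le> (\<Sum>m<Suc k. real (2 * m + 1) * q m) / (real (Suc k))\<^sup>2" for k
    by (intro divide_nonneg_nonneg sum_nonneg mult_nonneg_nonneg q) auto
qed

lemma (in prob_space) expected_excess_le:
  fixes X :: "'a \<Rightarrow> real"
  assumes [measurable]: "X \<in> borel_measurable M"
    and tail: "\<And>k. prob {w \<in> space M. real k < X w} \<le> q k"
    and q: "summable q" "\<And>k. 0 \<le> q k"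
  shows "(\<integral>w. max 0 (X w - real m) \<partial>M) \<le> (\<Sum>l. q (l + m))"
proof -
  have qs: "summable (\<lambda>l. q (l + m))" using q(1) by (simp add: summable_iff_shift)
  have "(\<integral>\<^sup>+w. ennreal (max 0 (X w - real m)) \<partial>M)
      \<le> (\<integral>\<^sup>+w. (\<Sum>l. indicator {w \<in> space M. real (l + m) < X w} w) \<partial>M)"
  proof (rule nn_integral_mono)
    fix w assume w: "w \<in> space M"
    obtain n :: nat where n: "max 0 (X w - real m) \<le> real n" using real_arch_simple by blast
    have "max 0 (X w - real m) \<le> (\<Sum>l<n. if real (l + m) < X w then 1 else 0)"
      using min_le_sum_exceeded_integers[of "X w" m n] n by simp
    hence "ennreal (max 0 (X w - real m)) \<le> ennreal (\<Sum>l<n. if real (l + m) < X w then 1 else 0)"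
      by (rule ennreal_leI)
    also have "\<dots> = (\<Sum>l<n. ennreal (if real (l + m) < X w then 1 else 0))"
      by (rule sum_ennreal[symmetric]) simp
    also have "\<dots> = (\<Sum>l<n. indicator {w \<in> space M. real (l + m) < X w} w)"
      using w by (intro sum.cong) (auto simp: indicator_def)
    also have "\<dots> \<le> (\<Sum>l. indicator {w \<in> space M. real (l + m) < X w} w)"
      by (rule sum_le_suminf) auto
    finally show "ennreal (max 0 (X w - real m)) \<le> (\<Sum>l. indicator {w \<in> space M. real (l + m) < X w} w)" .
  qed
  also have "\<dots> = (\<Sum>l. \<integral>\<^sup>+w. indicator {w \<in> space M. real (l + m) < X w} w \<partial>M)"
    by (rule nn_integral_suminf) measurable
  also have "\<dots> = (\<Sum>l. emeasure M {w \<in> space M. real (l + m) < X w})"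
    by (intro suminf_cong nn_integral_indicator) measurable
  also have "\<dots> \<le> (\<Sum>l. ennreal (q (l + m)))"
    by (intro suminf_le) (auto simp: emeasure_eq_measure intro!: ennreal_leI tail simp del: of_nat_add)
  also have "\<dots> = ennreal (\<Sum>l. q (l + m))" by (rule suminf_ennreal2[OF _ qs]) (rule q)
  finally have "(\<integral>\<^sup>+w. ennreal (max 0 (X w - real m)) \<partial>M) \<le> ennreal (\<Sum>l. q (l + m))" .
  moreover have "0 \<le> (\<Sum>l. q (l + m))" by (rule suminf_nonneg[OF qs]) (rule q)
  ultimately show ?thesis
    by (subst integral_eq_nn_integral) (auto simp: enn2real_leI)
qed

section \<open>Convergence in mean\<close>

lemma (in prob_space) tendsto_L1_bounded:
  fixes X :: "nat \<Rightarrow> 'a \<Rightarrow> 'b::{banach, second_countable_topology}"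
  assumes [measurable]: "\<And>n. X n \<in> borel_measurable M" "L \<in> borel_measurable M"
    and bound: "\<And>n. AE w in M. norm (X n w) \<le> B"
    and lim: "AE w in M. (\<lambda>n. X n w) \<longlonglongrightarrow> L w"
  shows "tendsto_L1 M X L"
proof -
  have int: "integrable M (X n)" for n
    by (rule integrable_const_bound[of _ B]) (auto intro: bound)
  have L: "AE w in M. norm (L w) \<le> B"
  proof -
    have "AE w in M. \<forall>n. norm (X n w) \<le> B" using bound by (simp add: AE_all_countable)
    thus ?thesis using lim
    proof eventually_elim
      case (elim w)
      show ?case by (rule LIMSEQ_le_const2[OF tendsto_norm[OF elim(2)]]) (use elim(1) in auto)
    qed
  qed
  have intL: "integrable M L" by (rule integrable_const_bound[of _ B]) (auto intro: L)
  have "(\<lambda>n. \<integral>w. norm (X n w - L w) \<partial>M) \<longlonglongrightarrow> (\<integral>w. 0 \<partial>M)"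
  proof (rule integral_dominated_convergence[where w = "\<lambda>_. 2 * B"])
    show "AE w in M. (\<lambda>n. norm (X n w - L w)) \<longlonglongrightarrow> 0"
      using lim by eventually_elim (simp add: LIM_zero tendsto_norm_zero)
    show "AE w in M. norm (norm (X n w - L w)) \<le> 2 * B" for n
      using bound[of n] L by eventually_elim (simp add: norm_triangle_le_diff order_trans[OF norm_triangle_ineq4])
  qed auto
  thus ?thesis using int intL by (simp add: tendsto_L1_def)
qed

lemma (in prob_space) integrable_limit_of_bounded_means:
  fixes f :: "nat \<Rightarrow> 'a \<Rightarrow> real"
  assumes f: "\<And>n. integrable M (f n)" "\<And>n. AE w in M. 0 \<le> f n w"
    and g[measurable]: "g \<in> borel_measurable M"
    and lim: "AE w in M. (\<lambda>n. f n w) \<longlonglongrightarrow> g w"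
    and c: "eventually (\<lambda>n. (\<integral>w. f n w \<partial>M) \<le> c) sequentially"
  shows "integrable M g" "(\<integral>w. g w \<partial>M) \<le> c" "AE w in M. 0 \<le> g w"
proof -
  have [measurable]: "f n \<in> borel_measurable M" for n using f(1) by simp
  have "AE w in M. \<forall>n. 0 \<le> f n w" using f(2) by (simp add: AE_all_countable)
  thus g0: "AE w in M. 0 \<le> g w"
    using lim by eventually_elim (auto intro: LIMSEQ_le_const)
  obtain n0 where n0: "\<And>n. n \<ge> n0 \<Longrightarrow> (\<integral>w. f n w \<partial>M) \<le> c"
    using c by (auto simp: eventually_sequentially)
  have "0 \<le> (\<integral>w. f n0 w \<partial>M)" by (rule integral_nonneg_AE[OF f(2)])
  hence c0: "0 \<le> c" using n0[of n0] by simp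
  have "(\<integral>\<^sup>+w. ennreal (g w) \<partial>M) = (\<integral>\<^sup>+w. liminf (\<lambda>n. ennreal (f n w)) \<partial>M)"
  proof (rule nn_integral_cong_AE)
    show "AE w in M. ennreal (g w) = liminf (\<lambda>n. ennreal (f n w))"
      using lim
    proof eventually_elim
      case (elim w)
      have "(\<lambda>n. ennreal (f n w)) \<longlonglongrightarrow> ennreal (g w)" by (rule tendsto_ennrealI[OF elim])
      thus ?case by (simp add: lim_imp_Liminf)
    qed
  qed
  also have "\<dots> \<le> liminf (\<lambda>n. \<integral>\<^sup>+w. ennreal (f n w) \<partial>M)" by (rule nn_integral_liminf) simp
  also have "\<dots> \<le> ennreal c"
  proof (rule Liminf_le)
    show "eventually (\<lambda>n. (\<integral>\<^sup>+w. ennreal (f n w) \<partial>M) \<le> ennreal c) sequentially"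
      using c by eventually_elim (simp add: nn_integral_eq_integral[OF f] ennreal_leI)
  qed simp
  finally have le: "(\<integral>\<^sup>+w. ennreal (g w) \<partial>M) \<le> ennreal c" .
  hence "(\<integral>\<^sup>+w. ennreal (g w) \<partial>M) < \<infinity>" by (rule le_less_trans) simp
  thus "integrable M g" using g0 by (intro integrableI_nonneg) auto
  show "(\<integral>w. g w \<partial>M) \<le> c"
    using g0 le c0 by (subst integral_eq_nn_integral) (auto simp: enn2real_leI)
qed

text \<open>Uniform integrability in the form of small mean excesses: truncated at a high level the variables
  converge by dominated convergence, and the excesses over that level are small in mean, for
  the limit by Fatou's lemma.\<close>

lemma (in prob_space) tendsto_L1_small_excess:
  fixes Z :: "nat \<Rightarrow> 'a \<Rightarrow> real"
  assumes Z: "\<And>n. integrable M (Z n)" "\<And>n. AE w in M. 0 \<le> Z n w"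
    and L[measurable]: "L \<in> borel_measurable M"
    and lim: "AE w in M. (\<lambda>n. Z n w) \<longlonglongrightarrow> L w"
    and excess: "\<And>e. 0 < e \<Longrightarrow> \<exists>m::nat. eventually (\<lambda>n. (\<integral>w. max 0 (Z n w - real m) \<partial>M) \<le> e) sequentially"
  shows "tendsto_L1 M Z L"
proof -
  have [measurable]: "Z n \<in> borel_measurable M" for n using Z(1) by simp
  have intE: "integrable M (\<lambda>w. max 0 (Z n w - real m))" for n m
    by (intro integrable_max Bochner_Integration.integrable_diff Z) auto
  obtain m1 :: nat where m1: "eventually (\<lambda>n. (\<integral>w. max 0 (Z n w - real m1) \<partial>M) \<le> 1) sequentially"
    using excess[of 1] by auto
  have "eventually (\<lambda>n. (\<integral>w. Z n w \<partial>M) \<le> real m1 + 1) sequentially"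
    using m1
  proof eventually_elim
    case (elim n)
    have "(\<integral>w. Z n w \<partial>M) \<le> (\<integral>w. real m1 + max 0 (Z n w - real m1) \<partial>M)"
      by (intro integral_mono Z Bochner_Integration.integrable_add intE) auto
    also have "\<dots> = real m1 + (\<integral>w. max 0 (Z n w - real m1) \<partial>M)"
      using intE by (simp add: prob_space)
    finally show ?case using elim by simp
  qed
  note Lint = integrable_limit_of_bounded_means[OF Z L lim this]
  have "(\<lambda>n. \<integral>w. norm (Z n w - L w) \<partial>M) \<longlonglongrightarrow> 0"
  proof (rule LIMSEQ_I)
    fix r :: real assume r: "0 < r"
    obtain m :: nat where m: "eventually (\<lambda>n. (\<integral>w. max 0 (Z n w - real m) \<partial>M) \<le> r / 4) sequentially"
      using excess[of "r / 4"] r by auto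
    have limE: "AE w in M. (\<lambda>n. max 0 (Z n w - real m)) \<longlonglongrightarrow> max 0 (L w - real m)"
      using lim by eventually_elim (intro tendsto_intros)
    have LE: "integrable M (\<lambda>w. max 0 (L w - real m))" "(\<integral>w. max 0 (L w - real m) \<partial>M) \<le> r / 4"
      by (rule integrable_limit_of_bounded_means[OF intE _ _ limE m]; simp)+
    define D where "D n w = \<bar>min (Z n w) (real m) - min (L w) (real m)\<bar>" for n w
    have intD: "integrable M (D n)" for n
      unfolding D_def by (intro integrable_abs Bochner_Integration.integrable_diff integrable_min Z Lint) auto
    have "(\<lambda>n. \<integral>w. D n w \<partial>M) \<longlonglongrightarrow> (\<integral>w. 0 \<partial>M)"
    proof (rule integral_dominated_convergence[where w = "\<lambda>_. real m"])
      show "AE w in M. (\<lambda>n. D n w) \<longlonglongrightarrow> 0"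
        using lim
      proof eventually_elim
        case (elim w)
        have "(\<lambda>n. D n w) \<longlonglongrightarrow> \<bar>min (L w) (real m) - min (L w) (real m)\<bar>"
          unfolding D_def by (intro tendsto_intros elim)
        thus ?case by simp
      qed
      show "AE w in M. norm (D n w) \<le> real m" for n
        using Z(2)[of n] Lint(3) by eventually_elim (auto simp: D_def)
    qed (auto simp: D_def[abs_def])
    hence "eventually (\<lambda>n. (\<integral>w. D n w \<partial>M) < r / 4) sequentially"
      using r by (intro order_tendstoD(2)) auto
    hence "eventually (\<lambda>n. norm ((\<integral>w. norm (Z n w - L w) \<partial>M) - 0) < r) sequentially"
      using m
    proof eventually_elim
      case (elim n)
      have "(\<integral>w. norm (Z n w - L w) \<partial>M)
          \<le> (\<integral>w. D n w + (max 0 (Z n w - real m) + max 0 (L w - real m)) \<partial>M)"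
        by (intro integral_mono integrable_norm Bochner_Integration.integrable_diff
            Bochner_Integration.integrable_add Z Lint intD intE LE) (auto simp: D_def)
      also have "\<dots> = (\<integral>w. D n w \<partial>M) + ((\<integral>w. max 0 (Z n w - real m) \<partial>M) + (\<integral>w. max 0 (L w - real m) \<partial>M))"
        using intD intE LE by simp
      finally have "(\<integral>w. norm (Z n w - L w) \<partial>M) < r" using elim LE r by linarith
      moreover have "0 \<le> (\<integral>w. norm (Z n w - L w) \<partial>M)" by simp
      ultimately show ?case by simp
    qed
    thus "\<exists>no. \<forall>n\<ge>no. norm ((\<integral>w. norm (Z n w - L w) \<partial>M) - 0) < r"
      by (simp add: eventually_sequentially)
  qed
  thus ?thesis using Z Lint by (simp add: tendsto_L1_def)
qed

lemma tendsto_L1_componentwise: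
  fixes X :: "nat \<Rightarrow> 'w \<Rightarrow> real^'k"
  assumes X: "\<And>i. tendsto_L1 M (\<lambda>n w. X n w $ i) (\<lambda>w. L w $ i)"
  shows "tendsto_L1 M X L"
proof -
  have vec: "integrable M f" if f: "\<And>i. integrable M (\<lambda>w. f w $ i)" for f :: "'w \<Rightarrow> real^'k"
  proof (rule Bochner_Integration.integrable_bound)
    show "integrable M (\<lambda>w. \<Sum>i\<in>UNIV. \<bar>f w $ i\<bar>)"
      by (intro Bochner_Integration.integrable_sum integrable_abs f)
    have "(\<lambda>w. \<chi> i. f w $ i) \<in> borel_measurable M"
      by (intro measurable_vec_lambda borel_measurable_integrable f)
    thus "f \<in> borel_measurable M" by simp
    have "norm (f w) \<le> norm (\<Sum>i\<in>UNIV. \<bar>f w $ i\<bar>)" for w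
      using norm_le_l1_cart[of "f w"] by simp
    thus "AE w in M. norm (f w) \<le> norm (\<Sum>i\<in>UNIV. \<bar>f w $ i\<bar>)" by blast
  qed
  have int: "integrable M (X n)" "integrable M L" for n
    using X by (auto intro!: vec simp: tendsto_L1_def)
  have comp: "integrable M (\<lambda>w. \<bar>X n w $ i - L w $ i\<bar>)" for n i
    using X[of i] by (simp add: tendsto_L1_def)
  have "(\<lambda>n. \<Sum>i\<in>UNIV. \<integral>w. \<bar>X n w $ i - L w $ i\<bar> \<partial>M) \<longlonglongrightarrow> (\<Sum>i\<in>(UNIV :: 'k set). 0::real)"
    using X by (intro tendsto_sum) (auto simp: tendsto_L1_def)
  hence lim: "(\<lambda>n. \<Sum>i\<in>UNIV. \<integral>w. \<bar>X n w $ i - L w $ i\<bar> \<partial>M) \<longlonglongrightarrow> 0" by simp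
  have le: "(\<integral>w. norm (X n w - L w) \<partial>M) \<le> (\<Sum>i\<in>UNIV. \<integral>w. \<bar>X n w $ i - L w $ i\<bar> \<partial>M)" for n
  proof -
    have "(\<integral>w. norm (X n w - L w) \<partial>M) \<le> (\<integral>w. (\<Sum>i\<in>UNIV. \<bar>X n w $ i - L w $ i\<bar>) \<partial>M)"
    proof (rule integral_mono)
      show "norm (X n w - L w) \<le> (\<Sum>i\<in>UNIV. \<bar>X n w $ i - L w $ i\<bar>)" for w
        using norm_le_l1_cart[of "X n w - L w"] by simp
    qed (use int comp in \<open>auto intro!: Bochner_Integration.integrable_sum\<close>)
    also have "\<dots> = (\<Sum>i\<in>UNIV. \<integral>w. \<bar>X n w $ i - L w $ i\<bar> \<partial>M)"
      by (rule Bochner_Integration.integral_sum) (rule comp)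
    finally show ?thesis .
  qed
  have "(\<lambda>n. \<integral>w. norm (X n w - L w) \<partial>M) \<longlonglongrightarrow> 0"
    by (rule Lim_null_comparison[OF _ lim]) (use le in \<open>auto intro!: always_eventually\<close>)
  thus ?thesis using int by (simp add: tendsto_L1_def)
qed

section \<open>Conditional means in the urn model\<close>

text \<open>The hypothesis says that \<open>X\<close> has the same law under the two measures with densities \<open>f\<close> and
  \<open>h\<close>.\<close>

lemma (in prob_space) integral_weighted_cong:
  fixes f h :: "'a \<Rightarrow> real" and X :: "'a \<Rightarrow> 'b::topological_space"
  assumes f: "integrable M f" "AE w in M. 0 \<le> f w" and h: "integrable M h" "AE w in M. 0 \<le> h w"
    and X[measurable]: "X \<in> borel_measurable M"
    and eq: "\<And>B. B \<in> sets borel \<Longrightarrow>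
      (\<integral>w. f w * indicat_real B (X w) \<partial>M) = (\<integral>w. h w * indicat_real B (X w) \<partial>M)"
    and g[measurable]: "g \<in> borel_measurable borel"
  shows "(\<integral>w. f w * g (X w) \<partial>M) = (\<integral>w. h w * g (X w) \<partial>M)"
proof -
  have [measurable]: "f \<in> borel_measurable M" "h \<in> borel_measurable M" using f h by auto
  define law where "law v = distr (density M (\<lambda>w. ennreal (v w))) borel X" for v :: "'a \<Rightarrow> real"
  have em: "emeasure (law v) B = ennreal (\<integral>w. v w * indicat_real B (X w) \<partial>M)"
    if v: "integrable M v" "AE w in M. 0 \<le> v w" and B[measurable]: "B \<in> sets borel" for v B
  proof -
    have [measurable]: "v \<in> borel_measurable M" using v by simp
    have "emeasure (law v) B = (\<integral>\<^sup>+w. ennreal (v w) * indicator (X -` B \<inter> space M) w \<partial>M)"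
      unfolding law_def by (subst emeasure_distr) (auto simp: emeasure_density)
    also have "\<dots> = (\<integral>\<^sup>+w. ennreal (v w * indicat_real B (X w)) \<partial>M)"
      by (rule nn_integral_cong) (auto simp: indicator_def)
    also have "\<dots> = ennreal (\<integral>w. v w * indicat_real B (X w) \<partial>M)"
    proof (rule nn_integral_eq_integral)
      show "integrable M (\<lambda>w. v w * indicat_real B (X w))"
        by (rule Bochner_Integration.integrable_bound[OF v(1)]) (auto simp: indicator_def)
      show "AE w in M. 0 \<le> v w * indicat_real B (X w)" using v(2) by eventually_elim simp
    qed
    finally show ?thesis .
  qed
  have "law f = law h"
  proof (rule measure_eqI)
    show "sets (law f) = sets (law h)" by (simp add: law_def)
    fix B assume "B \<in> sets (law f)"
    hence "B \<in> sets borel" by (simp add: law_def)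
    thus "emeasure (law f) B = emeasure (law h) B" using em f h eq by simp
  qed
  moreover have "(\<integral>y. g y \<partial>law v) = (\<integral>w. v w * g (X w) \<partial>M)"
    if "integrable M v" "AE w in M. 0 \<le> v w" for v
    unfolding law_def using that by (subst integral_distr) (auto simp: integral_density)
  ultimately show ?thesis using f h by metis
qed

context randomized_urn
begin

abbreviation "filt \<equiv> urn_filtration M C0 chi R"
abbreviation "config \<equiv> urn_config C0 chi R"
abbreviation "contents \<equiv> urn_total C0 chi R"
abbreviation "mean \<equiv> truncated_cond_mean M C0 chi R"

lemma R_measurable: "1 \<le> n \<Longrightarrow> R n \<in> borel_measurable M"
  by (rule borel_measurable_integrable[OF R_integrable])

lemma C0_measurable: "C0 \<in> borel_measurable M"
  by (rule borel_measurable_integrable[OF C0_integrable])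

lemma space_filt: "space (filt n) = space M"
  unfolding urn_filtration_def by (rule space_measure_of) auto

lemma sets_filt: "sets (filt n) = sigma_sets (space M)
     ({C0 -` A \<inter> space M | A. A \<in> sets borel}
      \<union> (\<Union>m\<in>{1..n}. {R m -` A \<inter> space M | A. A \<in> sets borel})
      \<union> (\<Union>m\<in>{1..n}. {chi m -` A \<inter> space M | A. A \<in> sets borel}))"
  unfolding urn_filtration_def by (rule sets_measure_of) auto

lemma subalgebra_filt: "subalgebra M (filt n)"
proof -
  have "C0 -` A \<inter> space M \<in> sets M" if "A \<in> sets borel" for A
    using that by (rule measurable_sets[OF C0_measurable])
  moreover have "R m -` A \<inter> space M \<in> sets M" if "A \<in> sets borel" "m \<in> {1..n}" for A m
    using that by (intro measurable_sets[OF R_measurable]) auto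
  moreover have "chi m -` A \<inter> space M \<in> sets M" if "A \<in> sets borel" "m \<in> {1..n}" for A m
    using that by (intro measurable_sets[OF chi_measurable]) auto
  ultimately have "sets (filt n) \<subseteq> sets M"
    unfolding sets_filt by (intro sets.sigma_sets_subset) blast
  thus ?thesis by (simp add: subalgebra_def space_filt)
qed

lemma filt_mono: "sets (filt n) \<subseteq> sets (filt (Suc n))"
  unfolding sets_filt by (intro sigma_sets_mono' Un_mono UN_mono order_refl) auto

lemma C0_filt: "C0 \<in> borel_measurable (filt n)"
proof (rule measurableI)
  fix A :: "(real^'k) set" assume "A \<in> sets borel"
  thus "C0 -` A \<inter> space (filt n) \<in> sets (filt n)"
    unfolding space_filt sets_filt by (intro sigma_sets.Basic) blast
qed simp

lemma R_filt:
  assumes m: "1 \<le> m" "m \<le> n" shows "R m \<in> borel_measurable (filt n)"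
proof (rule measurableI)
  fix A :: "(real^'k^'k) set" assume "A \<in> sets borel"
  moreover have "m \<in> {1..n}" using m by simp
  ultimately have "R m -` A \<inter> space M \<in> (\<Union>m\<in>{1..n}. {R m -` A \<inter> space M | A. A \<in> sets borel})"
    by blast
  thus "R m -` A \<inter> space (filt n) \<in> sets (filt n)"
    unfolding space_filt sets_filt by (intro sigma_sets.Basic) blast
qed simp

lemma chi_filt:
  assumes m: "1 \<le> m" "m \<le> n" shows "chi m \<in> borel_measurable (filt n)"
proof (rule measurableI)
  fix A :: "(real^'k) set" assume "A \<in> sets borel"
  moreover have "m \<in> {1..n}" using m by simp
  ultimately have "chi m -` A \<inter> space M \<in> (\<Union>m\<in>{1..n}. {chi m -` A \<inter> space M | A. A \<in> sets borel})"
    by blast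
  thus "chi m -` A \<inter> space (filt n) \<in> sets (filt n)"
    unfolding space_filt sets_filt by (intro sigma_sets.Basic) blast
qed simp

lemma config_filt: "m \<le> n \<Longrightarrow> config m \<in> borel_measurable (filt n)"
proof (induction m)
  case (Suc m)
  have "(\<lambda>w. config m w + chi (Suc m) w v* R (Suc m) w) \<in> borel_measurable (filt n)"
    using Suc by (intro borel_measurable_add measurable_vector_matrix_mult R_filt chi_filt) auto
  moreover have "config (Suc m) = (\<lambda>w. config m w + chi (Suc m) w v* R (Suc m) w)" by (rule ext) simp
  ultimately show ?case by simp
next
  case 0
  have "config 0 = C0" by (rule ext) simp
  thus ?case using C0_filt by simp
qed

lemma contents_filt: "contents n \<in> borel_measurable (filt n)"
proof -
  have "contents n = (\<lambda>w. \<Sum>i\<in>UNIV. config n w $ i)" by (rule ext) (simp add: urn_total_def)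
  thus ?thesis using config_filt[of n n] by (simp add: borel_measurable_sum measurable_vec_nth)
qed

definition share :: "nat \<Rightarrow> 'k \<Rightarrow> 'w \<Rightarrow> real" where
  "share n i w = config n w $ i / contents n w"

lemma share_filt: "share n i \<in> borel_measurable (filt n)"
proof -
  have "share n i = (\<lambda>w. config n w $ i / contents n w)" by (rule ext) (simp add: share_def)
  thus ?thesis using config_filt[of n n] contents_filt by (simp add: borel_measurable_divide measurable_vec_nth)
qed

text \<open>The almost sure assumptions on the start, the draws and the replacement matrices, collected
  for all times at once, so that the urn can be studied path by path.\<close>

definition regular :: "'w \<Rightarrow> bool" where
  "regular w \<longleftrightarrow> C0 w \<noteq> 0 \<and> (\<forall>i. 0 \<le> C0 w $ i) \<and>
     (\<forall>n. chi (Suc n) w \<in> range (\<lambda>i. axis i 1)) \<and> (\<forall>n. nonneg_matrix (R (Suc n) w))"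

lemma AE_regular: "AE w in M. regular w"
proof -
  have "AE w in M. \<forall>n. chi (Suc n) w \<in> range (\<lambda>i. axis i 1)"
    using chi_unit_vector by (simp add: AE_all_countable)
  moreover have "AE w in M. \<forall>n. nonneg_matrix (R (Suc n) w)"
    using R_nonneg by (simp add: AE_all_countable)
  ultimately show ?thesis using C0_nonneg_nonzero
    by eventually_elim (simp add: regular_def)
qed

lemma regular_draw:
  assumes "regular w"
  obtains i where "chi (Suc n) w = axis i 1"
  using assms unfolding regular_def by blast

lemma regular_draw_bounds:
  assumes "regular w" shows "0 \<le> chi (Suc n) w $ i" "chi (Suc n) w $ i \<le> 1"
proof -
  obtain j where "chi (Suc n) w = axis j 1" using assms by (rule regular_draw)
  thus "0 \<le> chi (Suc n) w $ i" "chi (Suc n) w $ i \<le> 1" by (simp_all add: axis_def)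
qed

lemma regular_addition_nonneg:
  assumes "regular w" shows "0 \<le> (chi (Suc n) w v* R (Suc n) w) $ j"
  unfolding vector_matrix_mult_nth using assms regular_draw_bounds[OF assms]
  by (intro sum_nonneg mult_nonneg_nonneg) (auto simp: regular_def nonneg_matrix_def)

lemma regular_config_nonneg:
  assumes "regular w" shows "0 \<le> config n w $ i"
proof (induction n)
  case 0 thus ?case using assms by (simp add: regular_def)
next
  case (Suc n) thus ?case using regular_addition_nonneg[OF assms, of n i] by simp
qed

lemma regular_contents_pos:
  assumes "regular w" shows "0 < contents n w"
proof (induction n)
  case 0
  obtain i where "C0 w $ i \<noteq> 0" using assms by (auto simp: regular_def vec_eq_iff)
  hence "0 < C0 w $ i" using assms by (simp add: regular_def less_le)
  thus ?case unfolding urn_total_def using assms by (intro sum_pos2[where i = i]) (auto simp: regular_def)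
next
  case (Suc n)
  have "contents (Suc n) w = contents n w + (\<Sum>j\<in>UNIV. (chi (Suc n) w v* R (Suc n) w) $ j)"
    by (simp add: urn_total_def sum.distrib)
  thus ?case using Suc regular_addition_nonneg[OF assms, of n] by (simp add: add_pos_nonneg sum_nonneg)
qed

lemma regular_share_bounds:
  assumes "regular w" shows "0 \<le> share n i w" "share n i w \<le> 1"
proof -
  have "config n w $ i \<le> contents n w" unfolding urn_total_def
    by (rule member_le_sum) (auto simp: regular_config_nonneg[OF assms])
  thus "0 \<le> share n i w" "share n i w \<le> 1"
    using regular_contents_pos[OF assms, of n] regular_config_nonneg[OF assms, of n i]
    by (auto simp: share_def)
qed

lemma regular_draw_indicator:
  assumes "regular w" "w \<in> space M"
  shows "chi (Suc n) w $ i = indicat_real {u \<in> space M. chi (Suc n) u = axis i 1} w"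
proof -
  obtain j where "chi (Suc n) w = axis j 1" using assms(1) by (rule regular_draw)
  thus ?thesis using assms(2) by (simp add: indicator_def axis_eq_axis) (simp add: axis_def)
qed

lemma share_integrable: "integrable M (share n i)"
proof (rule integrable_const_bound[of _ 1])
  show "AE w in M. norm (share n i w) \<le> 1"
    using AE_regular by eventually_elim (use regular_share_bounds in auto)
qed (rule measurable_from_subalg[OF subalgebra_filt share_filt])

text \<open>By conditional independence the two weights \<open>1{chi = e\<^sub>i}\<close> and \<open>C\<^sub>i/S\<close> give every event
  \<open>{R \<in> B}\<close> the same mass on each event of the past. Hence the weighted laws of \<open>R\<close> coincide,
  and so do the weighted integrals of \<open>g (R)\<close>.\<close>

lemma cond_exp_draw_times_replacement:
  fixes g :: "real^'k^'k \<Rightarrow> real"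
  assumes g[measurable]: "g \<in> borel_measurable borel" and bound: "\<And>A. \<bar>g A\<bar> \<le> b"
  shows "AE w in M. real_cond_exp M (filt n) (\<lambda>u. chi (Suc n) u $ i * g (R (Suc n) u)) w
      = share n i w * real_cond_exp M (filt n) (\<lambda>u. g (R (Suc n) u)) w"
proof -
  interpret sigma_finite_subalgebra M "filt n" by (rule subalgebra_sigma_finite[OF subalgebra_filt])
  have R[measurable]: "R (Suc n) \<in> borel_measurable M" by (rule R_measurable) simp
  have chi[measurable]: "chi (Suc n) \<in> borel_measurable M" by (rule chi_measurable) simp
  have sh[measurable]: "share n i \<in> borel_measurable M"
    by (rule measurable_from_subalg[OF subalgebra_filt share_filt])
  have chi_i[measurable]: "(\<lambda>w. chi (Suc n) w $ i) \<in> borel_measurable M"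
    by (rule measurable_vec_nth) measurable
  define A where "A = {u \<in> space M. chi (Suc n) u = axis i 1}"
  have A[measurable]: "A \<in> sets M" unfolding A_def by measurable
  have draw: "AE w in M. real_cond_exp M (filt n) (indicat_real A) w = share n i w"
    using draw_prob[of "Suc n" i] by (simp add: cond_prob_sigma_def A_def share_def)
  have share_bd: "AE w in M. 0 \<le> share n i w \<and> share n i w \<le> 1"
    using AE_regular by eventually_elim (use regular_share_bounds in auto)
  have chiA: "AE w in M. chi (Suc n) w $ i = indicat_real A w"
  proof -
    have "AE w in M. w \<in> space M \<and> regular w" using AE_regular AE_space by eventually_elim simp
    thus ?thesis by eventually_elim (simp add: A_def regular_draw_indicator)
  qed
  have gR: "integrable M (\<lambda>u. g (R (Suc n) u))"
    by (rule integrable_const_bound[of _ b]) (use bound in auto)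
  have int1: "integrable M (\<lambda>u. indicat_real A u * g (R (Suc n) u))"
    by (rule Bochner_Integration.integrable_bound[OF gR]) (auto simp: indicator_def)
  have bounded_share: "integrable M (\<lambda>u. share n i u * f u)" if f: "integrable M f" for f
  proof (rule Bochner_Integration.integrable_bound[OF f])
    show "AE u in M. norm (share n i u * f u) \<le> norm (f u)"
      using share_bd by eventually_elim (simp add: abs_mult mult_left_le_one_le)
  qed (use f in measurable)
  have weights: "(\<integral>w. (indicator E w * indicat_real A w) * indicat_real B (R (Suc n) w) \<partial>M)
      = (\<integral>w. (indicator E w * share n i w) * indicat_real B (R (Suc n) w) \<partial>M)"
    if E: "E \<in> sets (filt n)" and B[measurable]: "B \<in> sets borel" for E B
  proof -
    have EM[measurable]: "E \<in> sets M" using E subalgebra_filt by (auto simp: subalgebra_def)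
    have E'[measurable]: "indicat_real E \<in> borel_measurable (filt n)" using E by simp
    define AB where "AB = {u \<in> space M. chi (Suc n) u \<in> {axis i 1} \<and> R (Suc n) u \<in> B}"
    define RB where "RB = {u \<in> space M. R (Suc n) u \<in> B}"
    have [measurable]: "AB \<in> sets M" "RB \<in> sets M" unfolding AB_def RB_def by measurable
    have ci: "AE w in M. real_cond_exp M (filt n) (indicat_real AB) w
        = real_cond_exp M (filt n) (indicat_real A) w * real_cond_exp M (filt n) (indicat_real RB) w"
    proof -
      have "cond_indep_var M (filt n) (chi (Suc n)) (R (Suc n))"
        using draw_replacement_cond_indep[of "Suc n"] by simp
      moreover have "{axis i 1 :: real^'k} \<in> sets borel" by simp
      ultimately show ?thesis using B
        unfolding cond_indep_var_def cond_prob_sigma_def AB_def A_def RB_def by fastforce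
    qed
    have iAB: "integrable M (\<lambda>w. indicat_real E w * indicat_real AB w)"
      by (rule integrable_const_bound[of _ 1]) (auto simp: indicator_def)
    have shE: "(\<lambda>w. indicat_real E w * share n i w) \<in> borel_measurable (filt n)"
      using share_filt by (intro borel_measurable_times E')
    have iRB: "integrable M (\<lambda>w. (indicat_real E w * share n i w) * indicat_real RB w)"
    proof (rule integrable_const_bound[of _ 1])
      show "AE w in M. norm (indicat_real E w * share n i w * indicat_real RB w) \<le> 1"
        using share_bd by eventually_elim (auto simp: indicator_def)
    qed measurable
    have "(\<integral>w. (indicator E w * indicat_real A w) * indicat_real B (R (Suc n) w) \<partial>M)
        = (\<integral>w. indicat_real E w * indicat_real AB w \<partial>M)"
      by (rule Bochner_Integration.integral_cong) (auto simp: indicator_def A_def AB_def)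
    also have "\<dots> = (\<integral>w. indicat_real E w * real_cond_exp M (filt n) (indicat_real AB) w \<partial>M)"
      by (rule real_cond_exp_intg(2)[OF iAB E', symmetric]) measurable
    also have "\<dots> = (\<integral>w. (indicat_real E w * share n i w) * real_cond_exp M (filt n) (indicat_real RB) w \<partial>M)"
    proof (rule integral_cong_AE)
      show "AE w in M. indicat_real E w * real_cond_exp M (filt n) (indicat_real AB) w
          = (indicat_real E w * share n i w) * real_cond_exp M (filt n) (indicat_real RB) w"
        using ci draw by eventually_elim simp
    qed measurable
    also have "\<dots> = (\<integral>w. (indicat_real E w * share n i w) * indicat_real RB w \<partial>M)"
      by (rule real_cond_exp_intg(2)[OF iRB shE]) measurable
    also have "\<dots> = (\<integral>w. (indicator E w * share n i w) * indicat_real B (R (Suc n) w) \<partial>M)"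
      by (rule Bochner_Integration.integral_cong) (auto simp: indicator_def RB_def)
    finally show ?thesis .
  qed
  have "AE w in M. real_cond_exp M (filt n) (\<lambda>u. indicat_real A u * g (R (Suc n) u)) w
      = share n i w * real_cond_exp M (filt n) (\<lambda>u. g (R (Suc n) u)) w"
  proof (rule real_cond_exp_charact)
    show "integrable M (\<lambda>u. indicat_real A u * g (R (Suc n) u))" by (rule int1)
    show "integrable M (\<lambda>w. share n i w * real_cond_exp M (filt n) (\<lambda>u. g (R (Suc n) u)) w)"
      by (rule bounded_share) (rule real_cond_exp_int(1)[OF gR])
    show "(\<lambda>w. share n i w * real_cond_exp M (filt n) (\<lambda>u. g (R (Suc n) u)) w) \<in> borel_measurable (filt n)"
      using share_filt by (intro borel_measurable_times borel_measurable_cond_exp)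
    fix E assume E: "E \<in> sets (filt n)"
    have EM[measurable]: "E \<in> sets M" using E subalgebra_filt by (auto simp: subalgebra_def)
    have E'[measurable]: "indicat_real E \<in> borel_measurable (filt n)" using E by simp
    have shE: "(\<lambda>w. indicat_real E w * share n i w) \<in> borel_measurable (filt n)"
      using share_filt by (intro borel_measurable_times E')
    have bdE: "integrable M (\<lambda>w. indicat_real E w * f w)" if "integrable M f" for f
      by (rule Bochner_Integration.integrable_bound[OF that]) (use that in \<open>auto simp: indicator_def\<close>)
    have "(\<integral>w\<in>E. indicat_real A w * g (R (Suc n) w) \<partial>M)
        = (\<integral>w. (indicator E w * indicat_real A w) * g (R (Suc n) w) \<partial>M)"
      unfolding set_lebesgue_integral_def by (simp add: mult.assoc)
    also have "\<dots> = (\<integral>w. (indicator E w * share n i w) * g (R (Suc n) w) \<partial>M)"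
    proof (rule integral_weighted_cong[OF _ _ _ _ R weights[OF E] g])
      show "integrable M (\<lambda>w. indicat_real E w * indicat_real A w)"
        by (rule integrable_const_bound[of _ 1]) (auto simp: indicator_def)
      show "integrable M (\<lambda>w. indicat_real E w * share n i w)" by (rule bdE[OF share_integrable])
      show "AE w in M. 0 \<le> indicat_real E w * share n i w" using share_bd by eventually_elim simp
    qed auto
    also have "\<dots> = (\<integral>w. (indicator E w * share n i w) * real_cond_exp M (filt n) (\<lambda>u. g (R (Suc n) u)) w \<partial>M)"
      using bdE[OF bounded_share[OF gR]]
      by (intro real_cond_exp_intg(2)[OF _ shE, symmetric]) (auto simp: mult.assoc)
    also have "\<dots> = (\<integral>w\<in>E. share n i w * real_cond_exp M (filt n) (\<lambda>u. g (R (Suc n) u)) w \<partial>M)"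
      unfolding set_lebesgue_integral_def by (simp add: mult.assoc)
    finally show "(\<integral>w\<in>E. indicat_real A w * g (R (Suc n) w) \<partial>M)
        = (\<integral>w\<in>E. share n i w * real_cond_exp M (filt n) (\<lambda>u. g (R (Suc n) u)) w \<partial>M)" .
  qed
  moreover have "AE w in M. real_cond_exp M (filt n) (\<lambda>u. chi (Suc n) u $ i * g (R (Suc n) u)) w
      = real_cond_exp M (filt n) (\<lambda>u. indicat_real A u * g (R (Suc n) u)) w"
  proof (rule real_cond_exp_cong)
    show "AE u in M. chi (Suc n) u $ i * g (R (Suc n) u) = indicat_real A u * g (R (Suc n) u)"
      using chiA by eventually_elim simp
  qed measurable
  ultimately show ?thesis by eventually_elim simp
qed

end

section \<open>The strong law for the urn\<close>

text \<open>The deterministic bookkeeping behind \<open>C\<^sub>n / n - A\<^sub>n H \<rightarrow> 0\<close>: the increments split into the part removed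
  by truncation, a centered part, the error of the conditional means, and the limit matrix.\<close>

lemma urn_config_linearization:
  fixes c x y :: "nat \<Rightarrow> real^'k" and B T :: "nat \<Rightarrow> real^'k^'k" and H :: "real^'k^'k"
  assumes c: "\<And>n. c (Suc n) = c n + y (Suc n) v* B (Suc n)"
    and trunc: "eventually (\<lambda>n. max_row_sum (B n) \<le> real n) sequentially"
    and centered: "\<And>i j. (\<lambda>n. (1 / real n) * (\<Sum>k=1..n.
        y k $ i * (B k $ i $ j * (if max_row_sum (B k) \<le> real k then 1 else 0))
          - x (k - 1) $ i * T (k - 1) $ i $ j)) \<longlonglongrightarrow> 0"
    and x: "\<And>k i. \<bar>x k $ i\<bar> \<le> 1"
    and cesaro: "(\<lambda>n. (1 / real n) * (\<Sum>k<n. max_row_sum (T k - H))) \<longlonglongrightarrow> 0"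
  shows "(\<lambda>n. (1 / real n) *\<^sub>R c n - (1 / real n) *\<^sub>R ((\<Sum>k<n. x k) v* H)) \<longlonglongrightarrow> 0"
proof -
  define G where "G k i j = B k $ i $ j * (if max_row_sum (B k) \<le> real k then 1 else 0)" for k i j
  have inv_n: "(\<lambda>n. 1 / real n) \<longlonglongrightarrow> 0" by (rule lim_const_over_n)
  have sum_c: "c n $ j = c 0 $ j + (\<Sum>k=1..n. \<Sum>i\<in>UNIV. y k $ i * B k $ i $ j)" for n j
    by (induction n) (simp_all add: c vector_matrix_mult_nth)
  obtain N where N: "\<And>n. n \<ge> N \<Longrightarrow> max_row_sum (B n) \<le> real n"
    using trunc by (auto simp: eventually_sequentially)
  have rest: "(\<lambda>n. (1 / real n) * (\<Sum>k=1..n. y k $ i * (B k $ i $ j - G k i j))) \<longlonglongrightarrow> 0" for i j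
  proof -
    define d where "d k = y k $ i * (B k $ i $ j - G k i j)" for k
    have d0: "d k = 0" if "k \<ge> N" for k using N[OF that] by (simp add: d_def G_def)
    have const: "(\<Sum>k=1..n. d k) = (\<Sum>k=1..N. d k)" if "n \<ge> N" for n
      using that d0 by (intro sum.mono_neutral_right) auto
    have ev: "eventually (\<lambda>n. (1 / real n) * (\<Sum>k=1..N. d k) = (1 / real n) * (\<Sum>k=1..n. d k)) sequentially"
      using eventually_ge_at_top[of N]
    proof eventually_elim
      case (elim n)
      show ?case by (simp only: const[OF elim])
    qed
    have "(\<lambda>n. (1 / real n) * (\<Sum>k=1..N. d k)) \<longlonglongrightarrow> 0 * (\<Sum>k=1..N. d k)"
      by (intro tendsto_mult inv_n tendsto_const)
    hence "(\<lambda>n. (1 / real n) * (\<Sum>k=1..N. d k)) \<longlonglongrightarrow> 0" by simp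
    from Lim_transform_eventually[OF this ev] show ?thesis by (simp add: d_def)
  qed
  have drift: "(\<lambda>n. (1 / real n) * (\<Sum>k<n. x k $ i * (T k $ i $ j - H $ i $ j))) \<longlonglongrightarrow> 0" for i j
  proof (rule Lim_null_comparison[OF _ cesaro], rule always_eventually, rule allI)
    fix n
    have "\<bar>\<Sum>k<n. x k $ i * (T k $ i $ j - H $ i $ j)\<bar> \<le> (\<Sum>k<n. max_row_sum (T k - H))"
    proof (rule order_trans[OF sum_abs], rule sum_mono)
      fix k
      have "\<bar>x k $ i * (T k $ i $ j - H $ i $ j)\<bar> \<le> 1 * \<bar>(T k - H) $ i $ j\<bar>"
        unfolding abs_mult using x[of k i] by (intro mult_mono) auto
      thus "\<bar>x k $ i * (T k $ i $ j - H $ i $ j)\<bar> \<le> max_row_sum (T k - H)"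
        using max_row_sum_entry_le[of "T k - H" i j] by simp
    qed
    thus "norm ((1 / real n) * (\<Sum>k<n. x k $ i * (T k $ i $ j - H $ i $ j)))
        \<le> (1 / real n) * (\<Sum>k<n. max_row_sum (T k - H))"
      by (simp add: abs_mult divide_right_mono)
  qed
  have eq: "((1 / real n) *\<^sub>R c n - (1 / real n) *\<^sub>R ((\<Sum>k<n. x k) v* H)) $ j
      = (1 / real n) * c 0 $ j
        + (\<Sum>i\<in>UNIV. (1 / real n) * (\<Sum>k=1..n. y k $ i * (B k $ i $ j - G k i j))
            + (1 / real n) * (\<Sum>k=1..n. y k $ i * G k i j - x (k - 1) $ i * T (k - 1) $ i $ j)
            + (1 / real n) * (\<Sum>k<n. x k $ i * (T k $ i $ j - H $ i $ j)))" for n j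
  proof -
    have shift: "(\<Sum>k=1..n. x (k - 1) $ i * T (k - 1) $ i $ j) = (\<Sum>k<n. x k $ i * T k $ i $ j)" for i
      by (rule sum.reindex_bij_witness[of _ Suc "\<lambda>k. k - 1"]) auto
    have one: "(\<Sum>k=1..n. y k $ i * (B k $ i $ j - G k i j))
            + (\<Sum>k=1..n. y k $ i * G k i j - x (k - 1) $ i * T (k - 1) $ i $ j)
            + (\<Sum>k<n. x k $ i * (T k $ i $ j - H $ i $ j))
        = (\<Sum>k=1..n. y k $ i * B k $ i $ j) - (\<Sum>k<n. x k $ i) * H $ i $ j" for i
      unfolding sum_subtractf right_diff_distrib shift
      by (simp add: sum_distrib_right)
    have "((1 / real n) *\<^sub>R c n - (1 / real n) *\<^sub>R ((\<Sum>k<n. x k) v* H)) $ j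
        = (1 / real n) * (c n $ j - (\<Sum>i\<in>UNIV. (\<Sum>k<n. x k $ i) * H $ i $ j))"
      by (simp add: vector_matrix_mult_nth sum_component right_diff_distrib)
    also have "c n $ j = c 0 $ j + (\<Sum>i\<in>UNIV. \<Sum>k=1..n. y k $ i * B k $ i $ j)"
      using sum_c[of n j] sum.swap[of "\<lambda>k i. y k $ i * B k $ i $ j" UNIV "{1..n}"] by argo
    also have "(1 / real n) * (c 0 $ j + (\<Sum>i\<in>UNIV. \<Sum>k=1..n. y k $ i * B k $ i $ j)
          - (\<Sum>i\<in>UNIV. (\<Sum>k<n. x k $ i) * H $ i $ j))
        = (1 / real n) * c 0 $ j + (1 / real n) * (\<Sum>i\<in>UNIV. (\<Sum>k=1..n. y k $ i * B k $ i $ j) - (\<Sum>k<n. x k $ i) * H $ i $ j)"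
      by (simp only: sum_subtractf distrib_left[symmetric] add_diff_eq)
    also have "(\<Sum>i\<in>UNIV. (\<Sum>k=1..n. y k $ i * B k $ i $ j) - (\<Sum>k<n. x k $ i) * H $ i $ j)
        = (\<Sum>i\<in>UNIV. (\<Sum>k=1..n. y k $ i * (B k $ i $ j - G k i j))
            + (\<Sum>k=1..n. y k $ i * G k i j - x (k - 1) $ i * T (k - 1) $ i $ j)
            + (\<Sum>k<n. x k $ i * (T k $ i $ j - H $ i $ j)))"
      by (simp only: one)
    finally show ?thesis by (simp only: sum_distrib_left distrib_left)
  qed
  have "(\<lambda>n. (1 / real n) * c 0 $ j
        + (\<Sum>i\<in>UNIV. (1 / real n) * (\<Sum>k=1..n. y k $ i * (B k $ i $ j - G k i j))
            + (1 / real n) * (\<Sum>k=1..n. y k $ i * G k i j - x (k - 1) $ i * T (k - 1) $ i $ j)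
            + (1 / real n) * (\<Sum>k<n. x k $ i * (T k $ i $ j - H $ i $ j))))
      \<longlonglongrightarrow> 0 * c 0 $ j + (\<Sum>i\<in>(UNIV :: 'k set). 0 + 0 + 0)" for j
    using centered unfolding G_def[symmetric]
    by (intro tendsto_add tendsto_sum tendsto_mult inv_n tendsto_const rest drift)
  hence "(\<lambda>n. ((1 / real n) *\<^sub>R c n - (1 / real n) *\<^sub>R ((\<Sum>k<n. x k) v* H)) $ j) \<longlonglongrightarrow> 0" for j
    unfolding eq by simp
  thus ?thesis by (intro vec_tendstoI) simp
qed

context randomized_urn
begin

lemma strong_law_counts:
  "AE w in M. \<forall>i. (\<lambda>n. (1 / real n) * (\<Sum>k=1..n. chi k w $ i - share (k - 1) i w)) \<longlonglongrightarrow> 0"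
proof -
  have "AE w in M. (\<lambda>n. (1 / real n) * (\<Sum>k=1..n. chi k w $ i - share (k - 1) i w)) \<longlonglongrightarrow> 0" for i
  proof (rule strong_law_conditional_means[where F = filt and m = "\<lambda>n. share n i" and Y = "\<lambda>k w. chi k w $ i",
        OF subalgebra_filt filt_mono])
    have [measurable]: "(\<lambda>w. chi (Suc n) w $ i) \<in> borel_measurable M" for n
      by (intro measurable_vec_nth chi_measurable) simp
    have bd: "AE w in M. (chi (Suc n) w $ i)\<^sup>2 \<le> 1" for n
      using AE_regular by eventually_elim (use regular_draw_bounds in \<open>auto simp: power_le_one\<close>)
    show "(\<lambda>w. chi (Suc n) w $ i) \<in> borel_measurable (filt (Suc n))" for n
      by (intro measurable_vec_nth chi_filt) auto
    show int: "integrable M (\<lambda>w. (chi (Suc n) w $ i)\<^sup>2)" for n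
      by (rule integrable_const_bound[of _ 1]) (use bd in auto)
    have le1: "(\<integral>w. (chi (Suc n) w $ i)\<^sup>2 \<partial>M) \<le> 1" for n
    proof -
      have "(\<integral>w. (chi (Suc n) w $ i)\<^sup>2 \<partial>M) \<le> (\<integral>w. 1 \<partial>M)"
        by (rule integral_mono_AE[OF int _ bd]) simp
      thus ?thesis by (simp add: prob_space)
    qed
    show "summable (\<lambda>k. (\<integral>w. (chi (Suc k) w $ i)\<^sup>2 \<partial>M) / (real (Suc k))\<^sup>2)"
    proof (rule summable_comparison_test')
      have "summable (\<lambda>k. inverse ((real (Suc k))\<^sup>2))"
        by (subst summable_Suc_iff[of "\<lambda>k. inverse ((real k)\<^sup>2)"]) (rule inverse_power_summable, simp)
      thus "summable (\<lambda>k. 1 / (real (Suc k))\<^sup>2)" by (simp add: inverse_eq_divide)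
      show "norm ((\<integral>w. (chi (Suc k) w $ i)\<^sup>2 \<partial>M) / (real (Suc k))\<^sup>2) \<le> 1 / (real (Suc k))\<^sup>2" if "0 \<le> k" for k
        using le1[of k] by (simp add: divide_right_mono)
    qed
    show "share n i \<in> borel_measurable (filt n)" for n by (rule share_filt)
    show "integrable M (\<lambda>w. (share n i w)\<^sup>2)" for n
    proof (rule integrable_const_bound[of _ 1])
      show "AE w in M. norm ((share n i w)\<^sup>2) \<le> 1"
        using AE_regular by eventually_elim (use regular_share_bounds in \<open>auto simp: power_le_one\<close>)
      have [measurable]: "share n i \<in> borel_measurable M" using share_integrable by simp
      show "(\<lambda>w. (share n i w)\<^sup>2) \<in> borel_measurable M" by measurable
    qed
    show "AE w in M. real_cond_exp M (filt n) (\<lambda>w. chi (Suc n) w $ i) w = share n i w" for n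
    proof -
      interpret sigma_finite_subalgebra M "filt n" by (rule subalgebra_sigma_finite[OF subalgebra_filt])
      have "AE w in M. w \<in> space M \<and> regular w" using AE_regular AE_space by eventually_elim simp
      hence "AE w in M. chi (Suc n) w $ i = indicat_real {u \<in> space M. chi (Suc n) u = axis i 1} w"
        by eventually_elim (simp add: regular_draw_indicator)
      moreover have [measurable]: "chi (Suc n) \<in> borel_measurable M" by (rule chi_measurable) simp
      ultimately have "AE w in M. real_cond_exp M (filt n) (\<lambda>w. chi (Suc n) w $ i) w
          = real_cond_exp M (filt n) (indicat_real {u \<in> space M. chi (Suc n) u = axis i 1}) w"
        by (intro real_cond_exp_cong) measurable
      moreover have "AE w in M. real_cond_exp M (filt n)
          (indicat_real {u \<in> space M. chi (Suc n) u = axis i 1}) w = share n i w"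
        using draw_prob[of "Suc n" i] by (simp add: cond_prob_sigma_def share_def)
      ultimately show ?thesis by eventually_elim simp
    qed
  qed
  thus ?thesis by (simp add: AE_all_countable)
qed

text \<open>Truncation at level \<open>k\<close> keeps the second moments finite, and the tail bound makes their sum
  with weights \<open>1/k\<^sup>2\<close> finite, as the strong law requires.\<close>

lemma strong_law_truncated_additions:
  assumes q: "summable q" "\<And>k. 0 \<le> q k"
    and tail: "\<And>n k. prob {w \<in> space M. real k < max_row_sum (R (Suc n) w)} \<le> q k"
  shows "AE w in M. \<forall>i j. (\<lambda>n. (1 / real n) * (\<Sum>k=1..n.
      chi k w $ i * (R k w $ i $ j * (if max_row_sum (R k w) \<le> real k then 1 else 0))
        - share (k - 1) i w * mean (k - 1) w $ i $ j)) \<longlonglongrightarrow> 0"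
proof -
  have "AE w in M. (\<lambda>n. (1 / real n) * (\<Sum>k=1..n.
      chi k w $ i * (R k w $ i $ j * (if max_row_sum (R k w) \<le> real k then 1 else 0))
        - share (k - 1) i w * mean (k - 1) w $ i $ j)) \<longlonglongrightarrow> 0" for i j
  proof -
    define g where "g k A = A $ i $ j * (if max_row_sum A \<le> real k then 1 else 0)" for k and A :: "real^'k^'k"
    have rho[measurable]: "max_row_sum \<in> borel_measurable (borel :: (real^'k^'k) measure)"
      using measurable_max_row_sum[of "\<lambda>A::real^'k^'k. A" borel] by simp
    have entry[measurable]: "(\<lambda>A::real^'k^'k. A $ i $ j) \<in> borel_measurable borel"
      by (intro measurable_vec_nth) simp
    have g[measurable]: "g k \<in> borel_measurable borel" for k
      unfolding g_def by measurable
    have g_rho: "\<bar>g k A\<bar> \<le> max_row_sum A * (if max_row_sum A \<le> real k then 1 else 0)" for k A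
      using max_row_sum_entry_le[of A i j] by (simp add: g_def)
    have g_bd: "\<bar>g k A\<bar> \<le> real k" for k A
      using g_rho[of k A] by (auto split: if_splits)
    have R[measurable]: "R (Suc n) \<in> borel_measurable M" for n by (rule R_measurable) simp
    have chi[measurable]: "(\<lambda>w. chi (Suc n) w $ i) \<in> borel_measurable M" for n
      by (intro measurable_vec_nth chi_measurable) simp
    have sh[measurable]: "share n i \<in> borel_measurable M" for n using share_integrable by simp
    have mean_eq: "mean n w $ i $ j = real_cond_exp M (filt n) (\<lambda>u. g (Suc n) (R (Suc n) u)) w" for n w
    proof -
      have "(\<lambda>u. R (Suc n) u $ i $ j * indicat_real {v. max_row_sum (R (Suc n) v) \<le> real (Suc n)} u)
          = (\<lambda>u. g (Suc n) (R (Suc n) u))" by (rule ext) (simp add: g_def indicator_def)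
      thus ?thesis by (simp add: truncated_cond_mean_def)
    qed
    define m where "m n w = share n i w * mean n w $ i $ j" for n w
    define Y where "Y k w = chi k w $ i * g k (R k w)" for k w
    have Y_le: "AE w in M. (Y (Suc n) w)\<^sup>2 \<le> (max_row_sum (R (Suc n) w))\<^sup>2
        * indicat_real {w. max_row_sum (R (Suc n) w) \<le> real (Suc n)} w" for n
      using AE_regular
    proof eventually_elim
      case (elim w)
      have "\<bar>Y (Suc n) w\<bar> \<le> 1 * (max_row_sum (R (Suc n) w) * (if max_row_sum (R (Suc n) w) \<le> real (Suc n) then 1 else 0))"
        unfolding Y_def abs_mult using regular_draw_bounds[OF elim, of n i]
        by (intro mult_mono g_rho) auto
      hence "\<bar>Y (Suc n) w\<bar>\<^sup>2 \<le> (1 * (max_row_sum (R (Suc n) w) * (if max_row_sum (R (Suc n) w) \<le> real (Suc n) then 1 else 0)))\<^sup>2"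
        by (rule power_mono) simp
      thus ?case by (simp add: indicator_def split: if_splits)
    qed
    have rn[measurable]: "(\<lambda>w. max_row_sum (R (Suc n) w)) \<in> borel_measurable M" for n by measurable
    have int_rho: "integrable M (\<lambda>w. (max_row_sum (R (Suc n) w))\<^sup>2
        * indicat_real {w. max_row_sum (R (Suc n) w) \<le> real (Suc n)} w)" for n
    proof (rule integrable_const_bound[of _ "(real (Suc n))\<^sup>2"])
      show "AE w in M. norm ((max_row_sum (R (Suc n) w))\<^sup>2
        * indicat_real {w. max_row_sum (R (Suc n) w) \<le> real (Suc n)} w) \<le> (real (Suc n))\<^sup>2"
        by (intro AE_I2) (auto simp: indicator_def max_row_sum_nonneg intro!: power_mono simp del: of_nat_Suc)
      have eq: "(max_row_sum (R (Suc n) w))\<^sup>2 * indicat_real {w. max_row_sum (R (Suc n) w) \<le> real (Suc n)} w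
          = (max_row_sum (R (Suc n) w))\<^sup>2 * (if max_row_sum (R (Suc n) w) \<le> real (Suc n) then 1 else 0)" for w
        by (simp add: indicator_def)
      show "(\<lambda>w. (max_row_sum (R (Suc n) w))\<^sup>2
        * indicat_real {w. max_row_sum (R (Suc n) w) \<le> real (Suc n)} w) \<in> borel_measurable M"
        unfolding eq by measurable
    qed
    have Ymeas[measurable]: "Y (Suc n) \<in> borel_measurable M" for n
    proof -
      have "(\<lambda>w. g (Suc n) (R (Suc n) w)) \<in> borel_measurable M" by measurable
      thus ?thesis unfolding Y_def using chi by (intro borel_measurable_times)
    qed
    have intY2: "integrable M (\<lambda>w. (Y (Suc n) w)\<^sup>2)" for n
      by (rule Bochner_Integration.integrable_bound[OF int_rho[of n]])
         (use Y_le[of n] in \<open>auto elim!: eventually_mono intro: order_trans[OF _ abs_ge_self]\<close>)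
    have "AE w in M. (\<lambda>n. (1 / real n) * (\<Sum>k=1..n. Y k w - m (k - 1) w)) \<longlonglongrightarrow> 0"
    proof (rule strong_law_conditional_means[where F = filt, OF subalgebra_filt filt_mono])
      show "Y (Suc n) \<in> borel_measurable (filt (Suc n))" for n
      proof -
        have "(\<lambda>w. g (Suc n) (R (Suc n) w)) \<in> borel_measurable (filt (Suc n))"
          by (rule measurable_compose[OF R_filt g]) auto
        moreover have "(\<lambda>w. chi (Suc n) w $ i) \<in> borel_measurable (filt (Suc n))"
          by (intro measurable_vec_nth chi_filt) auto
        ultimately show ?thesis unfolding Y_def by (intro borel_measurable_times)
      qed
      show "integrable M (\<lambda>w. (Y (Suc n) w)\<^sup>2)" for n by (rule intY2)
      have mom: "(\<integral>w. (Y (Suc k) w)\<^sup>2 \<partial>M) \<le> (\<Sum>l<Suc k. real (2 * l + 1) * q l)" for k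
      proof -
        have "(\<integral>w. (Y (Suc k) w)\<^sup>2 \<partial>M) \<le> (\<integral>w. (max_row_sum (R (Suc k) w))\<^sup>2
            * indicat_real {w. max_row_sum (R (Suc k) w) \<le> real (Suc k)} w \<partial>M)"
          by (rule integral_mono_AE[OF intY2 int_rho Y_le])
        also have "\<dots> \<le> (\<Sum>l<Suc k. real (2 * l + 1) * q l)"
          by (rule truncated_second_moment_le[OF rn max_row_sum_nonneg tail])
        finally show ?thesis .
      qed
      show "summable (\<lambda>k. (\<integral>w. (Y (Suc k) w)\<^sup>2 \<partial>M) / (real (Suc k))\<^sup>2)"
      proof (rule summable_comparison_test'[OF summable_truncated_second_moments[OF q]])
        show "norm ((\<integral>w. (Y (Suc k) w)\<^sup>2 \<partial>M) / (real (Suc k))\<^sup>2)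
            \<le> (\<Sum>m<Suc k. real (2 * m + 1) * q m) / (real (Suc k))\<^sup>2" if "0 \<le> k" for k
        proof -
          have "0 \<le> (\<integral>w. (Y (Suc k) w)\<^sup>2 \<partial>M) / (real (Suc k))\<^sup>2" by simp
          moreover have "(\<integral>w. (Y (Suc k) w)\<^sup>2 \<partial>M) / (real (Suc k))\<^sup>2
            \<le> (\<Sum>m<Suc k. real (2 * m + 1) * q m) / (real (Suc k))\<^sup>2"
            by (intro divide_right_mono mom) simp
          ultimately show ?thesis by (simp only: real_norm_def abs_of_nonneg)
        qed
      qed
      fix n
      interpret sigma_finite_subalgebra M "filt n" by (rule subalgebra_sigma_finite[OF subalgebra_filt])
      show "m n \<in> borel_measurable (filt n)"
        unfolding m_def mean_eq by (intro borel_measurable_times share_filt borel_measurable_cond_exp)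
      have intg: "integrable M (\<lambda>u. g (Suc n) (R (Suc n) u))"
      proof (rule integrable_const_bound[of _ "real (Suc n)"])
        show "AE u in M. norm (g (Suc n) (R (Suc n) u)) \<le> real (Suc n)"
          unfolding real_norm_def by (intro AE_I2 g_bd)
      qed measurable
      have bd1: "AE w in M. real_cond_exp M (filt n) (\<lambda>u. g (Suc n) (R (Suc n) u)) w \<le> real (Suc n)"
        using g_bd[of "Suc n"] by (intro real_cond_exp_le_c[OF intg] AE_I2) (simp add: abs_le_iff)
      have bd2: "AE w in M. - real (Suc n) \<le> real_cond_exp M (filt n) (\<lambda>u. g (Suc n) (R (Suc n) u)) w"
        using g_bd[of "Suc n"] by (intro real_cond_exp_ge_c[OF intg] AE_I2) (simp add: abs_le_iff minus_le_iff)
      show "integrable M (\<lambda>w. (m n w)\<^sup>2)"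
      proof (rule integrable_const_bound[of _ "(real (Suc n))\<^sup>2"])
        show "AE w in M. norm ((m n w)\<^sup>2) \<le> (real (Suc n))\<^sup>2"
          using bd1 bd2 AE_regular
        proof eventually_elim
          case (elim w)
          have "\<bar>m n w\<bar> \<le> 1 * real (Suc n)"
            unfolding m_def mean_eq abs_mult using elim regular_share_bounds[OF elim(3), of n i]
            by (intro mult_mono) auto
          hence "\<bar>m n w\<bar>\<^sup>2 \<le> (real (Suc n))\<^sup>2" by (intro power_mono) auto
          thus ?case by simp
        qed
        have "m n \<in> borel_measurable M"
          unfolding m_def mean_eq by (intro borel_measurable_times sh borel_measurable_cond_exp2)
        thus "(\<lambda>w. (m n w)\<^sup>2) \<in> borel_measurable M" by (rule borel_measurable_power)
      qed
      show "AE w in M. real_cond_exp M (filt n) (Y (Suc n)) w = m n w"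
        using cond_exp_draw_times_replacement[of "g (Suc n)" "real (Suc n)" n i, OF g g_bd]
        unfolding Y_def[abs_def] m_def mean_eq .
    qed
    thus ?thesis by (simp only: Y_def m_def g_def)
  qed
  thus ?thesis by (simp add: AE_all_countable)
qed

lemma AE_eventually_not_truncated:
  assumes q: "summable q"
    and tail: "\<And>n k. prob {w \<in> space M. real k < max_row_sum (R (Suc n) w)} \<le> q k"
  shows "AE w in M. eventually (\<lambda>n. max_row_sum (R n w) \<le> real n) sequentially"
proof -
  define E where "E n = {w \<in> space M. real (Suc n) < max_row_sum (R (Suc n) w)}" for n
  have E: "E n \<in> sets M" for n
  proof -
    have [measurable]: "(\<lambda>w. max_row_sum (R (Suc n) w)) \<in> borel_measurable M"
      by (intro measurable_max_row_sum R_measurable) simp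
    show ?thesis unfolding E_def by measurable
  qed
  have "summable (\<lambda>n. q (Suc n))" using q by (simp add: summable_Suc_iff)
  hence "summable (\<lambda>n. prob (E n))"
    by (rule summable_comparison_test') (auto simp: E_def intro!: tail simp del: of_nat_Suc)
  hence "AE w in M. eventually (\<lambda>n. w \<in> space M - E n) sequentially"
    by (intro borel_cantelli_AE1 E) (simp_all add: emeasure_eq_measure)
  thus ?thesis
  proof eventually_elim
    case (elim w)
    then obtain N where N: "\<And>n. n \<ge> N \<Longrightarrow> w \<in> space M - E n" by (auto simp: eventually_sequentially)
    have "max_row_sum (R n w) \<le> real n" if "n \<ge> Suc N" for n
    proof (cases n)
      case (Suc m)
      thus ?thesis using N[of m] that by (simp add: E_def not_less)
    qed (use that in simp)
    thus ?case unfolding eventually_sequentially by blast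
  qed
qed

lemma integrable_config: "integrable M (\<lambda>w. config n w $ j)"
proof (induction n)
  case 0
  show ?case using integrable_bounded_linear[OF bounded_linear_vec_nth C0_integrable] by simp
next
  case (Suc n)
  have "integrable M (\<lambda>w. \<Sum>i\<in>UNIV. chi (Suc n) w $ i * R (Suc n) w $ i $ j)"
  proof (rule Bochner_Integration.integrable_sum)
    fix i
    have Rij: "integrable M (\<lambda>w. R (Suc n) w $ i $ j)"
      by (intro integrable_bounded_linear[OF bounded_linear_vec_nth] R_integrable) simp
    show "integrable M (\<lambda>w. chi (Suc n) w $ i * R (Suc n) w $ i $ j)"
    proof (rule Bochner_Integration.integrable_bound[OF Rij])
      show "(\<lambda>w. chi (Suc n) w $ i * R (Suc n) w $ i $ j) \<in> borel_measurable M"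
        by (rule borel_measurable_times[OF measurable_vec_nth[OF chi_measurable] borel_measurable_integrable[OF Rij]])
          simp
      show "AE w in M. norm (chi (Suc n) w $ i * R (Suc n) w $ i $ j) \<le> norm (R (Suc n) w $ i $ j)"
        using AE_regular
      proof eventually_elim
        case (elim w)
        show ?case using regular_draw_bounds[OF elim, of n i]
          by (simp add: abs_mult mult_left_le_one_le)
      qed
    qed
  qed
  thus ?case using Suc by (simp add: vector_matrix_mult_nth)
qed

lemma integrable_contents: "integrable M (contents n)"
proof -
  have "contents n = (\<lambda>w. \<Sum>i\<in>UNIV. config n w $ i)" by (rule ext) (simp add: urn_total_def)
  thus ?thesis by (simp add: Bochner_Integration.integrable_sum integrable_config)
qed

lemma integrable_max_row_sum:
  assumes "1 \<le> n" shows "integrable M (\<lambda>w. max_row_sum (R n w))"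
proof (rule Bochner_Integration.integrable_bound)
  show "integrable M (\<lambda>w. \<Sum>i\<in>UNIV. \<Sum>j\<in>UNIV. \<bar>R n w $ i $ j\<bar>)"
    by (intro Bochner_Integration.integrable_sum integrable_abs
        integrable_bounded_linear[OF bounded_linear_vec_nth] R_integrable assms)
  show "(\<lambda>w. max_row_sum (R n w)) \<in> borel_measurable M"
    by (intro measurable_max_row_sum R_measurable assms)
  have "max_row_sum A \<le> (\<Sum>i\<in>UNIV. \<Sum>j\<in>UNIV. \<bar>A $ i $ j\<bar>)" for A :: "real^'k^'k"
    unfolding max_row_sum_def
  proof (rule Max.boundedI)
    fix a assume "a \<in> range (\<lambda>i. \<Sum>j\<in>UNIV. \<bar>A $ i $ j\<bar>)"
    then obtain i where "a = (\<Sum>j\<in>UNIV. \<bar>A $ i $ j\<bar>)" by auto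
    thus "a \<le> (\<Sum>i\<in>UNIV. \<Sum>j\<in>UNIV. \<bar>A $ i $ j\<bar>)"
      by (auto intro!: member_le_sum sum_nonneg)
  qed auto
  hence "norm (max_row_sum (R n w)) \<le> norm (\<Sum>i\<in>UNIV. \<Sum>j\<in>UNIV. \<bar>R n w $ i $ j\<bar>)" for w
    by (simp add: max_row_sum_nonneg) (meson abs_ge_self order_trans)
  thus "AE w in M. norm (max_row_sum (R n w)) \<le> norm (\<Sum>i\<in>UNIV. \<Sum>j\<in>UNIV. \<bar>R n w $ i $ j\<bar>)"
    by blast
qed

lemma regular_contents_le:
  assumes "regular w" shows "contents n w \<le> contents 0 w + (\<Sum>k=1..n. max_row_sum (R k w))"
proof (induction n)
  case (Suc n)
  obtain i where i: "chi (Suc n) w = axis i 1" using assms by (rule regular_draw)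
  have "(chi (Suc n) w v* R (Suc n) w) $ j = R (Suc n) w $ i $ j" for j
    unfolding vector_matrix_mult_nth i axis_def by (simp add: if_distrib[of "\<lambda>x. x * _"] cong: if_cong)
  hence "(\<Sum>j\<in>UNIV. (chi (Suc n) w v* R (Suc n) w) $ j) \<le> (\<Sum>j\<in>UNIV. \<bar>R (Suc n) w $ i $ j\<bar>)"
    by (simp add: sum_mono)
  also have "\<dots> \<le> max_row_sum (R (Suc n) w)" by (rule max_row_sum_row_le)
  finally have "contents (Suc n) w \<le> contents n w + max_row_sum (R (Suc n) w)"
    by (simp add: urn_total_def sum.distrib)
  thus ?case using Suc by simp
qed simp

text \<open>By the previous lemma the excess of \<open>S\<^sub>n / n\<close> over \<open>m\<close> is at most \<open>S\<^sub>0 / n\<close> plus the average of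
  the excesses of the row sums, whose means are bounded by tails of the series \<open>\<Sum> q\<close>.\<close>

lemma contents_excess:
  assumes q: "summable q" "\<And>k. 0 \<le> q k"
    and tail: "\<And>n k. prob {w \<in> space M. real k < max_row_sum (R (Suc n) w)} \<le> q k"
    and e: "0 < e"
  shows "\<exists>m::nat. eventually (\<lambda>n. (\<integral>w. max 0 (contents n w / real n - real m) \<partial>M) \<le> e) sequentially"
proof -
  have "(\<lambda>m. suminf q - (\<Sum>l<m. q l)) \<longlonglongrightarrow> suminf q - suminf q"
    by (intro tendsto_diff tendsto_const summable_LIMSEQ q)
  hence "eventually (\<lambda>m. suminf q - (\<Sum>l<m. q l) < e / 2) sequentially"
    using e by (intro order_tendstoD(2)) auto
  then obtain m where "suminf q - (\<Sum>l<m. q l) < e / 2" by (auto simp: eventually_sequentially)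
  hence m: "(\<Sum>l. q (l + m)) < e / 2" using suminf_minus_initial_segment[OF q(1), of m] by simp
  define s0 where "s0 = (\<integral>w. contents 0 w \<partial>M)"
  have "(\<lambda>n. s0 * (1 / real n)) \<longlonglongrightarrow> s0 * 0" by (intro tendsto_mult tendsto_const lim_const_over_n)
  hence "eventually (\<lambda>n. s0 * (1 / real n) < e / 2) sequentially"
    using e by (intro order_tendstoD(2)) auto
  hence "eventually (\<lambda>n. (\<integral>w. max 0 (contents n w / real n - real m) \<partial>M) \<le> e) sequentially"
    using eventually_ge_at_top[of 1]
  proof eventually_elim
    case (elim n)
    have n: "0 < real n" using elim by simp
    define X where "X k w = max 0 (max_row_sum (R k w) - real m)" for k w
    have intX: "integrable M (X k)" if "k \<in> {1..n}" for k
      unfolding X_def using that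
      by (intro integrable_max Bochner_Integration.integrable_diff integrable_max_row_sum) auto
    have int_rhs: "integrable M (\<lambda>w. contents 0 w / real n + (\<Sum>k=1..n. X k w) / real n)"
      by (intro Bochner_Integration.integrable_add integrable_divide integrable_contents
          Bochner_Integration.integrable_sum intX)
    have "(\<integral>w. max 0 (contents n w / real n - real m) \<partial>M)
        \<le> (\<integral>w. contents 0 w / real n + (\<Sum>k=1..n. X k w) / real n \<partial>M)"
    proof (rule integral_mono_AE)
      show "integrable M (\<lambda>w. max 0 (contents n w / real n - real m))"
        by (intro integrable_max Bochner_Integration.integrable_diff integrable_divide integrable_contents) auto
      show "AE w in M. max 0 (contents n w / real n - real m)
          \<le> contents 0 w / real n + (\<Sum>k=1..n. X k w) / real n"
        using AE_regular
      proof eventually_elim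
        case (elim w)
        have "(\<Sum>k=1..n. max_row_sum (R k w)) \<le> (\<Sum>k=1..n. real m + X k w)"
          by (intro sum_mono) (simp add: X_def)
        hence "contents n w \<le> contents 0 w + (\<Sum>k=1..n. X k w) + real m * real n"
          using regular_contents_le[OF elim, of n] unfolding sum.distrib
          by (simp add: mult.commute[of "real n"])
        hence "contents n w / real n \<le> (contents 0 w + (\<Sum>k=1..n. X k w) + real m * real n) / real n"
          using n by (intro divide_right_mono) auto
        hence "contents n w / real n - real m \<le> (contents 0 w + (\<Sum>k=1..n. X k w)) / real n"
          using n by (simp add: add_divide_distrib)
        moreover have "0 \<le> (contents 0 w + (\<Sum>k=1..n. X k w)) / real n"
          using regular_contents_pos[OF elim, of 0]
          by (intro divide_nonneg_nonneg add_nonneg_nonneg sum_nonneg) (auto simp: X_def)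
        ultimately show ?case by (simp add: add_divide_distrib)
      qed
    qed (rule int_rhs)
    also have "\<dots> = s0 / real n + (\<Sum>k=1..n. \<integral>w. X k w \<partial>M) / real n"
    proof -
      have "(\<integral>w. contents 0 w / real n + (\<Sum>k=1..n. X k w) / real n \<partial>M)
          = (\<integral>w. contents 0 w / real n \<partial>M) + (\<integral>w. (\<Sum>k=1..n. X k w) / real n \<partial>M)"
        by (intro Bochner_Integration.integral_add integrable_divide integrable_contents
            Bochner_Integration.integrable_sum intX)
      moreover have "(\<integral>w. (\<Sum>k=1..n. X k w) \<partial>M) = (\<Sum>k=1..n. \<integral>w. X k w \<partial>M)"
        by (intro Bochner_Integration.integral_sum intX)
      ultimately show ?thesis by (simp add: s0_def)
    qed
    also have "(\<Sum>k=1..n. \<integral>w. X k w \<partial>M) \<le> (\<Sum>k=1..n. e / 2)"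
    proof (rule sum_mono)
      fix k assume k: "k \<in> {1..n}"
      then obtain k' where k': "k = Suc k'" by (cases k) auto
      have "(\<integral>w. X k w \<partial>M) \<le> (\<Sum>l. q (l + m))"
        unfolding X_def k'
        by (intro expected_excess_le q tail measurable_max_row_sum R_measurable) auto
      thus "(\<integral>w. X k w \<partial>M) \<le> e / 2" using m by simp
    qed
    finally have "(\<integral>w. max 0 (contents n w / real n - real m) \<partial>M) \<le> s0 / real n + (\<Sum>k=1..n. e / 2) / real n"
      using n by (simp add: divide_right_mono)
    moreover have "s0 / real n < e / 2"
      using elim(1) by (simp only: times_divide_eq_right mult_1_right)
    moreover have "(\<Sum>k=1..n. e / 2) / real n = e / 2" using n by simp
    ultimately show ?case by linarith
  qed
  thus ?thesis by blast
qed

end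

section \<open>The limit theorem\<close>

lemma (in randomized_urn) almost_sure_limits:
  fixes H :: "'w \<Rightarrow> real^'k^'k"
  assumes irreducible: "AE w in M. irreducible_matrix (H w)"
    and cesaro: "AE w in M.
      (\<lambda>n. (1 / real n) * (\<Sum>k<n. max_row_sum (mean k w - H w))) \<longlonglongrightarrow> 0"
    and q: "summable q" "\<And>k. 0 \<le> q k"
    and tail: "\<And>n k. prob {w \<in> space M. real k < max_row_sum (R (Suc n) w)} \<le> q k"
  shows "AE w in M.
      (\<lambda>n. config n w /\<^sub>R contents n w) \<longlonglongrightarrow> left_prob_eigenvector (H w) \<and>
      (\<lambda>n. contents n w / real n) \<longlonglongrightarrow> dominant_eigenvalue (H w) \<and>
      (\<lambda>n. config n w /\<^sub>R real n) \<longlonglongrightarrow> dominant_eigenvalue (H w) *\<^sub>R left_prob_eigenvector (H w) \<and>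
      (\<lambda>n. urn_counts chi n w /\<^sub>R real n) \<longlonglongrightarrow> left_prob_eigenvector (H w)"
  using AE_regular irreducible cesaro strong_law_counts
    strong_law_truncated_additions[OF q tail] AE_eventually_not_truncated[OF q(1) tail]
proof eventually_elim
  case (elim w)
  define x where "x k = (1 / contents k w) *\<^sub>R config k w" for k
  have x_share: "x k $ i = share k i w" for k i by (simp add: x_def share_def)
  have contents: "(\<Sum>i\<in>UNIV. config n w $ i) = contents n w" for n by (simp add: urn_total_def)
  have lin: "(\<lambda>n. (1 / real n) *\<^sub>R config n w - (1 / real n) *\<^sub>R ((\<Sum>k<n. x k) v* H w)) \<longlonglongrightarrow> 0"
  proof (rule urn_config_linearization[where y = "\<lambda>k. chi k w" and B = "\<lambda>k. R k w" and T = "\<lambda>k. mean k w"])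
    show "config (Suc n) w = config n w + chi (Suc n) w v* R (Suc n) w" for n by simp
    show "eventually (\<lambda>n. max_row_sum (R n w) \<le> real n) sequentially" by (rule elim)
    show "(\<lambda>n. (1 / real n) * (\<Sum>k=1..n. chi k w $ i * (R k w $ i $ j *
        (if max_row_sum (R k w) \<le> real k then 1 else 0)) - x (k - 1) $ i * mean (k - 1) w $ i $ j))
        \<longlonglongrightarrow> 0" for i j
      unfolding x_share using elim(5) by blast
    show "\<bar>x k $ i\<bar> \<le> 1" for k i
      unfolding x_share using regular_share_bounds[OF elim(1), of k i] by simp
    show "(\<lambda>n. (1 / real n) * (\<Sum>k<n. max_row_sum (mean k w - H w))) \<longlonglongrightarrow> 0" by (rule elim)
  qed
  note limits = self_consistent_proportions_converge[where C = "\<lambda>n. config n w", unfolded contents,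
      OF elim(2) regular_config_nonneg[OF elim(1)] regular_contents_pos[OF elim(1)] lin[unfolded x_def]]
  have "(\<lambda>n. urn_counts chi n w /\<^sub>R real n) \<longlonglongrightarrow> left_prob_eigenvector (H w)"
  proof (rule vec_tendstoI)
    fix i
    have shift: "(\<Sum>k=1..n. share (k - 1) i w) = (\<Sum>k<n. x k $ i)" for n
      unfolding x_share by (rule sum.reindex_bij_witness[of _ Suc "\<lambda>k. k - 1"]) auto
    have "(\<lambda>n. (1 / real n) * (\<Sum>k=1..n. chi k w $ i - share (k - 1) i w)
        + ((1 / real n) *\<^sub>R (\<Sum>k<n. x k)) $ i) \<longlonglongrightarrow> 0 + left_prob_eigenvector (H w) $ i"
      using limits(1) elim(4) unfolding x_def by (intro tendsto_add tendsto_vec_nth) auto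
    moreover have "(1 / real n) * (\<Sum>k=1..n. chi k w $ i - share (k - 1) i w)
        + ((1 / real n) *\<^sub>R (\<Sum>k<n. x k)) $ i = (urn_counts chi n w /\<^sub>R real n) $ i" for n
      unfolding sum_subtractf shift
      by (simp add: urn_counts_def sum_component diff_divide_distrib inverse_eq_divide)
    ultimately show "(\<lambda>n. (urn_counts chi n w /\<^sub>R real n) $ i) \<longlonglongrightarrow> left_prob_eigenvector (H w) $ i"
      by simp
  qed
  thus ?case using limits(2-4) by (simp add: inverse_eq_divide)
qed

theorem theorem2p2:
  fixes M :: "'w measure"
    and C0 :: "'w \<Rightarrow> real^'k"
    and chi :: "nat \<Rightarrow> 'w \<Rightarrow> real^'k"
    and R :: "nat \<Rightarrow> 'w \<Rightarrow> real^'k^'k"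
    and H :: "'w \<Rightarrow> real^'k^'k"
  defines "C \<equiv> urn_config C0 chi R"
    and "S \<equiv> urn_total C0 chi R"
  assumes urn: "randomized_urn M C0 chi R"
    and H_measurable: "H \<in> borel_measurable M"
    and H_nonneg: "AE w in M. nonneg_matrix (H w)"
    and H_irreducible: "AE w in M. irreducible_matrix (H w)"
    and H_cesaro: "AE w in M.
          (\<lambda>n. (1 / real n) * (\<Sum>k<n. max_row_sum (truncated_cond_mean M C0 chi R k w - H w)))
            \<longlonglongrightarrow> 0"
    and moments: "tail_dominated M R \<or> phi_moment_bounded M R"
  shows "tendsto_as_and_L1 M (\<lambda>n w. C n w /\<^sub>R S n w) (\<lambda>w. left_prob_eigenvector (H w))
       \<and> tendsto_as_and_L1 M (\<lambda>n w. S n w / real n) (\<lambda>w. dominant_eigenvalue (H w))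
       \<and> tendsto_as_and_L1 M (\<lambda>n w. C n w /\<^sub>R real n)
           (\<lambda>w. dominant_eigenvalue (H w) *\<^sub>R left_prob_eigenvector (H w))
       \<and> tendsto_as_and_L1 M (\<lambda>n w. urn_counts chi n w /\<^sub>R real n)
           (\<lambda>w. left_prob_eigenvector (H w))"
proof -
  interpret randomized_urn M C0 chi R by (rule urn)
  obtain q where q: "summable q" "\<And>k. 0 \<le> q k"
    and "\<And>n k. 1 \<le> n \<Longrightarrow> prob {w \<in> space M. real k < max_row_sum (R n w)} \<le> q k"
    using uniformly_summable_tail[OF R_measurable moments] by blast
  hence tail: "prob {w \<in> space M. real k < max_row_sum (R (Suc n) w)} \<le> q k" for n k by simp
  note limits = almost_sure_limits[OF H_irreducible H_cesaro q tail]
  let ?p = "\<lambda>w. left_prob_eigenvector (H w)" and ?l = "\<lambda>w. dominant_eigenvalue (H w)"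
  have as1: "AE w in M. (\<lambda>n. C n w /\<^sub>R S n w) \<longlonglongrightarrow> ?p w"
    and as2: "AE w in M. (\<lambda>n. S n w / real n) \<longlonglongrightarrow> ?l w"
    and as3: "AE w in M. (\<lambda>n. C n w /\<^sub>R real n) \<longlonglongrightarrow> ?l w *\<^sub>R ?p w"
    and as4: "AE w in M. (\<lambda>n. urn_counts chi n w /\<^sub>R real n) \<longlonglongrightarrow> ?p w"
    unfolding C_def S_def using limits by (eventually_elim; blast)+
  have p_meas: "?p \<in> borel_measurable M" and l_meas: "?l \<in> borel_measurable M"
    by (rule measurable_left_prob_eigenvector[OF H_measurable])+
  have C_meas: "C n \<in> borel_measurable M" and S_meas: "S n \<in> borel_measurable M" for n
    unfolding C_def S_def
    by (rule measurable_from_subalg[OF subalgebra_filt config_filt[OF order_refl]])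
       (rule measurable_from_subalg[OF subalgebra_filt contents_filt])
  have "tendsto_L1 M (\<lambda>n w. C n w /\<^sub>R S n w) ?p"
  proof (rule tendsto_L1_bounded[OF _ p_meas _ as1])
    show "(\<lambda>w. C n w /\<^sub>R S n w) \<in> borel_measurable M" for n
      using C_meas S_meas by (intro borel_measurable_scaleR borel_measurable_inverse)
    show "AE w in M. norm (C n w /\<^sub>R S n w) \<le> 1" for n
      using AE_regular
    proof eventually_elim
      case (elim w)
      have "norm (C n w /\<^sub>R S n w) \<le> (\<Sum>i\<in>UNIV. \<bar>(C n w /\<^sub>R S n w) $ i\<bar>)" by (rule norm_le_l1_cart)
      also have "\<dots> = (\<Sum>i\<in>UNIV. C n w $ i) / S n w"
        using regular_contents_pos[OF elim, of n] regular_config_nonneg[OF elim, of n]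
        by (simp add: C_def S_def sum_distrib_left abs_mult divide_inverse mult.commute)
      also have "\<dots> = 1"
        using regular_contents_pos[OF elim, of n] by (simp add: C_def S_def urn_total_def)
      finally show ?case .
    qed
  qed
  moreover have excess: "\<exists>m::nat. eventually (\<lambda>n. (\<integral>w. max 0 (S n w / real n - real m) \<partial>M) \<le> e) sequentially"
    if "0 < e" for e unfolding S_def by (rule contents_excess[OF q tail that])
  have S_int: "integrable M (\<lambda>w. S n w / real n)" for n
    unfolding S_def by (intro integrable_divide integrable_contents)
  have "tendsto_L1 M (\<lambda>n w. S n w / real n) ?l"
  proof (rule tendsto_L1_small_excess[OF S_int _ l_meas as2 excess])
    show "AE w in M. 0 \<le> S n w / real n" for n
      using AE_regular by eventually_elim (simp add: S_def regular_contents_pos less_imp_le)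
  qed
  moreover have "tendsto_L1 M (\<lambda>n w. C n w /\<^sub>R real n) (\<lambda>w. ?l w *\<^sub>R ?p w)"
  proof (rule tendsto_L1_componentwise, rule tendsto_L1_small_excess)
    fix i
    have C_int: "integrable M (\<lambda>w. C n w $ i / real n)" for n
      unfolding C_def by (intro integrable_divide integrable_config)
    thus "integrable M (\<lambda>w. (C n w /\<^sub>R real n) $ i)" for n
      by (simp add: divide_inverse mult.commute)
    show "AE w in M. 0 \<le> (C n w /\<^sub>R real n) $ i" for n
      using AE_regular by eventually_elim (simp add: C_def regular_config_nonneg)
    show "(\<lambda>w. (?l w *\<^sub>R ?p w) $ i) \<in> borel_measurable M"
      by (intro measurable_vec_nth borel_measurable_scaleR p_meas l_meas)
    show "AE w in M. (\<lambda>n. (C n w /\<^sub>R real n) $ i) \<longlonglongrightarrow> (?l w *\<^sub>R ?p w) $ i"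
      using as3 by eventually_elim (rule tendsto_vec_nth)
    fix e :: real assume "0 < e"
    then obtain m :: nat where m: "eventually (\<lambda>n. (\<integral>w. max 0 (S n w / real n - real m) \<partial>M) \<le> e) sequentially"
      using excess by blast
    have "eventually (\<lambda>n. (\<integral>w. max 0 ((C n w /\<^sub>R real n) $ i - real m) \<partial>M) \<le> e) sequentially"
      using m
    proof eventually_elim
      case (elim n)
      have "(\<integral>w. max 0 (C n w $ i / real n - real m) \<partial>M) \<le> (\<integral>w. max 0 (S n w / real n - real m) \<partial>M)"
      proof (rule integral_mono_AE)
        show "AE w in M. max 0 (C n w $ i / real n - real m) \<le> max 0 (S n w / real n - real m)"
          using AE_regular
        proof eventually_elim
          case (elim w)
          have "C n w $ i \<le> S n w" unfolding C_def S_def urn_total_def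
            by (rule member_le_sum) (auto simp: regular_config_nonneg[OF elim])
          hence "C n w $ i / real n \<le> S n w / real n" by (rule divide_right_mono) simp
          thus ?case by simp
        qed
      qed (use C_int S_int in \<open>auto intro!: integrable_max Bochner_Integration.integrable_diff\<close>)
      thus ?case using elim by (simp add: divide_inverse mult.commute)
    qed
    thus "\<exists>m::nat. eventually (\<lambda>n. (\<integral>w. max 0 ((C n w /\<^sub>R real n) $ i - real m) \<partial>M) \<le> e) sequentially"
      by blast
  qed
  moreover have "tendsto_L1 M (\<lambda>n w. urn_counts chi n w /\<^sub>R real n) ?p"
  proof (rule tendsto_L1_bounded[OF _ p_meas _ as4])
    show "(\<lambda>w. urn_counts chi n w /\<^sub>R real n) \<in> borel_measurable M" for n
      unfolding urn_counts_def
      by (intro borel_measurable_scaleR borel_measurable_const borel_measurable_sum chi_measurable) simp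
    show "AE w in M. norm (urn_counts chi n w /\<^sub>R real n) \<le> 1" for n
      using AE_regular
    proof eventually_elim
      case (elim w)
      have "norm (urn_counts chi n w) \<le> (\<Sum>k=1..n. norm (chi k w))"
        unfolding urn_counts_def by (rule norm_sum)
      also have "\<dots> \<le> (\<Sum>k=1..n. 1)"
      proof (rule sum_mono)
        fix k assume "k \<in> {1..n}"
        then obtain m where k: "k = Suc m" by (cases k) auto
        obtain i where "chi (Suc m) w = axis i 1" using elim by (rule regular_draw)
        thus "norm (chi k w) \<le> 1" by (simp add: k norm_axis_1)
      qed
      finally show ?case by (cases "n = 0") (simp_all add: divide_le_eq field_simps)
    qed
  qed
  ultimately show ?thesis using as1 as2 as3 as4 by (simp add: tendsto_as_and_L1_def)
qed

end
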